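(* Let $X=X(\mathbb R)$ be a Banach lattice on $\mathbb R$ satisfying Assumption A, and let $r,s\in\mathbb N$ with $2r\ge s$. Let $\mathcal K_{\sigma,r}$ be the Kantorovich-type operators described in the context, and suppose that there exist constants $C_1,C_2,C_3>0$ such that $$\|\mathcal K_{\sigma,r}f\|_X\le C_1\|f\|_X\quad\text{for all } f\in X,\ \sigma\ge1,$$ $$\|g-\mathcal K_{\sigma,r}g\|_X\le C_2\,\sigma^{-s}\|g^{(s)}\|_X\quad\text{for all } g\in\mathcal B_X^\sigma,\ \sigma\ge1,$$ $$C_3\,\sigma^{-s}\|\varphi^{(s)}\|_X\le\|\varphi-\mathcal K_{\sigma,r}\varphi\|_X\quad\text{for all } \varphi\in\Phi_\sigma,\ \sigma\ge1.$$ Then for all $f\in X$ and all $\sigma\ge1$ $$\|f-\mathcal K_{\sigma,r}f\|_X\asymp\|(I-\dot A_{\gamma/\sigma})^s f\|_X,$$ where $\asymp$ denotes a two-sided inequality with positive constants independent of $f$ and $\sigma$.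
   Context: **Banach lattice.** $\mu$ is Lebesgue measure on $\mathbb R$. A Banach lattice $X$ on $\mathbb R$ is a Banach space of measurable functions on $\mathbb R$ with norm $\|\cdot\|_X$ such that: (1) if $f$ is measurable, $g\in X$ and $|f|\le|g|$, then $f\in X$ and $\|f\|_X\le\|g\|_X$; (2) if $f_n\in X$, $\sup_n\|f_n\|_X<\infty$ and $0\le f_n\uparrow f$, then $f\in X$ and $\|f_n\|_X\to\|f\|_X$; (3) if $E\subset\mathbb R$ is measurable with $\mu(E)<\infty$, then $\chi_E\in X$ and there is $c_E>0$ with $\int_E|f|\,d\mu\le c_E\|f\|_X$ for all $f\in X$. **Steklov averages.** For locally integrable $f$ and $h>0$: $A_hf(x)=\frac1h\int_{x-h/2}^{x+h/2}f(t)\,dt$, $\dot A_hf(x)=A_hf(x+h/2)=\frac1h\int_x^{x+h}f(t)\,dt$, and $A_{h,r}f=\sum_{k=1}^r(-1)^{k+1}\binom rk A_h^kf=f-(I-A_h)^rf$. **Assumption A.** For all $f\in X$ and $h>0$, $A_hf\in X$, and $\sup_{h>0}\sup_{\|f\|_X\le1}\|A_hf\|_X<\infty$. **Spaces.** $\mathcal B_X^\sigma=\{\varphi\in X\cap\mathcal S'(\mathbb R):\operatorname{supp}\widehat\varphi\subset[-\sigma,\sigma]\}$, with $\widehat\varphi$ the distributional Fourier transform. $(\Phi_\sigma)_{\sigma}$ is a nested family of linear subspaces of $X$ ($\Phi_{\sigma'}\subset\Phi_\sigma$ for $\sigma'\le\sigma$, $\Phi_0=\{0\}$) satisfying the Bernstein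 inequality: there is $B>0$ depending only on $X$ with $\|\varphi^{(k)}\|_X\le(B\sigma)^k\|\varphi\|_X$ for all $k\in\mathbb N$, $\varphi\in\Phi_\sigma$ (in particular the derivatives exist and lie in $X$). **Operators.** $\varphi_{k,\sigma}\in\Phi_\sigma$, $k\in\mathbb Z$, and $(x_{k,\sigma})_{k\in\mathbb Z}\subset\mathbb R$ are distinct points for which there are positive constants $\gamma,\gamma'$ (independent of $\sigma,k$) with $\frac\gamma\sigma\le x_{k+1,\sigma}-x_{k,\sigma}\le\frac{\gamma'}\sigma$, $k\in\mathbb Z$. Then $$\mathcal K_{\sigma,r}f(x)=\sum_{k\in\mathbb Z}A_{\gamma/\sigma,r}f(x_{k,\sigma})\,\varphi_{k,\sigma}(x).$$ **Standing assumptions.** The series defining $\mathcal K_{\sigma,r}f$ converges in the norm of $X$ for every $f\in X$. To guarantee this when the kernels $\varphi_{k,\sigma}$ are not compactly supported, it is additionally required that $X$ has order continuous norm ($f_n\downarrow0$ a.e. implies $\|f_n\|_X\to0$) and contains the Schwartz space $\mathcal S$ as a dense subspace. *)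

theory Defs
  imports "HOL-Analysis.Analysis"
begin

text \<open>
  A space of measurable functions is a set \<open>X\<close> of complex-valued functions together with a
  real-valued function \<open>N\<close>, of which only the values on \<open>X\<close> matter. Elements of \<open>X\<close> are
  representatives: functions that agree almost everywhere are identified, so pointwise relations
  between elements are required almost everywhere and \<open>N\<close> is definite up to null functions.
  By \<open>ideal\<close>, both \<open>X\<close> and \<open>N\<close> respect almost-everywhere equality.
\<close>

locale banach_lattice =
  fixes X :: "(real \<Rightarrow> complex) set"
    and N :: "(real \<Rightarrow> complex) \<Rightarrow> real"
  assumes measurable: "f \<in> X \<Longrightarrow> f \<in> borel_measurable lebesgue"
    and add_closed: "f \<in> X \<Longrightarrow> g \<in> X \<Longrightarrow> (\<lambda>x. f x + g x) \<in> X"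
    and scale_closed: "f \<in> X \<Longrightarrow> (\<lambda>x. c * f x) \<in> X"
    and norm_nonneg: "f \<in> X \<Longrightarrow> 0 \<le> N f"
    and norm_triangle: "f \<in> X \<Longrightarrow> g \<in> X \<Longrightarrow> N (\<lambda>x. f x + g x) \<le> N f + N g"
    and norm_scale: "f \<in> X \<Longrightarrow> N (\<lambda>x. c * f x) = cmod c * N f"
    and norm_definite: "f \<in> X \<Longrightarrow> N f = 0 \<Longrightarrow> AE x in lebesgue. f x = 0"
    and complete:
      "\<And>u :: nat \<Rightarrow> real \<Rightarrow> complex.
        (\<And>n. u n \<in> X) \<Longrightarrow>
        (\<And>e. e > 0 \<Longrightarrow> \<exists>M. \<forall>m\<ge>M. \<forall>n\<ge>M. N (\<lambda>x. u m x - u n x) < e) \<Longrightarrow>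
        \<exists>f\<in>X. (\<lambda>n. N (\<lambda>x. u n x - f x)) \<longlonglongrightarrow> 0"
    and ideal:
      "f \<in> borel_measurable lebesgue \<Longrightarrow> g \<in> X \<Longrightarrow>
        (AE x in lebesgue. cmod (f x) \<le> cmod (g x)) \<Longrightarrow> f \<in> X \<and> N f \<le> N g"
    and fatou:
      "\<And>(u :: nat \<Rightarrow> real \<Rightarrow> real) (v :: real \<Rightarrow> real).
        (\<And>n. (\<lambda>x. complex_of_real (u n x)) \<in> X) \<Longrightarrow>
        bdd_above (range (\<lambda>n. N (\<lambda>x. complex_of_real (u n x)))) \<Longrightarrow>
        (AE x in lebesgue.
          (\<forall>n. 0 \<le> u n x) \<and> incseq (\<lambda>n. u n x) \<and> (\<lambda>n. u n x) \<longlonglongrightarrow> v x) \<Longrightarrow>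
        (\<lambda>x. complex_of_real (v x)) \<in> X \<and>
        (\<lambda>n. N (\<lambda>x. complex_of_real (u n x))) \<longlonglongrightarrow> N (\<lambda>x. complex_of_real (v x))"
    and indicator_mem:
      "E \<in> sets lebesgue \<Longrightarrow> emeasure lebesgue E < \<infinity> \<Longrightarrow>
        (\<lambda>x. complex_of_real (indicator E x)) \<in> X"
    and integral_bound:
      "E \<in> sets lebesgue \<Longrightarrow> emeasure lebesgue E < \<infinity> \<Longrightarrow>
        \<exists>c>0. \<forall>f\<in>X. (\<integral>\<^sup>+x\<in>E. ennreal (cmod (f x)) \<partial>lebesgue) \<le> ennreal (c * N f)"

text \<open>Linear subspaces need not be saturated under almost-everywhere equality.\<close>

definition linear_subspace_of :: "(real \<Rightarrow> complex) set \<Rightarrow> (real \<Rightarrow> complex) set \<Rightarrow> bool" where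
  "linear_subspace_of V X \<longleftrightarrow>
     V \<subseteq> X \<and> (\<lambda>x. 0) \<in> V \<and>
     (\<forall>f\<in>V. \<forall>g\<in>V. (\<lambda>x. f x + g x) \<in> V) \<and>
     (\<forall>c. \<forall>f\<in>V. (\<lambda>x. c * f x) \<in> V)"

definition order_continuous_norm ::
    "(real \<Rightarrow> complex) set \<Rightarrow> ((real \<Rightarrow> complex) \<Rightarrow> real) \<Rightarrow> bool" where
  "order_continuous_norm X N \<longleftrightarrow>
     (\<forall>u :: nat \<Rightarrow> real \<Rightarrow> real.
        (\<forall>n. (\<lambda>x. complex_of_real (u n x)) \<in> X) \<longrightarrow>
        (AE x in lebesgue. decseq (\<lambda>n. u n x) \<and> (\<lambda>n. u n x) \<longlonglongrightarrow> 0) \<longrightarrow>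
        (\<lambda>n. N (\<lambda>x. complex_of_real (u n x))) \<longlonglongrightarrow> 0)"

definition has_series_sum ::
    "(real \<Rightarrow> complex) set \<Rightarrow> ((real \<Rightarrow> complex) \<Rightarrow> real) \<Rightarrow>
     (int \<Rightarrow> real \<Rightarrow> complex) \<Rightarrow> (real \<Rightarrow> complex) \<Rightarrow> bool" where
  "has_series_sum X N u g \<longleftrightarrow>
     g \<in> X \<and> (\<lambda>n. N (\<lambda>x. (\<Sum>k\<in>{- int n..int n}. u k x) - g x)) \<longlonglongrightarrow> 0"

text \<open>The sum is determined up to almost-everywhere equality when the series converges.\<close>

definition series_sum ::
    "(real \<Rightarrow> complex) set \<Rightarrow> ((real \<Rightarrow> complex) \<Rightarrow> real) \<Rightarrow>
     (int \<Rightarrow> real \<Rightarrow> complex) \<Rightarrow> real \<Rightarrow> complex" where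
  "series_sum X N u = (SOME g. has_series_sum X N u g)"

definition steklov :: "real \<Rightarrow> (real \<Rightarrow> complex) \<Rightarrow> real \<Rightarrow> complex" where
  "steklov h f x = (LINT t:{x - h/2..x + h/2}|lebesgue. f t) / of_real h"

definition steklov_fwd :: "real \<Rightarrow> (real \<Rightarrow> complex) \<Rightarrow> real \<Rightarrow> complex" where
  "steklov_fwd h f x = steklov h f (x + h/2)"

definition steklov_comb :: "real \<Rightarrow> nat \<Rightarrow> (real \<Rightarrow> complex) \<Rightarrow> real \<Rightarrow> complex" where
  "steklov_comb h r f x =
     (\<Sum>k = 1..r. (-1) ^ (k + 1) * of_nat (r choose k) * (steklov h ^^ k) f x)"

definition steklov_diff :: "real \<Rightarrow> nat \<Rightarrow> (real \<Rightarrow> complex) \<Rightarrow> real \<Rightarrow> complex" where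
  "steklov_diff h s f = ((\<lambda>g x. g x - steklov_fwd h g x) ^^ s) f"

definition steklov_bounded :: "(real \<Rightarrow> complex) set \<Rightarrow> ((real \<Rightarrow> complex) \<Rightarrow> real) \<Rightarrow> bool" where
  "steklov_bounded X N \<longleftrightarrow>
     (\<forall>f\<in>X. \<forall>h>0. steklov h f \<in> X) \<and>
     (\<exists>C. \<forall>h>0. \<forall>f\<in>X. N f \<le> 1 \<longrightarrow> N (steklov h f) \<le> C)"

definition nth_vderiv :: "nat \<Rightarrow> (real \<Rightarrow> complex) \<Rightarrow> real \<Rightarrow> complex" where
  "nth_vderiv n f = ((\<lambda>g x. vector_derivative g (at x)) ^^ n) f"

definition times_differentiable :: "nat \<Rightarrow> (real \<Rightarrow> complex) \<Rightarrow> bool" where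
  "times_differentiable n f \<longleftrightarrow> (\<forall>i<n. \<forall>x. nth_vderiv i f differentiable (at x))"

definition smooth_fun :: "(real \<Rightarrow> complex) \<Rightarrow> bool" where
  "smooth_fun f \<longleftrightarrow> (\<forall>n. times_differentiable n f)"

text \<open>
  The derivative of an equivalence class modulo null functions is that of a representative which
  is differentiable \<open>n\<close> times at every point; for \<open>n \<ge> 1\<close> there is at most one such
  representative. (Almost-everywhere derivatives would be inadequate: step functions would
  have derivative zero.)
\<close>

definition differentiable_rep :: "nat \<Rightarrow> (real \<Rightarrow> complex) \<Rightarrow> (real \<Rightarrow> complex) \<Rightarrow> bool" where
  "differentiable_rep n f F \<longleftrightarrow> times_differentiable n F \<and> (AE x in lebesgue. F x = f x)"

definition class_deriv :: "nat \<Rightarrow> (real \<Rightarrow> complex) \<Rightarrow> real \<Rightarrow> complex" where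
  "class_deriv n f = nth_vderiv n (SOME F. differentiable_rep n f F)"

definition schwartz :: "(real \<Rightarrow> complex) set" where
  "schwartz = {\<psi>. smooth_fun \<psi> \<and>
     (\<forall>m n. bounded (range (\<lambda>x. of_real (x ^ m) * nth_vderiv n \<psi> x)))}"

definition schwartz_seminorm :: "nat \<Rightarrow> nat \<Rightarrow> (real \<Rightarrow> complex) \<Rightarrow> real" where
  "schwartz_seminorm m n \<psi> = (SUP x. cmod (of_real (x ^ m) * nth_vderiv n \<psi> x))"

definition test_fun :: "(real \<Rightarrow> complex) set" where
  "test_fun = {\<psi>. smooth_fun \<psi> \<and> compact (closure {x. \<psi> x \<noteq> 0})}"

text \<open>Only the values of \<open>T\<close> on \<^const>\<open>schwartz\<close> matter.\<close>

definition tempered :: "((real \<Rightarrow> complex) \<Rightarrow> complex) \<Rightarrow> bool" where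
  "tempered T \<longleftrightarrow>
     (\<forall>\<psi>\<in>schwartz. \<forall>\<theta>\<in>schwartz. T (\<lambda>x. \<psi> x + \<theta> x) = T \<psi> + T \<theta>) \<and>
     (\<forall>c. \<forall>\<psi>\<in>schwartz. T (\<lambda>x. c * \<psi> x) = c * T \<psi>) \<and>
     (\<exists>C M. \<forall>\<psi>\<in>schwartz. cmod (T \<psi>) \<le> C * (\<Sum>m\<le>M. \<Sum>n\<le>M. schwartz_seminorm m n \<psi>))"

text \<open>
  A locally integrable \<open>f\<close> is a tempered distribution if the distribution it induces on test
  functions extends to a (necessarily unique) tempered one; \<open>f * \<psi>\<close> need not be
  integrable for all Schwartz functions \<open>\<psi>\<close>.
\<close>

definition induces_tempered ::
    "(real \<Rightarrow> complex) \<Rightarrow> ((real \<Rightarrow> complex) \<Rightarrow> complex) \<Rightarrow> bool" where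
  "induces_tempered f T \<longleftrightarrow>
     tempered T \<and> (\<forall>\<psi>\<in>test_fun. T \<psi> = (LINT x|lebesgue. f x * \<psi> x))"

definition fourier :: "(real \<Rightarrow> complex) \<Rightarrow> real \<Rightarrow> complex" where
  "fourier \<psi> \<xi> = (LINT x|lebesgue. \<psi> x * cis (- (\<xi> * x)))"

definition fourier_dist ::
    "((real \<Rightarrow> complex) \<Rightarrow> complex) \<Rightarrow> (real \<Rightarrow> complex) \<Rightarrow> complex" where
  "fourier_dist T \<psi> = T (fourier \<psi>)"

definition dist_support :: "((real \<Rightarrow> complex) \<Rightarrow> complex) \<Rightarrow> real set" where
  "dist_support T =
     - \<Union>{V. open V \<and> (\<forall>\<psi>\<in>test_fun. closure {x. \<psi> x \<noteq> 0} \<subseteq> V \<longrightarrow> T \<psi> = 0)}"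

definition bandlimited :: "(real \<Rightarrow> complex) set \<Rightarrow> real \<Rightarrow> (real \<Rightarrow> complex) set" where
  "bandlimited X \<sigma> =
     {f \<in> X. \<exists>T. induces_tempered f T \<and> dist_support (fourier_dist T) \<subseteq> {-\<sigma>..\<sigma>}}"

definition bernstein_family ::
    "(real \<Rightarrow> complex) set \<Rightarrow> ((real \<Rightarrow> complex) \<Rightarrow> real) \<Rightarrow>
     (real \<Rightarrow> (real \<Rightarrow> complex) set) \<Rightarrow> bool" where
  "bernstein_family X N \<Phi> \<longleftrightarrow>
     (\<forall>\<sigma>\<ge>0. linear_subspace_of (\<Phi> \<sigma>) X) \<and>
     (\<forall>\<sigma>' \<sigma>. 0 \<le> \<sigma>' \<longrightarrow> \<sigma>' \<le> \<sigma> \<longrightarrow> \<Phi> \<sigma>' \<subseteq> \<Phi> \<sigma>) \<and>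
     (\<forall>\<phi>\<in>\<Phi> 0. AE x in lebesgue. \<phi> x = 0) \<and>
     (\<exists>B>0. \<forall>\<sigma>\<ge>0. \<forall>\<phi>\<in>\<Phi> \<sigma>. \<forall>k.
        (\<exists>F. differentiable_rep k \<phi> F) \<and> class_deriv k \<phi> \<in> X \<and>
        N (class_deriv k \<phi>) \<le> (B * \<sigma>) ^ k * N \<phi>)"

definition kantorovich_term ::
    "real \<Rightarrow> nat \<Rightarrow> (int \<Rightarrow> real) \<Rightarrow> (int \<Rightarrow> real \<Rightarrow> complex) \<Rightarrow>
     (real \<Rightarrow> complex) \<Rightarrow> int \<Rightarrow> real \<Rightarrow> complex" where
  "kantorovich_term h r p \<phi> f k x = steklov_comb h r f (p k) * \<phi> k x"

definition kantorovich ::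
    "(real \<Rightarrow> complex) set \<Rightarrow> ((real \<Rightarrow> complex) \<Rightarrow> real) \<Rightarrow>
     real \<Rightarrow> nat \<Rightarrow> (int \<Rightarrow> real) \<Rightarrow> (int \<Rightarrow> real \<Rightarrow> complex) \<Rightarrow>
     (real \<Rightarrow> complex) \<Rightarrow> real \<Rightarrow> complex" where
  "kantorovich X N h r p \<phi> f = series_sum X N (kantorovich_term h r p \<phi> f)"

definition compactly_supported_ae :: "(real \<Rightarrow> complex) \<Rightarrow> bool" where
  "compactly_supported_ae f \<longleftrightarrow> (\<exists>R. AE x in lebesgue. \<bar>x\<bar> > R \<longrightarrow> f x = 0)"

definition dense_in ::
    "((real \<Rightarrow> complex) \<Rightarrow> real) \<Rightarrow> (real \<Rightarrow> complex) set \<Rightarrow> (real \<Rightarrow> complex) set \<Rightarrow> bool" where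
  "dense_in N D X \<longleftrightarrow> D \<subseteq> X \<and> (\<forall>f\<in>X. \<forall>e>0. \<exists>\<psi>\<in>D. N (\<lambda>x. f x - \<psi> x) < e)"

end

theory Submission
  imports Defs
begin

text \<open>
  Put \<open>h = \<gamma> / \<sigma>\<close>. Acting on Borel representatives, the forward average is the convolution with
  the indicator of \<open>[0, 1]\<close> at scale \<open>h\<close>, and every operator of the proof is a convolution whose
  kernel is dominated by a multiple of \<open>1 / (1 + t\<^sup>2)\<close>, or a polynomial in such convolutions. They
  are bounded on \<open>X\<close> uniformly in \<open>h\<close> (\<open>poisson_bound\<close>, \<open>conv_mem\<close>), because \<open>1 / (1 + t\<^sup>2)\<close> is dominated
  by a geometric series of kernels of Steklov averages. They commute (\<open>conv_commute\<close>), so an estimate for \<open>s = 1\<close> can be raised to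
  the power \<open>s\<close> (\<open>funpow_dominated\<close>).

  Lower bound. The smooth functions \<open>\<psi>\<close> of \<open>\<Phi>\<^sub>\<sigma>\<close> satisfy \<open>\<psi> - A \<psi> = - h T \<psi>'\<close> with \<open>A\<close> the forward
  average and \<open>T\<close> another convolution, so that the \<open>s\<close>-th difference of \<open>\<psi>\<close> is at most
  \<open>C h\<^sup>s \<parallel>\<psi>\<^sup>(\<^sup>s\<^sup>)\<parallel>\<close>, which by the hypothesis on \<open>\<Phi>\<^sub>\<sigma>\<close> is at most \<open>C \<parallel>\<psi> - K \<psi>\<parallel>\<close>. For \<open>\<psi>\<close> a partial sum of
  the series \<open>K f\<close> the right-hand side tends to \<open>C \<parallel>K f - K (K f)\<parallel> \<le> C C\<^sub>1 \<parallel>f - K f\<parallel>\<close>.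

  Upper bound. It suffices to find a band-limited \<open>g\<close> for which \<open>\<parallel>f - g\<parallel>\<close> and \<open>h\<^sup>s \<parallel>g\<^sup>(\<^sup>s\<^sup>)\<parallel>\<close> are both
  at most \<open>C \<parallel>(1 - A)\<^sup>s f\<parallel>\<close>; then \<open>f - K f\<close> is split at \<open>g\<close>. The key is the exact factorization
  \<open>1 - A = (1 - R) (1 - E)\<close> (\<open>ramp_convolve_exp\<close>), where \<open>E\<close> has the exponential kernel and is the
  resolvent of the derivative, \<open>h (E v)' = E v - v\<close>, and \<open>R\<close> has the kernel \<open>t\<close> on \<open>[0, 1]\<close>. As \<open>R\<close>
  has total mass \<open>1 / 2\<close>, its powers tend to zero on \<open>X\<close> and \<open>1 - R\<close> is bounded below; hence
  \<open>\<parallel>(1 - E) f\<parallel> \<le> C \<parallel>(1 - A) f\<parallel>\<close> (\<open>resolvent_dominated_by_box\<close>). With \<open>J\<close> the convolution with a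
  normalized fourth power of the cardinal sine, the operator \<open>B = J E\<^sup>s\<^sup>+\<^sup>1\<close> has band-limited values, and
  \<open>\<parallel>f - B f\<parallel> \<le> C \<parallel>(1 - E) f\<parallel>\<close> since increments of \<open>E f\<close> are integrals of \<open>f - E f\<close>
  (\<open>averaged_resolvent_error\<close>). The choice \<open>g = f - (1 - B)\<^sup>s f\<close> has both properties: \<open>g\<close> lies in
  the range of \<open>B\<close>, whose factor \<open>E\<^sup>s\<close> turns \<open>s\<close> derivatives into \<open>(1 - E)\<^sup>s\<close>
  (\<open>bandlimited_approximation\<close>).

  That \<open>g\<close> is band-limited in the sense of distributions (\<open>jackson_bandlimited\<close>) only requires
  Fourier inversion at points outside the support of a test function, where it is elementary.
\<close>

section \<open>Lattices of functions on which the Steklov averages are bounded\<close>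

locale steklov_lattice = banach_lattice +
  fixes A :: real
  assumes steklov_mem: "f \<in> X \<Longrightarrow> 0 < h \<Longrightarrow> steklov h f \<in> X"
    and steklov_le: "f \<in> X \<Longrightarrow> 0 < h \<Longrightarrow> N (steklov h f) \<le> A * N f"
    and A_nonneg: "0 \<le> A"

context banach_lattice
begin

lemma zero_mem: "(\<lambda>x. 0) \<in> X"
  using indicator_mem[of "{}"] by simp

lemma norm_zero: "N (\<lambda>x. 0) = 0"
  using norm_scale[OF zero_mem, of 0] by simp

lemma diff_closed: "f \<in> X \<Longrightarrow> g \<in> X \<Longrightarrow> (\<lambda>x. f x - g x) \<in> X"
  using add_closed[OF _ scale_closed[of g "-1"], of f] by simp

lemma norm_diff_triangle: "f \<in> X \<Longrightarrow> g \<in> X \<Longrightarrow> N (\<lambda>x. f x - g x) \<le> N f + N g"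
  using norm_triangle[OF _ scale_closed[of g "-1"], of f] norm_scale[of g "-1"] by simp

lemma norm_swap: "f \<in> X \<Longrightarrow> g \<in> X \<Longrightarrow> N (\<lambda>x. f x - g x) = N (\<lambda>x. g x - f x)"
  using norm_scale[OF diff_closed[of g f], of "-1"] by simp

lemma norm_le_diff_add: "f \<in> X \<Longrightarrow> g \<in> X \<Longrightarrow> N f \<le> N (\<lambda>x. f x - g x) + N g"
  using norm_triangle[OF diff_closed[of f g], of g] by simp

lemma norm_diff_le_via:
  assumes "f \<in> X" "g \<in> X" "k \<in> X"
  shows "N (\<lambda>x. f x - k x) \<le> N (\<lambda>x. f x - g x) + N (\<lambda>x. g x - k x)"
  using norm_triangle[OF diff_closed[of f g] diff_closed[of g k]] assms by simp

lemma AE_eq_mem: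
  assumes "f \<in> X" "g \<in> borel_measurable lebesgue" "AE x in lebesgue. f x = g x"
  shows "g \<in> X" "N g = N f"
proof -
  have gX: "g \<in> X \<and> N g \<le> N f"
    using assms(3) by (intro ideal[OF assms(2,1)]) auto
  moreover have "f \<in> X \<and> N f \<le> N g"
    using assms(3) gX by (intro ideal[OF measurable[OF assms(1)]]) auto
  ultimately show "g \<in> X" "N g = N f" by auto
qed

lemma norm_AE_cong:
  assumes "f \<in> X" "g \<in> X" "AE x in lebesgue. f x = g x"
  shows "N g = N f"
  using AE_eq_mem[OF assms(1) measurable[OF assms(2)] assms(3)] by simp

lemma cmod_mem:
  assumes "f \<in> X"
  shows "(\<lambda>x. complex_of_real (cmod (f x))) \<in> X" "N (\<lambda>x. complex_of_real (cmod (f x))) = N f"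
proof -
  note [measurable] = measurable[OF assms]
  have "(\<lambda>x. complex_of_real (cmod (f x))) \<in> X \<and> N (\<lambda>x. complex_of_real (cmod (f x))) \<le> N f"
    by (intro ideal[OF _ assms]) auto
  moreover from this have "f \<in> X \<and> N f \<le> N (\<lambda>x. complex_of_real (cmod (f x)))"
    by (intro ideal) auto
  ultimately show "(\<lambda>x. complex_of_real (cmod (f x))) \<in> X"
      "N (\<lambda>x. complex_of_real (cmod (f x))) = N f" by auto
qed

lemma sum_mem_norm_le:
  assumes "\<And>j. j \<in> J \<Longrightarrow> u j \<in> X"
  shows "(\<lambda>x. \<Sum>j\<in>J. u j x) \<in> X \<and> N (\<lambda>x. \<Sum>j\<in>J. u j x) \<le> (\<Sum>j\<in>J. N (u j))"
  using assms
proof (induction J rule: infinite_finite_induct)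
  case (insert a J)
  then have "(\<lambda>x. u a x + (\<Sum>j\<in>J. u j x)) \<in> X"
    by (intro add_closed) auto
  moreover have "N (\<lambda>x. u a x + (\<Sum>j\<in>J. u j x)) \<le> N (u a) + N (\<lambda>x. \<Sum>j\<in>J. u j x)"
    using insert by (intro norm_triangle) auto
  moreover have "N (\<lambda>x. \<Sum>j\<in>J. u j x) \<le> (\<Sum>j\<in>J. N (u j))"
    using insert by auto
  ultimately show ?case
    using insert.hyps by (auto simp: sum.insert)
qed (auto simp: zero_mem norm_zero)

definition XB :: "(real \<Rightarrow> complex) set" where
  "XB = {f \<in> X. f \<in> borel_measurable borel}"

lemma XB_X: "f \<in> XB \<Longrightarrow> f \<in> X"
  and XB_measurable[measurable_dest]: "f \<in> XB \<Longrightarrow> f \<in> borel_measurable borel"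
  by (auto simp: XB_def)

lemma XB_diff: "f \<in> XB \<Longrightarrow> g \<in> XB \<Longrightarrow> (\<lambda>x. f x - g x) \<in> XB"
  and XB_scale: "f \<in> XB \<Longrightarrow> (\<lambda>x. c * f x) \<in> XB"
  by (auto simp: XB_def diff_closed scale_closed)

lemma borel_imp_lebesgue: "f \<in> borel_measurable borel \<Longrightarrow> f \<in> borel_measurable lebesgue"
  by (rule measurable_completion) simp

lemma XB_ideal:
  assumes "f \<in> borel_measurable borel" "g \<in> X" "\<And>x. cmod (f x) \<le> cmod (g x)"
  shows "f \<in> XB" "N f \<le> N g"
  using ideal[OF borel_imp_lebesgue[OF assms(1)] assms(2)] assms by (auto simp: XB_def)

text \<open>
  For a Lebesgue measurable \<open>f\<close> the function \<open>f (x + h t)\<close> of two variables need not be measurable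
  for the product of the Lebesgue \<open>\<sigma>\<close>-algebras, as Fubini arguments require; for a Borel
  representative it is.
\<close>

lemma ex_borel_representative:
  assumes "f \<in> X"
  obtains g where "g \<in> XB" "AE x in lebesgue. f x = g x"
proof -
  note [measurable] = measurable[OF assms]
  have "(\<lambda>x. Re (f x)) \<in> borel_measurable (completion lborel)"
       "(\<lambda>x. Im (f x)) \<in> borel_measurable (completion lborel)"
    by measurable
  then obtain a b where ab: "a \<in> borel_measurable lborel" "AE x in lborel. Re (f x) = a x"
      "b \<in> borel_measurable lborel" "AE x in lborel. Im (f x) = b x"
    using completion_ex_borel_measurable_real by metis
  define g where "g = (\<lambda>x. Complex (a x) (b x))"
  have g: "g \<in> borel_measurable borel"
    using ab unfolding g_def by (simp add: borel_measurable_complex_iff)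
  have eq: "AE x in lebesgue. f x = g x"
    using AE_completion[OF ab(2)] AE_completion[OF ab(4)]
    by eventually_elim (simp add: g_def complex_eq_iff)
  show thesis
    using that[of g] AE_eq_mem(1)[OF assms borel_imp_lebesgue[OF g] eq] g eq by (auto simp: XB_def)
qed

lemma set_integrable_interval:
  assumes "f \<in> X"
  shows "set_integrable lebesgue {a..b} f"
proof -
  note [measurable] = measurable[OF assms]
  obtain c where c: "\<forall>f\<in>X. (\<integral>\<^sup>+x\<in>{a..b}. ennreal (cmod (f x)) \<partial>lebesgue) \<le> ennreal (c * N f)"
    using integral_bound[of "{a..b}"] emeasure_lborel_Icc_eq[of a b] by auto
  have "(\<integral>\<^sup>+x. ennreal (cmod (indicator {a..b} x *\<^sub>R f x)) \<partial>lebesgue)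
      = (\<integral>\<^sup>+x\<in>{a..b}. ennreal (cmod (f x)) \<partial>lebesgue)"
    by (intro nn_integral_cong) (auto simp: indicator_def)
  also have "\<dots> < \<infinity>"
    using bspec[OF c assms] by (simp add: le_less_trans)
  finally show ?thesis
    unfolding set_integrable_def
    by (intro integrableI_bounded borel_measurable_scaleR measurable[OF assms]
        borel_measurable_indicator) auto
qed

lemma XB_set_integrable:
  assumes "f \<in> XB"
  shows "set_integrable lborel {a..b} f"
  using set_integrable_interval[OF XB_X[OF assms]] XB_measurable[OF assms]
  unfolding set_integrable_def by (subst (asm) integrable_completion) auto

definition mass :: "(real \<Rightarrow> complex) \<Rightarrow> real \<Rightarrow> real \<Rightarrow> real" where
  "mass f x r = (LINT t:{x - r..x + r}|lborel. cmod (f t))"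

lemma XB_set_integrable_cmod: "f \<in> XB \<Longrightarrow> set_integrable lborel {a..b} (\<lambda>x. cmod (f x))"
  using set_integrable_norm[OF XB_set_integrable] by simp

lemma mass_mono:
  assumes "f \<in> XB" "{x - r..x + r} \<subseteq> {y - q..y + q}"
  shows "mass f x r \<le> mass f y q"
  unfolding mass_def set_lebesgue_integral_def
  using XB_set_integrable_cmod[OF assms(1)] assms(2)
  by (intro integral_mono) (auto simp: set_integrable_def indicator_def)

lemma mass_nonneg: "0 \<le> mass f x r"
  unfolding mass_def set_lebesgue_integral_def by (intro integral_nonneg_AE) auto

lemma ennreal_mass:
  assumes "f \<in> XB"
  shows "ennreal (mass f x r) = (\<integral>\<^sup>+t\<in>{x - r..x + r}. ennreal (cmod (f t)) \<partial>lborel)"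
proof -
  have "ennreal (mass f x r) = (\<integral>\<^sup>+t. ennreal (indicator {x - r..x + r} t *\<^sub>R cmod (f t)) \<partial>lborel)"
    using XB_set_integrable_cmod[OF assms] unfolding mass_def set_lebesgue_integral_def set_integrable_def
    by (intro nn_integral_eq_integral[symmetric]) auto
  also have "\<dots> = (\<integral>\<^sup>+t\<in>{x - r..x + r}. ennreal (cmod (f t)) \<partial>lborel)"
    by (intro nn_integral_cong) (auto simp: indicator_def)
  finally show ?thesis .
qed

lemma steklov_eq_mass:
  assumes "f \<in> XB" "0 < r"
  shows "steklov (2 * r) (\<lambda>x. complex_of_real (cmod (f x))) x = complex_of_real (mass f x r / (2 * r))"
proof -
  note [measurable] = XB_measurable[OF assms(1)]
  have "(LINT t:{x - r..x + r}|lebesgue. complex_of_real (cmod (f t)))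
     = (LINT t|lborel. complex_of_real (indicator {x - r..x + r} t * cmod (f t)))"
    unfolding set_lebesgue_integral_def
    by (subst integral_completion) (auto simp: scaleR_conv_of_real)
  also have "\<dots> = complex_of_real (mass f x r)"
    unfolding mass_def set_lebesgue_integral_def by (subst integral_complex_of_real) simp
  finally show ?thesis by (simp add: steklov_def)
qed

end

context steklov_lattice
begin

lemma mass_mem:
  assumes "f \<in> XB" "0 < r"
  shows "(\<lambda>x. complex_of_real (mass f x r)) \<in> X"
    "N (\<lambda>x. complex_of_real (mass f x r)) \<le> 2 * r * A * N f"
proof -
  let ?F = "\<lambda>x. complex_of_real (cmod (f x))"
  have "steklov (2 * r) ?F \<in> X" "N (steklov (2 * r) ?F) \<le> A * N f"
    using steklov_mem[of ?F] steklov_le[of ?F] cmod_mem[OF XB_X[OF assms(1)]] assms by auto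
  moreover have "(\<lambda>x. complex_of_real (mass f x r))
      = (\<lambda>x. complex_of_real (2 * r) * steklov (2 * r) ?F x)"
    using assms by (auto simp: steklov_eq_mass)
  ultimately show "(\<lambda>x. complex_of_real (mass f x r)) \<in> X"
    "N (\<lambda>x. complex_of_real (mass f x r)) \<le> 2 * r * A * N f"
    using scale_closed norm_scale assms by (auto simp: mult_left_mono)
qed

text \<open>
  Elements of the lattice grow at most linearly in the mean: for \<open>x\<close> in \<open>[-1, 1]\<close> the mass of
  \<open>f\<close> on \<open>[-r, r]\<close> is at most \<open>2 r + 2\<close> times the average of \<open>\<bar>f\<bar>\<close> over \<open>[x - r - 1, x + r + 1]\<close>,
  and these averages are bounded in norm, hence in \<open>L\<^sup>1[-1, 1]\<close>.
\<close>

lemma mass_growth: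
  assumes "f \<in> XB"
  obtains G where "0 \<le> G" "\<And>x r. 0 \<le> r \<Longrightarrow> mass f x r \<le> G * (\<bar>x\<bar> + r + 1)"
proof -
  obtain c where c: "c > 0"
      "\<forall>f\<in>X. (\<integral>\<^sup>+x\<in>{-1..1}. ennreal (cmod (f x)) \<partial>lebesgue) \<le> ennreal (c * N f)"
    using integral_bound[of "{-1..1::real}"] by auto
  have *: "mass f 0 r \<le> c * A * N f * (r + 1)" if "0 \<le> r" for r
  proof -
    have "ennreal (2 * mass f 0 r) = (\<integral>\<^sup>+x\<in>{-1..1::real}. ennreal (mass f 0 r) \<partial>lebesgue)"
      by (subst nn_integral_cmult_indicator) (auto simp: mult.commute ennreal_mult mass_nonneg)
    also have "\<dots> \<le> (\<integral>\<^sup>+x\<in>{-1..1}. ennreal (cmod (complex_of_real (mass f x (r + 1)))) \<partial>lebesgue)"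
      using mass_mono[OF assms, of 0 r _ "r + 1"]
      by (intro nn_integral_mono) (auto simp: mass_nonneg indicator_def intro!: ennreal_leI)
    also have "\<dots> \<le> ennreal (c * N (\<lambda>x. complex_of_real (mass f x (r + 1))))"
      using bspec[OF c(2) mass_mem(1)[OF assms, of "r + 1"]] that by simp
    also have "\<dots> \<le> ennreal (c * (2 * (r + 1) * A * N f))"
      using mass_mem(2)[OF assms, of "r + 1"] that c by (intro ennreal_leI mult_left_mono) auto
    finally have "2 * mass f 0 r \<le> c * (2 * (r + 1) * A * N f)"
      using that c A_nonneg norm_nonneg[OF XB_X[OF assms]] by (subst (asm) ennreal_le_iff) auto
    then show ?thesis by (simp add: algebra_simps)
  qed
  show thesis
  proof
    show "0 \<le> c * A * N f"
      using c A_nonneg norm_nonneg[OF XB_X[OF assms]] by simp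
    fix x r :: real assume "0 \<le> r"
    have "mass f x r \<le> mass f 0 (\<bar>x\<bar> + r)"
      by (intro mass_mono assms) auto
    then show "mass f x r \<le> c * A * N f * (\<bar>x\<bar> + r + 1)"
      using *[of "\<bar>x\<bar> + r"] \<open>0 \<le> r\<close> by simp
  qed
qed

subsection \<open>The Poisson majorant\<close>

text \<open>Up to the factor \<open>pi\<close>, the harmonic extension of \<open>\<bar>f\<bar>\<close> to the point at height \<open>h\<close> above \<open>x\<close>.\<close>

definition poisson :: "real \<Rightarrow> (real \<Rightarrow> complex) \<Rightarrow> real \<Rightarrow> real" where
  "poisson h f x = (LINT t|lborel. cmod (f (x + h * t)) / (1 + t\<^sup>2))"

lemma inverse_quadratic_le_dyadic:
  "\<exists>j. \<bar>t\<bar> \<le> 2 ^ j \<and> 1 / (1 + t\<^sup>2) \<le> 4 * (1 / 4 :: real) ^ j"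
proof -
  have ex: "\<exists>j. \<bar>t\<bar> \<le> 2 ^ j"
    using real_arch_pow[of 2 "\<bar>t\<bar>"] by (auto intro: less_imp_le)
  define j where "j = (LEAST j. \<bar>t\<bar> \<le> 2 ^ j)"
  have j: "\<bar>t\<bar> \<le> 2 ^ j" unfolding j_def using ex by (rule LeastI_ex)
  show ?thesis
  proof (cases j)
    case 0
    have "1 / (1 + t\<^sup>2) \<le> 1"
      by (subst divide_le_eq_1_pos) (auto simp: add_pos_nonneg)
    then show ?thesis using j 0 by (intro exI[of _ 0]) auto
  next
    case (Suc i)
    have "\<not> \<bar>t\<bar> \<le> 2 ^ i"
      using not_less_Least[of i "\<lambda>j. \<bar>t\<bar> \<le> 2 ^ j"] Suc unfolding j_def by auto
    then have "(2 ^ i)\<^sup>2 \<le> \<bar>t\<bar>\<^sup>2"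
      by (intro power_mono) auto
    moreover have "(2 ^ i)\<^sup>2 = (4 :: real) ^ i"
      by (simp add: power_mult[symmetric] mult.commute[of i] power_mult)
    ultimately have "4 ^ i \<le> 1 + t\<^sup>2" by simp
    then have "1 / (1 + t\<^sup>2) \<le> 1 / 4 ^ i"
      by (intro divide_left_mono) (auto simp: add_pos_nonneg)
    then have "1 / (1 + t\<^sup>2) \<le> 4 * (1 / 4) ^ j"
      using Suc by (simp add: power_one_over)
    then show ?thesis using j by auto
  qed
qed

lemma nn_integral_window:
  assumes "f \<in> XB" "0 < h"
  shows "(\<integral>\<^sup>+t\<in>{-r..r}. ennreal (cmod (f (x + h * t))) \<partial>lborel) = ennreal (mass f x (h * r) / h)"
proof -
  note [measurable] = XB_measurable[OF assms(1)]
  have "ennreal (mass f x (h * r))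
      = h * (\<integral>\<^sup>+t. ennreal (cmod (f (x + h * t))) * indicator {x - h * r..x + h * r} (x + h * t) \<partial>lborel)"
    unfolding ennreal_mass[OF assms(1)]
    using assms(2) by (subst nn_integral_real_affine[where c = h and t = x]) auto
  also have "(\<integral>\<^sup>+t. ennreal (cmod (f (x + h * t))) * indicator {x - h * r..x + h * r} (x + h * t) \<partial>lborel)
     = (\<integral>\<^sup>+t\<in>{-r..r}. ennreal (cmod (f (x + h * t))) \<partial>lborel)"
  proof (intro nn_integral_cong)
    fix t
    have "- (h * r) \<le> h * t \<longleftrightarrow> - r \<le> t" "h * t \<le> h * r \<longleftrightarrow> t \<le> r"
      using mult_le_cancel_left_pos[OF assms(2), of "- r" t] mult_le_cancel_left_pos[OF assms(2), of t r]
      by simp_all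
    then show "ennreal (cmod (f (x + h * t))) * indicator {x - h * r..x + h * r} (x + h * t)
        = ennreal (cmod (f (x + h * t))) * indicator {-r..r} t"
      by (auto simp: indicator_def)
  qed
  finally have "ennreal (1 / h) * ennreal (mass f x (h * r))
     = ennreal (1 / h) * (h * (\<integral>\<^sup>+t\<in>{-r..r}. ennreal (cmod (f (x + h * t))) \<partial>lborel))"
    by simp
  then show ?thesis
    using assms(2) by (simp add: mult.assoc[symmetric] ennreal_mult[symmetric] mass_nonneg)
qed

text \<open>
  The kernel \<open>1 / (1 + t\<^sup>2)\<close> is dominated by a geometrically weighted sum of indicators of the
  intervals \<open>[-2^j, 2^j]\<close>, so its convolution with \<open>\<bar>f\<bar>\<close> is dominated by a series of Steklov
  averages; the Fatou property of the lattice sums this series.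
\<close>

lemma poisson_bound:
  assumes f: "f \<in> XB" and h: "0 < h"
  shows poisson_integrable: "integrable lborel (\<lambda>t. cmod (f (x + h * t)) / (1 + t\<^sup>2))"
    and poisson_mem: "(\<lambda>x. complex_of_real (poisson h f x)) \<in> XB"
    and poisson_norm: "N (\<lambda>x. complex_of_real (poisson h f x)) \<le> 16 * A * N f"
proof -
  note [measurable] = XB_measurable[OF f]
  define w where "w j x = 4 * (1 / 4) ^ j * (mass f x (h * 2 ^ j) / h)" for j :: nat and x
  define u where "u n x = (\<Sum>j<n. w j x)" for n x
  obtain G where G: "0 \<le> G" "\<And>x r. 0 \<le> r \<Longrightarrow> mass f x r \<le> G * (\<bar>x\<bar> + r + 1)"
    using mass_growth[OF f] by blast
  have w_nonneg: "0 \<le> w j x" for j x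
    using h by (simp add: w_def mass_nonneg)
  have summable: "summable (\<lambda>j. w j x)" for x
  proof (rule summable_comparison_test)
    show "\<exists>n0. \<forall>j\<ge>n0. norm (w j x) \<le> 4 * G / h * ((\<bar>x\<bar> + 1) * (1 / 4) ^ j + h * (1 / 2) ^ j)"
    proof (intro exI allI impI)
      fix j
      have "norm (w j x) \<le> 4 * (1 / 4) ^ j * (G * (\<bar>x\<bar> + h * 2 ^ j + 1) / h)"
        using w_nonneg[of j x] h unfolding real_norm_def w_def
        by (simp add: divide_right_mono mult_left_mono G mass_nonneg abs_mult)
      also have "\<dots> = 4 * G / h * ((\<bar>x\<bar> + 1) * (1 / 4) ^ j + h * (1 / 2) ^ j)"
      proof -
        have "(1 / 4) ^ j * 2 ^ j = (1 / 2 :: real) ^ j"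
          by (simp add: power_mult_distrib[symmetric])
        then have "(1 / 4) ^ j * (\<bar>x\<bar> + h * 2 ^ j + 1) = (\<bar>x\<bar> + 1) * (1 / 4) ^ j + h * (1 / 2) ^ j"
          by (simp add: distrib_left distrib_right mult.left_commute mult.commute)
        moreover have "4 * q * (G * B / h) = 4 * G / h * (q * B)" for q B :: real
          by simp
        ultimately show ?thesis by (simp only:)
      qed
      finally show "norm (w j x) \<le> 4 * G / h * ((\<bar>x\<bar> + 1) * (1 / 4) ^ j + h * (1 / 2) ^ j)" .
    qed
    show "summable (\<lambda>j. 4 * G / h * ((\<bar>x\<bar> + 1) * (1 / 4) ^ j + h * (1 / 2) ^ j))"
      by (intro summable_mult summable_add summable_geometric) auto
  qed
  define S where "S x = (\<Sum>j. w j x)" for x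
  have S_nonneg: "0 \<le> S x" for x
    unfolding S_def using w_nonneg summable by (intro suminf_nonneg) auto
  have dom: "(\<integral>\<^sup>+t. ennreal (cmod (f (x + h * t)) / (1 + t\<^sup>2)) \<partial>lborel) \<le> ennreal (S x)" for x
  proof -
    have "(\<integral>\<^sup>+t. ennreal (cmod (f (x + h * t)) / (1 + t\<^sup>2)) \<partial>lborel)
       \<le> (\<integral>\<^sup>+t. (\<Sum>j. ennreal (4 * (1 / 4) ^ j) *
             (ennreal (cmod (f (x + h * t))) * indicator {- (2 ^ j)..2 ^ j} t)) \<partial>lborel)"
      (is "_ \<le> (\<integral>\<^sup>+t. (\<Sum>j. ?s t j) \<partial>lborel)")
    proof (intro nn_integral_mono)
      fix t :: real
      obtain j where j: "\<bar>t\<bar> \<le> 2 ^ j" "1 / (1 + t\<^sup>2) \<le> 4 * (1 / 4 :: real) ^ j"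
        using inverse_quadratic_le_dyadic by blast
      have "ennreal (cmod (f (x + h * t)) / (1 + t\<^sup>2))
          = ennreal (1 / (1 + t\<^sup>2)) * ennreal (cmod (f (x + h * t)))"
        by (subst ennreal_mult[symmetric]) auto
      also have "\<dots> \<le> ?s t j"
        using j by (auto simp: indicator_def intro!: mult_right_mono ennreal_leI)
      also have "\<dots> = (\<Sum>i\<in>{j}. ?s t i)" by simp
      also have "\<dots> \<le> (\<Sum>j. ?s t j)" by (rule sum_le_suminf) auto
      finally show "ennreal (cmod (f (x + h * t)) / (1 + t\<^sup>2)) \<le> (\<Sum>j. ?s t j)" .
    qed
    also have "\<dots> = (\<Sum>j. \<integral>\<^sup>+t. ?s t j \<partial>lborel)"
      by (rule nn_integral_suminf) auto
    also have "\<dots> = (\<Sum>j. ennreal (4 * (1 / 4) ^ j) *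
        (\<integral>\<^sup>+t\<in>{- (2 ^ j)..2 ^ j}. ennreal (cmod (f (x + h * t))) \<partial>lborel))"
      by (subst nn_integral_cmult) auto
    also have "\<dots> = (\<Sum>j. ennreal (w j x))"
      using h by (simp add: nn_integral_window[OF f h] w_def ennreal_mult[symmetric] mass_nonneg
          del: ennreal_suminf_cmult)
    also have "\<dots> = ennreal (S x)"
      unfolding S_def by (rule suminf_ennreal2[OF w_nonneg summable])
    finally show ?thesis .
  qed
  show int: "integrable lborel (\<lambda>t. cmod (f (x + h * t)) / (1 + t\<^sup>2))" for x
  proof (rule integrableI_bounded)
    have "(\<integral>\<^sup>+t. ennreal (norm (cmod (f (x + h * t)) / (1 + t\<^sup>2))) \<partial>lborel) \<le> ennreal (S x)"
      using dom by (simp add: abs_of_nonneg)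
    then show "(\<integral>\<^sup>+t. ennreal (norm (cmod (f (x + h * t)) / (1 + t\<^sup>2))) \<partial>lborel) < \<infinity>"
      by (simp add: le_less_trans)
  qed measurable
  have u_X: "(\<lambda>x. complex_of_real (u n x)) \<in> X" and
    u_N: "N (\<lambda>x. complex_of_real (u n x)) \<le> 16 * A * N f" for n
  proof -
    have 1: "(\<lambda>x. complex_of_real (w j x)) \<in> X"
      "N (\<lambda>x. complex_of_real (w j x)) \<le> 8 * A * N f * (1 / 2) ^ j" for j
    proof -
      have eq: "(\<lambda>x. complex_of_real (w j x))
          = (\<lambda>x. complex_of_real (4 * (1 / 4) ^ j / h) * complex_of_real (mass f x (h * 2 ^ j)))"
        by (auto simp: w_def)
      have m: "(\<lambda>x. complex_of_real (mass f x (h * 2 ^ j))) \<in> X"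
        "N (\<lambda>x. complex_of_real (mass f x (h * 2 ^ j))) \<le> 2 * (h * 2 ^ j) * A * N f"
        using mass_mem[OF f, of "h * 2 ^ j"] h by auto
      show "(\<lambda>x. complex_of_real (w j x)) \<in> X"
        unfolding eq by (rule scale_closed[OF m(1)])
      have "N (\<lambda>x. complex_of_real (w j x))
          = 4 * (1 / 4) ^ j / h * N (\<lambda>x. complex_of_real (mass f x (h * 2 ^ j)))"
        unfolding eq norm_scale[OF m(1)] norm_of_real using h by simp
      also have "\<dots> \<le> 4 * (1 / 4) ^ j / h * (2 * (h * 2 ^ j) * A * N f)"
        using h by (intro mult_left_mono m) auto
      also have "\<dots> = 8 * A * N f * ((1 / 4) ^ j * 2 ^ j)"
        using h by simp
      also have "(1 / 4) ^ j * 2 ^ j = (1 / 2 :: real) ^ j"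
        by (simp add: power_mult_distrib[symmetric])
      finally show "N (\<lambda>x. complex_of_real (w j x)) \<le> 8 * A * N f * (1 / 2) ^ j" .
    qed
    have *: "(\<lambda>x. complex_of_real (u n x)) = (\<lambda>x. \<Sum>j<n. complex_of_real (w j x))"
      by (simp add: u_def)
    show "(\<lambda>x. complex_of_real (u n x)) \<in> X"
      unfolding * using sum_mem_norm_le[of "{..<n}" "\<lambda>j x. complex_of_real (w j x)"] 1 by auto
    have "N (\<lambda>x. complex_of_real (u n x)) \<le> (\<Sum>j<n. N (\<lambda>x. complex_of_real (w j x)))"
      unfolding * using sum_mem_norm_le[of "{..<n}" "\<lambda>j x. complex_of_real (w j x)"] 1 by auto
    also have "\<dots> \<le> (\<Sum>j<n. 8 * A * N f * (1 / 2) ^ j)"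
      by (intro sum_mono 1)
    also have "\<dots> = 8 * A * N f * (\<Sum>j<n. (1 / 2) ^ j)"
      by (simp add: sum_distrib_left)
    also have "\<dots> \<le> 8 * A * N f * 2"
      using A_nonneg norm_nonneg[OF XB_X[OF f]]
      by (intro mult_left_mono) (auto simp: geometric_sum)
    finally show "N (\<lambda>x. complex_of_real (u n x)) \<le> 16 * A * N f" by simp
  qed
  have S: "(\<lambda>x. complex_of_real (S x)) \<in> X \<and>
      (\<lambda>n. N (\<lambda>x. complex_of_real (u n x))) \<longlonglongrightarrow> N (\<lambda>x. complex_of_real (S x))"
  proof (rule fatou)
    show "bdd_above (range (\<lambda>n. N (\<lambda>x. complex_of_real (u n x))))"
      using u_N by (auto intro!: bdd_aboveI2)
    show "AE x in lebesgue. (\<forall>n. 0 \<le> u n x) \<and> incseq (\<lambda>n. u n x) \<and> (\<lambda>n. u n x) \<longlonglongrightarrow> S x"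
    proof (intro AE_I2 conjI allI)
      fix x
      show "0 \<le> u n x" for n unfolding u_def by (intro sum_nonneg w_nonneg)
      show "incseq (\<lambda>n. u n x)"
        unfolding u_def by (intro incseq_SucI) (simp add: w_nonneg)
      show "(\<lambda>n. u n x) \<longlonglongrightarrow> S x"
        unfolding u_def S_def by (rule summable_LIMSEQ[OF summable])
    qed
  qed (rule u_X)
  have S_N: "N (\<lambda>x. complex_of_real (S x)) \<le> 16 * A * N f"
    using u_N by (intro LIMSEQ_le_const2[OF conjunct2[OF S]]) auto
  have P_le: "0 \<le> poisson h f x \<and> poisson h f x \<le> S x" for x
  proof
    show "0 \<le> poisson h f x" unfolding poisson_def by (intro integral_nonneg_AE) auto
    have "ennreal (poisson h f x) = (\<integral>\<^sup>+t. ennreal (cmod (f (x + h * t)) / (1 + t\<^sup>2)) \<partial>lborel)"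
      unfolding poisson_def by (rule nn_integral_eq_integral[OF int, symmetric]) auto
    then show "poisson h f x \<le> S x"
      using dom[of x] S_nonneg[of x] by (metis ennreal_le_iff)
  qed
  have meas: "(\<lambda>x. complex_of_real (poisson h f x)) \<in> borel_measurable borel"
    unfolding poisson_def by measurable
  have le: "cmod (complex_of_real (poisson h f x)) \<le> cmod (complex_of_real (S x))" for x
    using P_le[of x] by simp
  show "(\<lambda>x. complex_of_real (poisson h f x)) \<in> XB"
    by (rule XB_ideal(1)[OF meas conjunct1[OF S] le])
  show "N (\<lambda>x. complex_of_real (poisson h f x)) \<le> 16 * A * N f"
    using XB_ideal(2)[OF meas conjunct1[OF S] le] S_N by simp
qed

end

section \<open>Convolution operators and the algebra they generate\<close>

definition kernel :: "real \<Rightarrow> (real \<Rightarrow> real) \<Rightarrow> bool" where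
  "kernel M a \<longleftrightarrow> a \<in> borel_measurable borel \<and> (\<forall>t. \<bar>a t\<bar> \<le> M / (1 + t\<^sup>2))"

text \<open>
  The scale \<open>h\<close> acts on the argument of \<open>f\<close>, so that one kernel serves all scales and bounds
  that depend on the kernel alone are uniform in \<open>h\<close>.
\<close>

definition conv :: "real \<Rightarrow> (real \<Rightarrow> real) \<Rightarrow> (real \<Rightarrow> complex) \<Rightarrow> real \<Rightarrow> complex" where
  "conv h a f x = (LINT t|lborel. a t *\<^sub>R f (x + h * t))"

lemma kernel_measurable[measurable_dest]: "kernel M a \<Longrightarrow> a \<in> borel_measurable borel"
  by (simp add: kernel_def)

lemma one_plus_square_pos: "0 < 1 + (t::real)\<^sup>2"
  by (simp add: add_pos_nonneg)

lemma kernel_nonneg: "kernel M a \<Longrightarrow> 0 \<le> M"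
  using abs_ge_zero[of "a 0"] unfolding kernel_def by (auto dest!: spec[of _ 0])

lemma kernel_abs: "kernel M a \<Longrightarrow> kernel M (\<lambda>t. \<bar>a t\<bar>)"
  by (auto simp: kernel_def)

lemma integrable_inverse_quadratic: "integrable lborel (\<lambda>t::real. 1 / (1 + t\<^sup>2))"
proof -
  let ?g = "\<lambda>t::real. 1 / (1 + t\<^sup>2)"
  have half: "(\<integral>\<^sup>+t. ennreal (?g t) * indicator {0..} t \<partial>lborel) = ennreal (pi / 2 - arctan 0)"
    by (intro nn_integral_FTC_atLeast tendsto_arctan_at_top)
       (auto intro!: derivative_eq_intros simp: inverse_eq_divide)
  have "(\<integral>\<^sup>+t. ennreal (norm (?g t)) \<partial>lborel)
      \<le> (\<integral>\<^sup>+t. ennreal (?g t) * indicator {0..} t + ennreal (?g (- t)) * indicator {0..} (- t) \<partial>lborel)"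
    by (intro nn_integral_mono) (auto simp: indicator_def)
  also have "\<dots> = (\<integral>\<^sup>+t. ennreal (?g t) * indicator {0..} t \<partial>lborel)
      + (\<integral>\<^sup>+t. ennreal (?g (- t)) * indicator {0..} (- t) \<partial>lborel)"
    by (intro nn_integral_add) measurable
  also have "(\<integral>\<^sup>+t. ennreal (?g (- t)) * indicator {0..} (- t) \<partial>lborel)
      = (\<integral>\<^sup>+t. ennreal (?g t) * indicator {0..} t \<partial>lborel)"
    by (subst nn_integral_real_affine[where c = "-1" and t = 0]) auto
  finally show ?thesis
    unfolding half by (intro integrableI_bounded) (auto simp: ennreal_plus[symmetric] le_less_trans simp del: ennreal_plus)
qed

lemma kernel_mult_bounded_integrable:
  assumes "kernel M a" "b \<in> borel_measurable borel" "\<And>t. \<bar>b t\<bar> \<le> C"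
  shows "integrable lborel (\<lambda>t. a t * b t)"
proof -
  note [measurable] = kernel_measurable[OF assms(1)] assms(2)
  show ?thesis
  proof (rule Bochner_Integration.integrable_bound)
    show "integrable lborel (\<lambda>t. M * C * (1 / (1 + t\<^sup>2)))"
      by (intro integrable_mult_right integrable_inverse_quadratic)
    show "AE t in lborel. norm (a t * b t) \<le> norm (M * C * (1 / (1 + t\<^sup>2)))"
    proof (rule AE_I2)
      fix t
      have "\<bar>a t\<bar> * \<bar>b t\<bar> \<le> M / (1 + t\<^sup>2) * C"
        using assms kernel_nonneg[OF assms(1)] unfolding kernel_def by (intro mult_mono) auto
      also have "\<dots> \<le> \<bar>M * C * (1 / (1 + t\<^sup>2))\<bar>" by (simp add: divide_right_mono)
      finally show "norm (a t * b t) \<le> norm (M * C * (1 / (1 + t\<^sup>2)))"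
        by (simp add: abs_mult)
    qed
  qed measurable
qed

lemma kernel_integrable: "kernel M a \<Longrightarrow> integrable lborel a"
  using kernel_mult_bounded_integrable[of M a "\<lambda>_. 1" 1] by simp

lemma kernel_bounded:
  assumes "kernel M a" shows "\<bar>a t\<bar> \<le> M"
proof -
  have "M / (1 + t\<^sup>2) \<le> M / 1"
    using kernel_nonneg[OF assms] by (intro divide_left_mono) (auto simp: one_plus_square_pos)
  then show ?thesis using assms unfolding kernel_def by (auto intro: order_trans)
qed

lemma kernelI:
  assumes "a \<in> borel_measurable borel" "\<And>t. \<bar>a t\<bar> * (1 + t\<^sup>2) \<le> M"
  shows "kernel M a"
  using assms one_plus_square_pos by (auto simp: kernel_def pos_le_divide_eq)

context steklov_lattice
begin

lemma poisson_nonneg: "0 \<le> poisson h f x"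
  unfolding poisson_def by (intro integral_nonneg_AE) auto

lemma kernel_mult_le:
  assumes "kernel M a"
  shows "norm (a t *\<^sub>R f (x + h * t)) \<le> M * (cmod (f (x + h * t)) / (1 + t\<^sup>2))"
proof -
  have "\<bar>a t\<bar> * cmod (f (x + h * t)) \<le> M / (1 + t\<^sup>2) * cmod (f (x + h * t))"
    using assms unfolding kernel_def by (intro mult_right_mono) auto
  then show ?thesis by simp
qed

lemma conv_integrable:
  assumes "kernel M a" "f \<in> XB" "0 < h"
  shows "integrable lborel (\<lambda>t. a t *\<^sub>R f (x + h * t))"
proof -
  note [measurable] = kernel_measurable[OF assms(1)] XB_measurable[OF assms(2)]
  show ?thesis
  proof (rule Bochner_Integration.integrable_bound)
    show "integrable lborel (\<lambda>t. M * (cmod (f (x + h * t)) / (1 + t\<^sup>2)))"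
      by (intro integrable_mult_right poisson_integrable assms)
    show "AE t in lborel. norm (a t *\<^sub>R f (x + h * t)) \<le> norm (M * (cmod (f (x + h * t)) / (1 + t\<^sup>2)))"
      using order_trans[OF kernel_mult_le[OF assms(1)] abs_ge_self] by auto
  qed measurable
qed

lemma conv_le_poisson:
  assumes "kernel M a" "f \<in> XB" "0 < h"
  shows "cmod (conv h a f x) \<le> M * poisson h f x"
proof -
  have "cmod (conv h a f x) \<le> (LINT t|lborel. norm (a t *\<^sub>R f (x + h * t)))"
    unfolding conv_def by (rule integral_norm_bound)
  also have "\<dots> \<le> (LINT t|lborel. M * (cmod (f (x + h * t)) / (1 + t\<^sup>2)))"
    by (intro integral_mono integrable_norm conv_integrable[OF assms] integrable_mult_right
        poisson_integrable assms kernel_mult_le[OF assms(1)])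
  finally show ?thesis by (simp only: poisson_def integral_mult_right_zero)
qed

lemma conv_mem:
  assumes "kernel M a" "f \<in> XB" "0 < h"
  shows "conv h a f \<in> XB" "N (conv h a f) \<le> 16 * A * M * N f"
proof -
  note [measurable] = kernel_measurable[OF assms(1)] XB_measurable[OF assms(2)]
  have M: "0 \<le> M" using kernel_nonneg[OF assms(1)] .
  let ?P = "\<lambda>x. complex_of_real M * complex_of_real (poisson h f x)"
  have P: "?P \<in> X" and NP: "N ?P \<le> 16 * A * M * N f"
    using scale_closed[OF XB_X[OF poisson_mem[OF assms(2,3)]]]
      norm_scale[OF XB_X[OF poisson_mem[OF assms(2,3)]], of "complex_of_real M"]
      mult_left_mono[OF poisson_norm[OF assms(2,3)] M] M
    by (auto simp: algebra_simps)
  have meas: "conv h a f \<in> borel_measurable borel"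
    unfolding conv_def by measurable
  have le: "cmod (conv h a f x) \<le> cmod (?P x)" for x
    using conv_le_poisson[OF assms, of x] M by (simp add: norm_mult poisson_nonneg)
  show "conv h a f \<in> XB" "N (conv h a f) \<le> 16 * A * M * N f"
    using XB_ideal[OF meas P le] NP by auto
qed

lemma conv_diff:
  assumes "kernel M a" "f \<in> XB" "g \<in> XB" "0 < h"
  shows "conv h a (\<lambda>x. f x - g x) = (\<lambda>x. conv h a f x - conv h a g x)"
  unfolding conv_def using conv_integrable[OF assms(1) _ assms(4)] assms
  by (auto simp: scaleR_diff_right)

lemma conv_scale: "conv h a (\<lambda>x. c * f x) = (\<lambda>x. c * conv h a f x)"
proof
  fix x
  have "(LINT t|lborel. a t *\<^sub>R (c * f (x + h * t))) = (LINT t|lborel. c * (a t *\<^sub>R f (x + h * t)))"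
    by (intro Bochner_Integration.integral_cong) auto
  then show "conv h a (\<lambda>x. c * f x) x = c * conv h a f x"
    by (simp only: conv_def integral_mult_right_zero)
qed

lemma integral_shift: "(LINT t|lborel. F t) = (LINT s|lborel. F (s - t))"
  for F :: "real \<Rightarrow> complex"
  using lborel_integral_real_affine[of 1 F "-t"] by simp

text \<open>
  The absolute double integral is dominated by a convolution applied to the Poisson majorant of
  \<open>f\<close>, which belongs to the lattice; hence it converges at every point and not just almost
  everywhere.
\<close>

lemma conv_conv:
  assumes "kernel M a" "kernel M' b" "f \<in> XB" "0 < h"
  shows "conv h a (conv h b f) = conv h (\<lambda>s. LINT t|lborel. a t * b (s - t)) f"
proof
  fix x
  note [measurable] = kernel_measurable[OF assms(1)] kernel_measurable[OF assms(2)]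
    XB_measurable[OF assms(3)]
  let ?F = "\<lambda>(t, s). (a t * b (s - t)) *\<^sub>R f (x + h * s)"
  have inner: "integrable lborel (\<lambda>s. b (s - t) *\<^sub>R f (x + h * s))" for t
    using conv_integrable[OF assms(2-4), of "x + h * t"]
      lborel_integrable_real_affine[of "\<lambda>u. b u *\<^sub>R f (x + h * t + h * u)" 1 "-t"]
    by (simp add: algebra_simps)
  have shift: "conv h b f (x + h * t) = (LINT s|lborel. b (s - t) *\<^sub>R f (x + h * s))" for t
    unfolding conv_def by (subst integral_shift[where t = t]) (simp add: algebra_simps)
  have shift_abs: "(LINT s|lborel. \<bar>b (s - t)\<bar> * cmod (f (x + h * s))) \<le> M' * poisson h f (x + h * t)" for t
  proof -
    have "(LINT s|lborel. \<bar>b (s - t)\<bar> * cmod (f (x + h * s)))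
        = (LINT u|lborel. norm (b u *\<^sub>R f (x + h * t + h * u)))"
      using lborel_integral_real_affine[of 1 "\<lambda>s. \<bar>b (s - t)\<bar> * cmod (f (x + h * s))" t]
      by (simp add: algebra_simps)
    also have "\<dots> \<le> (LINT u|lborel. M' * (cmod (f (x + h * t + h * u)) / (1 + u\<^sup>2)))"
      by (intro integral_mono integrable_norm conv_integrable[OF assms(2-4)] integrable_mult_right
        poisson_integrable assms kernel_mult_le[OF assms(2)])
    finally show ?thesis by (simp only: poisson_def integral_mult_right_zero)
  qed
  have int: "integrable (lborel \<Otimes>\<^sub>M lborel) ?F"
  proof (rule lborel_pair.Fubini_integrable)
    show "integrable lborel (\<lambda>t. LINT s|lborel. norm (?F (t, s)))"
    proof (rule Bochner_Integration.integrable_bound)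
      show "integrable lborel (\<lambda>t. M' *\<^sub>R (\<bar>a t\<bar> *\<^sub>R complex_of_real (poisson h f (x + h * t))))"
        by (intro integrable_scaleR_right conv_integrable[OF kernel_abs[OF assms(1)]]
            poisson_mem assms)
      show "AE t in lborel. norm (LINT s|lborel. norm (?F (t, s)))
          \<le> norm (M' *\<^sub>R (\<bar>a t\<bar> *\<^sub>R complex_of_real (poisson h f (x + h * t))))"
      proof (rule AE_I2)
        fix t
        have "(LINT s|lborel. norm (?F (t, s))) = \<bar>a t\<bar> * (LINT s|lborel. \<bar>b (s - t)\<bar> * cmod (f (x + h * s)))"
          by (simp add: abs_mult mult.assoc)
        moreover have "\<dots> \<le> \<bar>a t\<bar> * (M' * poisson h f (x + h * t))"
          by (intro mult_left_mono shift_abs) auto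
        moreover have "0 \<le> (LINT s|lborel. norm (?F (t, s)))"
          by (intro integral_nonneg_AE) auto
        ultimately show "norm (LINT s|lborel. norm (?F (t, s)))
          \<le> norm (M' *\<^sub>R (\<bar>a t\<bar> *\<^sub>R complex_of_real (poisson h f (x + h * t))))"
          using kernel_nonneg[OF assms(2)] by (simp add: poisson_nonneg abs_mult mult.left_commute)
      qed
    qed measurable
    show "AE t in lborel. integrable lborel (\<lambda>s. ?F (t, s))"
      using integrable_scaleR_right[OF inner] by (auto simp flip: scaleR_scaleR)
  qed measurable
  have "conv h a (conv h b f) x = (LINT t|lborel. LINT s|lborel. ?F (t, s))"
    unfolding conv_def[of h a] shift by (simp flip: integral_scaleR_right)
  also have "\<dots> = (LINT s|lborel. LINT t|lborel. ?F (t, s))"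
    using lborel_pair.Fubini_integral[of "\<lambda>t s. ?F (t, s)"] int by simp
  also have "\<dots> = (LINT s|lborel. (LINT t|lborel. a t * b (s - t)) *\<^sub>R f (x + h * s))"
  proof (intro Bochner_Integration.integral_cong refl)
    fix s
    show "(LINT t|lborel. ?F (t, s)) = (LINT t|lborel. a t * b (s - t)) *\<^sub>R f (x + h * s)"
      using kernel_mult_bounded_integrable[OF assms(1), of "\<lambda>t. b (s - t)" M'] kernel_bounded[OF assms(2)]
      by simp
  qed
  finally show "conv h a (conv h b f) x = conv h (\<lambda>s. LINT t|lborel. a t * b (s - t)) f x"
    by (simp add: conv_def)
qed

lemma conv_commute:
  assumes "kernel M a" "kernel M' b" "f \<in> XB" "0 < h"
  shows "conv h a (conv h b f) = conv h b (conv h a f)"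
proof -
  have "(LINT t|lborel. a t * b (s - t)) = (LINT t|lborel. b t * a (s - t))" for s
    using lborel_integral_real_affine[of "-1" "\<lambda>t. a t * b (s - t)" s] by (simp add: mult.commute)
  then show ?thesis
    using assms by (simp add: conv_conv)
qed

text \<open>
  All operators used below are polynomials in convolutions. The parameter \<open>M\<close> is an upper bound of
  the operator norm; it does not depend on \<open>h\<close> when the operator is built from fixed kernels.
\<close>

inductive conv_algebra :: "real \<Rightarrow> real \<Rightarrow> ((real \<Rightarrow> complex) \<Rightarrow> real \<Rightarrow> complex) \<Rightarrow> bool" for h where
  ident: "conv_algebra h 1 (\<lambda>f. f)"
| convolution: "kernel M a \<Longrightarrow> conv_algebra h (16 * A * M) (conv h a)"
| compose: "conv_algebra h M1 L1 \<Longrightarrow> conv_algebra h M2 L2 \<Longrightarrow> conv_algebra h (M1 * M2) (\<lambda>f. L1 (L2 f))"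
| diff: "conv_algebra h M1 L1 \<Longrightarrow> conv_algebra h M2 L2 \<Longrightarrow>
    conv_algebra h (M1 + M2) (\<lambda>f x. L1 f x - L2 f x)"
| scale: "conv_algebra h M L \<Longrightarrow> conv_algebra h (cmod c * M) (\<lambda>f x. c * L f x)"

lemma conv_algebra_nonneg: "conv_algebra h M L \<Longrightarrow> 0 \<le> M"
  by (induction rule: conv_algebra.induct) (use A_nonneg in \<open>auto dest: kernel_nonneg\<close>)

lemma conv_algebra_mem:
  assumes "conv_algebra h M L" "0 < h" "f \<in> XB"
  shows "L f \<in> XB"
  using assms by (induction arbitrary: f rule: conv_algebra.induct) (auto simp: conv_mem XB_diff XB_scale)

lemma conv_algebra_norm:
  assumes "conv_algebra h M L" "0 < h" "f \<in> XB"
  shows "N (L f) \<le> M * N f"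
  using assms
proof (induction arbitrary: f rule: conv_algebra.induct)
  case (compose M1 L1 M2 L2)
  have "N (L1 (L2 f)) \<le> M1 * N (L2 f)"
    using compose conv_algebra_mem by auto
  also have "\<dots> \<le> M1 * (M2 * N f)"
    using compose conv_algebra_nonneg by (intro mult_left_mono) auto
  finally show ?case by simp
next
  case (diff M1 L1 M2 L2)
  have "N (\<lambda>x. L1 f x - L2 f x) \<le> N (L1 f) + N (L2 f)"
    using diff conv_algebra_mem XB_X by (intro norm_diff_triangle) auto
  also have "\<dots> \<le> M1 * N f + M2 * N f"
    using diff by (intro add_mono) auto
  finally show ?case by (simp add: distrib_right)
next
  case (scale M L c)
  then have "N (\<lambda>x. c * L f x) = cmod c * N (L f)"
    using conv_algebra_mem XB_X by (intro norm_scale) auto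
  then show ?case using scale by (simp add: mult.assoc mult_left_mono)
qed (auto simp: conv_mem)

lemma conv_algebra_diff:
  assumes "conv_algebra h M L" "0 < h" "f \<in> XB" "g \<in> XB"
  shows "L (\<lambda>x. f x - g x) = (\<lambda>x. L f x - L g x)"
  using assms
proof (induction arbitrary: f g rule: conv_algebra.induct)
  case (compose M1 L1 M2 L2)
  then show ?case using conv_algebra_mem by simp
qed (auto simp: conv_diff algebra_simps)

lemma conv_algebra_scale:
  assumes "conv_algebra h M L"
  shows "L (\<lambda>x. c * f x) = (\<lambda>x. c * L f x)"
  using assms by (induction arbitrary: f rule: conv_algebra.induct)
    (auto simp: conv_scale algebra_simps)

lemma conv_algebra_commute_conv:
  assumes "conv_algebra h M L" "kernel M' a" "0 < h" "f \<in> XB"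
  shows "L (conv h a f) = conv h a (L f)"
  using assms(1,4)
proof (induction arbitrary: f rule: conv_algebra.induct)
  case (convolution M b)
  then show ?case using conv_commute assms by blast
next
  case (compose M1 L1 M2 L2)
  then show ?case using conv_algebra_mem assms by simp
next
  case (diff M1 L1 M2 L2)
  then show ?case using conv_algebra_mem assms by (simp add: conv_diff[OF assms(2)])
qed (auto simp: conv_scale)

lemma conv_algebra_commute:
  assumes "conv_algebra h M L" "conv_algebra h M' L'" "0 < h" "f \<in> XB"
  shows "L (L' f) = L' (L f)"
  using assms(2,4)
proof (induction arbitrary: f rule: conv_algebra.induct)
  case (convolution M b)
  then show ?case using conv_algebra_commute_conv assms by blast
next
  case (compose M1 L1 M2 L2)
  then show ?case using conv_algebra_mem assms by simp
next
  case (diff M1 L1 M2 L2)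
  then show ?case using conv_algebra_mem assms by (simp add: conv_algebra_diff[OF assms(1)])
next
  case (scale M L c)
  then show ?case by (simp add: conv_algebra_scale[OF assms(1)])
qed auto

lemma conv_algebra_funpow:
  assumes "conv_algebra h M L"
  shows "conv_algebra h (M ^ n) (L ^^ n)"
proof (induction n)
  case 0
  then show ?case using conv_algebra.ident by (simp add: id_def)
next
  case (Suc n)
  then show ?case
    using conv_algebra.compose[OF assms Suc] by (simp add: comp_def)
qed

lemma conv_algebra_id_minus:
  "conv_algebra h M L \<Longrightarrow> conv_algebra h (1 + M) (\<lambda>f x. f x - L f x)"
  by (rule conv_algebra.diff[OF conv_algebra.ident])

text \<open>Since the operators commute, a domination between two of them passes to their powers.\<close>

lemma funpow_dominated:
  assumes L: "conv_algebra h M L" "conv_algebra h M' L'" and h: "0 < h"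
    and dom: "\<And>f. f \<in> XB \<Longrightarrow> N (L f) \<le> c * N (L' f)" and c: "0 \<le> c" and f: "f \<in> XB"
  shows "N ((L ^^ n) f) \<le> c ^ n * N ((L' ^^ n) f)"
  using f
proof (induction n arbitrary: f)
  case (Suc n)
  have mem: "L f \<in> XB" "(L' ^^ n) f \<in> XB"
    using conv_algebra_mem[OF L(1) h Suc.prems]
      conv_algebra_mem[OF conv_algebra_funpow[OF L(2)] h Suc.prems] by auto
  have "N ((L ^^ Suc n) f) \<le> c ^ n * N ((L' ^^ n) (L f))"
    using Suc.IH[OF mem(1)] by (simp add: funpow_swap1)
  also have "(L' ^^ n) (L f) = L ((L' ^^ n) f)"
    by (rule conv_algebra_commute[OF conv_algebra_funpow[OF L(2)] L(1) h Suc.prems])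
  also have "c ^ n * N (L ((L' ^^ n) f)) \<le> c ^ n * (c * N (L' ((L' ^^ n) f)))"
    using dom[OF mem(2)] c by (intro mult_left_mono) auto
  finally show ?case by (simp add: mult_ac)
qed simp

text \<open>
  Telescoping: \<open>1 - L\<^sup>n = (1 + L + \<dots> + L\<^sup>n\<^sup>-\<^sup>1) (1 - L)\<close>.
\<close>

lemma id_minus_funpow_norm:
  assumes L: "conv_algebra h M L" and h: "0 < h" and f: "f \<in> XB"
  shows "N (\<lambda>x. f x - (L ^^ n) f x) \<le> (\<Sum>i<n. M ^ i) * N (\<lambda>x. f x - L f x)"
proof (induction n)
  case 0
  then show ?case by (simp add: norm_zero)
next
  case (Suc n)
  have mem: "L f \<in> XB" "(L ^^ n) f \<in> XB" "(L ^^ n) (L f) \<in> XB"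
    using conv_algebra_mem[OF L h f] conv_algebra_mem[OF conv_algebra_funpow[OF L] h] f by auto
  have "N (\<lambda>x. f x - (L ^^ Suc n) f x)
      \<le> N (\<lambda>x. f x - (L ^^ n) f x) + N (\<lambda>x. (L ^^ n) f x - (L ^^ n) (L f) x)"
    unfolding funpow_Suc_right comp_def
    using f mem by (intro norm_diff_le_via XB_X) auto
  also have "(\<lambda>x. (L ^^ n) f x - (L ^^ n) (L f) x) = (L ^^ n) (\<lambda>x. f x - L f x)"
    by (rule conv_algebra_diff[OF conv_algebra_funpow[OF L] h f mem(1), symmetric])
  also have "N \<dots> \<le> M ^ n * N (\<lambda>x. f x - L f x)"
    using f mem by (intro conv_algebra_norm[OF conv_algebra_funpow[OF L] h] XB_diff)
  finally show ?case using Suc by (simp add: distrib_right)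
qed

end

section \<open>Forward averages compared with a resolvent\<close>

definition box_kernel :: "real \<Rightarrow> real" where "box_kernel t = indicator {0..1} t"
definition exp_kernel :: "real \<Rightarrow> real" where "exp_kernel t = indicator {0..} t * exp (- t)"
definition ramp_kernel :: "real \<Rightarrow> real" where "ramp_kernel t = indicator {0..1} t * t"
definition tri_kernel :: "real \<Rightarrow> real" where "tri_kernel t = indicator {0..1} t * (1 - t)"

lemma square_le_one: "0 \<le> t \<Longrightarrow> t \<le> 1 \<Longrightarrow> t\<^sup>2 \<le> (1::real)"
  by (simp add: power_le_one)

lemma kernel_box: "kernel 2 box_kernel"
  by (rule kernelI) (auto simp: box_kernel_def[abs_def] indicator_def square_le_one)

lemma kernel_ramp: "kernel 2 ramp_kernel"
proof (rule kernelI)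
  show "\<bar>ramp_kernel t\<bar> * (1 + t\<^sup>2) \<le> 2" for t
    using mult_mono[of t 1 "1 + t\<^sup>2" 2] square_le_one[of t]
    by (auto simp: ramp_kernel_def indicator_def)
qed (simp add: ramp_kernel_def[abs_def])

lemma kernel_tri: "kernel 2 tri_kernel"
proof (rule kernelI)
  show "\<bar>tri_kernel t\<bar> * (1 + t\<^sup>2) \<le> 2" for t
    using mult_mono[of "1 - t" 1 "1 + t\<^sup>2" 2] square_le_one[of t]
    by (auto simp: tri_kernel_def indicator_def)
qed (simp add: tri_kernel_def[abs_def])

lemma kernel_exp: "kernel 2 exp_kernel"
proof (rule kernelI)
  show "\<bar>exp_kernel t\<bar> * (1 + t\<^sup>2) \<le> 2" for t
  proof (cases "0 \<le> t")
    case True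
    have "1 + t + t\<^sup>2 / 2 \<le> exp t"
      using exp_lower_Taylor_quadratic[OF True] .
    then have "1 + t\<^sup>2 \<le> 2 * exp t" using True by simp
    then have "exp (- t) * (1 + t\<^sup>2) \<le> exp (- t) * (2 * exp t)"
      by (intro mult_left_mono) auto
    also have "\<dots> = 2" by (simp add: exp_minus)
    finally show ?thesis using True by (simp add: exp_kernel_def)
  qed (simp add: exp_kernel_def)
qed (simp add: exp_kernel_def[abs_def])

text \<open>
  On the Laplace side \<open>box\<close> is \<open>(1 - exp (- s)) / s\<close> and \<open>exp\<close> is \<open>1 / (1 + s)\<close>; the identity
  below is \<open>1 - box = (1 - exp) (1 - ramp)\<close>. The first factor \<open>s / (1 + s)\<close> carries the zero of
  \<open>1 - box\<close> at the origin. The ramp has total mass \<open>1 / 2\<close>, which makes the second factor invertible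
  by a Neumann series.
\<close>

lemma ramp_convolve_exp:
  "(LINT t|lborel. ramp_kernel t * exp_kernel (s - t)) = exp_kernel s + ramp_kernel s - box_kernel s"
proof -
  have FTC: "(LINT t|lborel. indicator {0..b} t *\<^sub>R (t * exp (t - s)))
      = (b - 1) * exp (b - s) + exp (- s)" if "0 \<le> b" for b
  proof -
    have "(LINT t|lborel. indicator {0..b} t *\<^sub>R (t * exp (t - s)))
      = (b - 1) * exp (b - s) - (0 - 1) * exp (0 - s)"
      using that
      by (intro integral_FTC_atLeastAtMost)
         (auto intro!: derivative_eq_intros continuous_intros
           simp: has_real_derivative_iff_has_vector_derivative[symmetric] algebra_simps)
    then show ?thesis by simp
  qed
  consider "s < 0" | "0 \<le> s" "s \<le> 1" | "1 < s" by linarith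
  then show ?thesis
  proof cases
    case 1
    then have zero: "ramp_kernel t * exp_kernel (s - t) = 0" for t
      by (auto simp: ramp_kernel_def exp_kernel_def indicator_def)
    show ?thesis
      unfolding zero using 1 by (simp add: ramp_kernel_def exp_kernel_def box_kernel_def)
  next
    case 2
    then have eq: "ramp_kernel t * exp_kernel (s - t) = indicator {0..s} t *\<^sub>R (t * exp (t - s))" for t
      by (auto simp: ramp_kernel_def exp_kernel_def indicator_def)
    show ?thesis
      unfolding eq using 2 FTC[of s] by (simp add: ramp_kernel_def exp_kernel_def box_kernel_def)
  next
    case 3
    then have eq: "ramp_kernel t * exp_kernel (s - t) = indicator {0..1} t *\<^sub>R (t * exp (t - s))" for t
      by (auto simp: ramp_kernel_def exp_kernel_def indicator_def)
    show ?thesis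
      unfolding eq using 3 FTC[of 1] by (simp add: ramp_kernel_def exp_kernel_def box_kernel_def)
  qed
qed

text \<open>
  The kernel form of the fundamental theorem of calculus for the resolvent. Half-open intervals
  make it hold at every point.
\<close>

lemma window_convolve_exp:
  assumes "0 \<le> t"
  shows "(LINT u|lborel. indicator {0..<t} u * exp_kernel (s - u))
    = indicator {0..<t} s - exp_kernel s + exp_kernel (s - t)"
proof -
  have FTC: "(LINT u|lborel. indicator {0..b} u *\<^sub>R exp (u - s)) = exp (b - s) - exp (- s)"
    if "0 \<le> b" for b
  proof -
    have "(LINT u|lborel. indicator {0..b} u *\<^sub>R exp (u - s)) = exp (b - s) - exp (0 - s)"
      using that
      by (intro integral_FTC_atLeastAtMost)
         (auto intro!: derivative_eq_intros continuous_intros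
           simp: has_real_derivative_iff_has_vector_derivative[symmetric])
    then show ?thesis by simp
  qed
  consider "s < 0" | "0 \<le> s" "s < t" | "t \<le> s" using assms by linarith
  then show ?thesis
  proof cases
    case 1
    then have zero: "indicator {0..<t} u * exp_kernel (s - u) = 0" for u
      by (auto simp: exp_kernel_def indicator_def)
    show ?thesis unfolding zero using 1 assms by (simp add: exp_kernel_def)
  next
    case 2
    then have eq: "indicator {0..<t} u * exp_kernel (s - u) = indicator {0..s} u *\<^sub>R exp (u - s)" for u
      by (auto simp: exp_kernel_def indicator_def)
    show ?thesis unfolding eq using 2 FTC[of s] by (simp add: exp_kernel_def)
  next
    case 3
    have "(LINT u|lborel. indicator {0..<t} u * exp_kernel (s - u))
        = (LINT u|lborel. indicator {0..t} u *\<^sub>R exp (u - s))"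
    proof (rule integral_cong_AE)
      show "AE u in lborel. indicator {0..<t} u * exp_kernel (s - u) = indicator {0..t} u *\<^sub>R exp (u - s)"
        using AE_lborel_singleton[of t]
        by eventually_elim (use 3 in \<open>auto simp: exp_kernel_def indicator_def\<close>)
    qed (use kernel_measurable[OF kernel_exp] in measurable)
    then show ?thesis using 3 assms FTC[of t] by (simp add: exp_kernel_def)
  qed
qed

text \<open>
  The convolution powers of the ramp, with index shifted by one: \<open>ramp_power n\<close> is the kernel of
  the power \<open>n + 1\<close>.
\<close>

fun ramp_power :: "nat \<Rightarrow> real \<Rightarrow> real" where
  "ramp_power 0 = ramp_kernel"
| "ramp_power (Suc n) = (\<lambda>s. LINT t|lborel. ramp_kernel t * ramp_power n (s - t))"

lemma integral_ramp: "(LINT t|lborel. ramp_kernel t) = 1 / 2"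
proof -
  have "(LINT t|lborel. indicator {0..1} t *\<^sub>R t) = (1::real)\<^sup>2 / 2 - 0\<^sup>2 / 2"
    by (intro integral_FTC_atLeastAtMost)
       (auto intro!: derivative_eq_intros
         simp: has_real_derivative_iff_has_vector_derivative[symmetric])
  then show ?thesis by (simp add: ramp_kernel_def)
qed

lemma ramp_power_bounds:
  "ramp_power n \<in> borel_measurable borel \<and>
   (\<forall>s. 0 \<le> ramp_power n s \<and> ramp_power n s \<le> (1 / 2) ^ n * indicator {0..real n + 1} s)"
proof (induction n)
  case 0
  show ?case
    using kernel_measurable[OF kernel_ramp] by (auto simp: ramp_kernel_def indicator_def)
next
  case (Suc n)
  note [measurable] = conjunct1[OF Suc] kernel_measurable[OF kernel_ramp]
  have b: "0 \<le> ramp_power n s" "ramp_power n s \<le> (1 / 2) ^ n * indicator {0..real n + 1} s" for s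
    using Suc by auto
  have b1: "ramp_power n s \<le> (1 / 2) ^ n" for s
    using b(2)[of s] by (auto simp: indicator_def split: if_splits intro: order_trans)
  have r: "0 \<le> ramp_kernel t" for t
    by (auto simp: ramp_kernel_def indicator_def)
  have "ramp_power (Suc n) s \<le> (1 / 2) ^ Suc n * indicator {0..real (Suc n) + 1} s" for s
  proof (cases "s \<in> {0..real (Suc n) + 1}")
    case True
    have "ramp_power (Suc n) s \<le> (LINT t|lborel. ramp_kernel t * (1 / 2) ^ n)"
      unfolding ramp_power.simps
      by (intro integral_mono kernel_mult_bounded_integrable[OF kernel_ramp, where C = "(1/2)^n"]
           mult_left_mono b1 r) (use b b1 in \<open>auto simp: abs_le_iff intro: order_trans[of _ 0]\<close>)
    then show ?thesis using True by (simp add: integral_ramp)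
  next
    case False
    have zero: "ramp_kernel t * ramp_power n (s - t) = 0" for t
      using False b[of "s - t"] by (auto simp: ramp_kernel_def indicator_def split: if_splits)
    show ?thesis unfolding ramp_power.simps zero by simp
  qed
  moreover have "0 \<le> ramp_power (Suc n) s" for s
    using b r by (auto intro!: integral_nonneg_AE)
  ultimately show ?case by auto
qed

text \<open>
  The support grows linearly and the supremum decays geometrically, and so the bound in the class
  of kernels tends to zero. This replaces smallness of the operator norm of a single ramp, which
  fails when the norm of the Steklov averages is large.
\<close>

lemma kernel_ramp_power: "kernel ((1 / 2) ^ n * (1 + (real n + 1)\<^sup>2)) (ramp_power n)"
proof (rule kernelI)
  show "\<bar>ramp_power n t\<bar> * (1 + t\<^sup>2) \<le> (1 / 2) ^ n * (1 + (real n + 1)\<^sup>2)" for t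
  proof (cases "t \<in> {0..real n + 1}")
    case True
    then have "t\<^sup>2 \<le> (real n + 1)\<^sup>2" by (intro power_mono) auto
    moreover have "0 \<le> ramp_power n t" "ramp_power n t \<le> (1 / 2) ^ n"
      using ramp_power_bounds[of n] True by (auto dest!: spec[of _ t])
    ultimately show ?thesis by (intro mult_mono) auto
  next
    case False
    then have "ramp_power n t = 0"
      using ramp_power_bounds[of n] by (auto dest!: spec[of _ t])
    then show ?thesis by (simp add: add_nonneg_nonneg)
  qed
qed (use ramp_power_bounds in blast)

lemma ramp_power_small:
  assumes "0 < d"
  obtains n where "(1 / 2) ^ n * (1 + (real n + 1)\<^sup>2) \<le> d"
proof -
  have "(\<lambda>n. real n * (3 / 4) ^ n) \<longlonglongrightarrow> 0"
    using powser_times_n_limit_0[of "3 / 4 :: real"] by simp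
  then have "(\<lambda>n. 4 * (real n * (3 / 4) ^ n)\<^sup>2) \<longlonglongrightarrow> 4 * 0\<^sup>2"
    by (intro tendsto_intros)
  then have "eventually (\<lambda>n. 4 * (real n * (3 / 4) ^ n)\<^sup>2 < d) sequentially"
    using assms by (intro order_tendstoD(2)) auto
  then obtain n0 where n0: "\<And>n. n \<ge> n0 \<Longrightarrow> 4 * (real n * (3 / 4) ^ n)\<^sup>2 < d"
    by (auto simp: eventually_sequentially)
  \<comment> \<open>The base \<open>(3 / 4)\<^sup>2 = 9 / 16\<close> exceeds \<open>1 / 2\<close>.\<close>
  have "(1 / 2) ^ n0 * (1 + (real n0 + 1)\<^sup>2) \<le> 4 * (real (Suc n0) * (3 / 4) ^ Suc n0)\<^sup>2"
  proof -
    have "(1 / 2) ^ n0 * (1 + (real n0 + 1)\<^sup>2) \<le> (1 / 2) ^ n0 * (2 * (real n0 + 1)\<^sup>2)"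
      by (intro mult_left_mono) auto
    also have "\<dots> = 4 * (real (Suc n0))\<^sup>2 * (1 / 2) ^ Suc n0"
      by (simp add: algebra_simps)
    also have "\<dots> \<le> 4 * (real (Suc n0))\<^sup>2 * (9 / 16) ^ Suc n0"
      by (intro mult_left_mono power_mono) auto
    also have "(9 / 16 :: real) ^ Suc n0 = ((3 / 4) ^ Suc n0)\<^sup>2"
      by (simp add: power_mult[symmetric] mult.commute[of _ 2] power_mult power2_eq_square
          power_mult_distrib[symmetric] del: power_Suc)
    finally show ?thesis by (simp only: power_mult_distrib mult.assoc)
  qed
  also have "\<dots> \<le> d" using n0[of "Suc n0"] by simp
  finally show thesis by (rule that)
qed

context steklov_lattice
begin

lemma conv_kernel_add:
  assumes "kernel M a" "kernel M' b" "f \<in> XB" "0 < h"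
  shows "conv h (\<lambda>t. a t + b t) f x = conv h a f x + conv h b f x"
  unfolding conv_def using conv_integrable[OF assms(1,3,4)] conv_integrable[OF assms(2,3,4)]
  by (simp add: scaleR_add_left)

lemma kernel_add: "kernel M a \<Longrightarrow> kernel M' b \<Longrightarrow> kernel (M + M') (\<lambda>t. a t + b t)"
  unfolding kernel_def by (auto simp: add_divide_distrib intro: abs_triangle_ineq[THEN order_trans] add_mono)

lemma conv_kernel_minus: "conv h (\<lambda>t. - a t) f x = - conv h a f x"
  unfolding conv_def by simp

lemma kernel_minus: "kernel M a \<Longrightarrow> kernel M (\<lambda>t. - a t)"
  unfolding kernel_def by auto

lemma conv_kernel_diff:
  assumes "kernel M a" "kernel M' b" "f \<in> XB" "0 < h"
  shows "conv h (\<lambda>t. a t - b t) f x = conv h a f x - conv h b f x"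
  using conv_kernel_add[OF assms(1) kernel_minus[OF assms(2)] assms(3,4)] by (simp add: conv_kernel_minus)

lemma one_minus_box_factor:
  assumes "f \<in> XB" "0 < h"
  defines "G \<equiv> \<lambda>x. f x - conv h exp_kernel f x"
  shows "G x - conv h ramp_kernel G x = f x - conv h box_kernel f x"
proof -
  have "conv h ramp_kernel G x = conv h ramp_kernel f x - conv h ramp_kernel (conv h exp_kernel f) x"
    unfolding G_def using conv_mem(1)[OF kernel_exp assms(1,2)] assms(1,2)
    by (simp add: conv_diff[OF kernel_ramp])
  also have "conv h ramp_kernel (conv h exp_kernel f) x
      = conv h exp_kernel f x + conv h ramp_kernel f x - conv h box_kernel f x"
    unfolding conv_conv[OF kernel_ramp kernel_exp assms(1,2)] ramp_convolve_exp
    using assms(1,2)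
    by (simp add: conv_kernel_diff[OF kernel_add[OF kernel_exp kernel_ramp] kernel_box]
        conv_kernel_add[OF kernel_exp kernel_ramp])
  finally show ?thesis by (simp add: G_def)
qed

lemma ramp_funpow:
  assumes "f \<in> XB" "0 < h"
  shows "(conv h ramp_kernel ^^ Suc n) f = conv h (ramp_power n) f"
proof (induction n)
  case (Suc n)
  have "(conv h ramp_kernel ^^ Suc (Suc n)) f = conv h ramp_kernel (conv h (ramp_power n) f)"
    using Suc by simp
  then show ?case
    by (simp add: conv_conv[OF kernel_ramp kernel_ramp_power assms])
qed simp

text \<open>
  With \<open>G = f - E f\<close> and \<open>R\<close> the ramp operator, \<open>G = (G - R\<^sup>n G) + R\<^sup>n G\<close>: the first term is
  controlled by \<open>G - R G\<close>, which is \<open>f\<close> minus its forward average, and for large \<open>n\<close> the second one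
  is absorbed on the left.
\<close>

lemma resolvent_dominated_by_box:
  obtains c where "0 \<le> c"
    "\<And>h f. 0 < h \<Longrightarrow> f \<in> XB \<Longrightarrow>
      N (\<lambda>x. f x - conv h exp_kernel f x) \<le> c * N (\<lambda>x. f x - conv h box_kernel f x)"
proof -
  obtain n where "(1 / 2) ^ n * (1 + (real n + 1)\<^sup>2) \<le> 1 / (2 * (16 * A + 1))"
    using ramp_power_small[of "1 / (2 * (16 * A + 1))"] A_nonneg by auto
  then have "16 * A * ((1 / 2) ^ n * (1 + (real n + 1)\<^sup>2)) \<le> 16 * A * (1 / (2 * (16 * A + 1)))"
    using A_nonneg by (intro mult_left_mono) auto
  also have "\<dots> \<le> 1 / 2"
    using A_nonneg by (simp add: field_simps)
  finally have n: "16 * A * ((1 / 2) ^ n * (1 + (real n + 1)\<^sup>2)) \<le> 1 / 2" .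
  define S where "S = (\<Sum>i<Suc n. (16 * A * 2) ^ i)"
  have S: "0 \<le> S" unfolding S_def using A_nonneg by (intro sum_nonneg) auto
  show thesis
  proof (rule that[of "2 * S"])
    fix h :: real and f assume h: "0 < h" and f: "f \<in> XB"
    define G where "G = (\<lambda>x. f x - conv h exp_kernel f x)"
    have G: "G \<in> XB"
      unfolding G_def by (intro XB_diff f conv_mem[OF kernel_exp f h])
    have KG: "(conv h ramp_kernel ^^ Suc n) G \<in> XB"
      "N ((conv h ramp_kernel ^^ Suc n) G) \<le> 16 * A * ((1 / 2) ^ n * (1 + (real n + 1)\<^sup>2)) * N G"
      unfolding ramp_funpow[OF G h] by (rule conv_mem[OF kernel_ramp_power G h])+
    have "N G \<le> N (\<lambda>x. G x - (conv h ramp_kernel ^^ Suc n) G x) + N ((conv h ramp_kernel ^^ Suc n) G)"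
      by (intro norm_le_diff_add XB_X G KG)
    also have "N (\<lambda>x. G x - (conv h ramp_kernel ^^ Suc n) G x)
        \<le> S * N (\<lambda>x. G x - conv h ramp_kernel G x)"
      unfolding S_def by (rule id_minus_funpow_norm[OF conv_algebra.convolution[OF kernel_ramp] h G])
    also have "(\<lambda>x. G x - conv h ramp_kernel G x) = (\<lambda>x. f x - conv h box_kernel f x)"
      unfolding G_def by (intro ext) (rule one_minus_box_factor[OF f h])
    also have "N ((conv h ramp_kernel ^^ Suc n) G) \<le> 1 / 2 * N G"
      using KG(2) mult_right_mono[OF n norm_nonneg[OF XB_X[OF G]]] by simp
    finally show "N (\<lambda>x. f x - conv h exp_kernel f x) \<le> 2 * S * N (\<lambda>x. f x - conv h box_kernel f x)"
      unfolding G_def[symmetric] by simp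
  qed (use S in simp)
qed

subsection \<open>The resolvent as an antiderivative\<close>

lemma conv_window:
  assumes "w \<in> XB" "0 < h" "0 \<le> t"
  shows "conv h (indicator {0..<t}) w a = (1 / h) *\<^sub>R integral {a..a + h * t} w"
proof -
  note [measurable] = XB_measurable[OF assms(1)]
  have "integral {a..a + h * t} w = (LINT z|lborel. indicator {a..a + h * t} z *\<^sub>R w z)"
    using set_borel_integral_eq_integral(2)[OF XB_set_integrable[OF assms(1)]]
    by (simp add: set_lebesgue_integral_def)
  also have "\<dots> = (LINT z|lborel. indicator {a..<a + h * t} z *\<^sub>R w z)"
    by (rule integral_cong_AE, measurable)
       (use AE_lborel_singleton[of "a + h * t"] in \<open>eventually_elim, auto simp: indicator_def\<close>)
  also have "\<dots> = h *\<^sub>R (LINT u|lborel. indicator {a..<a + h * t} (a + h * u) *\<^sub>R w (a + h * u))"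
    using assms(2) by (subst lborel_integral_real_affine[where c = h and t = a]) auto
  also have "(LINT u|lborel. indicator {a..<a + h * t} (a + h * u) *\<^sub>R w (a + h * u))
      = conv h (indicator {0..<t}) w a"
    unfolding conv_def using assms(2)
    by (intro Bochner_Integration.integral_cong) (auto simp: indicator_def zero_le_mult_iff)
  finally show ?thesis using assms(2) by simp
qed

lemma kernel_window: "kernel (1 + t\<^sup>2) (indicator {0..<t})"
proof (rule kernelI)
  show "\<bar>indicator {0..<t} u\<bar> * (1 + u\<^sup>2) \<le> 1 + t\<^sup>2" for u
    by (auto simp: indicator_def power_mono)
qed simp

lemma resolvent_difference:
  assumes "v \<in> XB" "0 < h" "0 \<le> t"
  shows "conv h (indicator {0..<t}) (\<lambda>x. v x - conv h exp_kernel v x) a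
    = conv h exp_kernel v a - conv h exp_kernel v (a + h * t)"
proof -
  let ?w = "indicator {0..<t} :: real \<Rightarrow> real"
  have kw: "kernel (1 + t\<^sup>2) ?w" by (rule kernel_window)
  have shift: "conv h (\<lambda>s. exp_kernel (s - t)) v a = conv h exp_kernel v (a + h * t)"
    unfolding conv_def using lborel_integral_real_affine[of 1 "\<lambda>s. exp_kernel (s - t) *\<^sub>R v (a + h * s)" t]
    by (simp add: algebra_simps)
  \<comment> \<open>Peetre's inequality shows that a translate of a kernel is a kernel.\<close>
  have ke: "\<exists>M. kernel M (\<lambda>s. exp_kernel (s - t))"
  proof -
    have "\<bar>exp_kernel (s - t)\<bar> * (1 + s\<^sup>2) \<le> 2 * (2 + 2 * t\<^sup>2)" for s
    proof -
      have "1 + s\<^sup>2 \<le> (1 + (s - t)\<^sup>2) * (2 + 2 * t\<^sup>2)"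
      proof -
        have "0 \<le> (s - 2 * t)\<^sup>2 + 1 + 2 * t\<^sup>2 * (s - t)\<^sup>2" by simp
        then show ?thesis by (simp add: power2_eq_square algebra_simps)
      qed
      then have "\<bar>exp_kernel (s - t)\<bar> * (1 + s\<^sup>2) \<le> \<bar>exp_kernel (s - t)\<bar> * ((1 + (s - t)\<^sup>2) * (2 + 2 * t\<^sup>2))"
        by (intro mult_left_mono) auto
      also have "\<dots> \<le> 2 * (2 + 2 * t\<^sup>2)"
      proof -
        have "\<bar>exp_kernel (s - t)\<bar> * (1 + (s - t)\<^sup>2) \<le> 2"
          using kernel_exp one_plus_square_pos unfolding kernel_def by (auto simp: pos_le_divide_eq)
        from mult_right_mono[OF this, of "2 + 2 * t\<^sup>2"] show ?thesis
          by (simp add: mult.assoc)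
      qed
      finally show ?thesis .
    qed
    then show ?thesis using kernel_measurable[OF kernel_exp]
      by (intro exI[of _ "2 * (2 + 2 * t\<^sup>2)"] kernelI) auto
  qed
  then obtain M where ke: "kernel M (\<lambda>s. exp_kernel (s - t))" ..
  have "conv h ?w (conv h exp_kernel v) a = conv h (\<lambda>s. ?w s - exp_kernel s + exp_kernel (s - t)) v a"
    unfolding conv_conv[OF kw kernel_exp assms(1,2)] window_convolve_exp[OF assms(3)] ..
  also have "\<dots> = conv h ?w v a - conv h exp_kernel v a + conv h exp_kernel v (a + h * t)"
    using conv_kernel_add[OF kernel_add[OF kw kernel_minus[OF kernel_exp]] ke assms(1,2)]
      conv_kernel_add[OF kw kernel_minus[OF kernel_exp] assms(1,2)]
    by (simp add: conv_kernel_minus shift)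
  finally show ?thesis
    using conv_diff[OF kw assms(1) conv_mem(1)[OF kernel_exp assms(1,2)] assms(2)] by simp
qed

lemma resolvent_integral:
  assumes "v \<in> XB" "0 < h" "a \<le> b"
  shows "conv h exp_kernel v b
    = conv h exp_kernel v a - (1 / h) *\<^sub>R integral {a..b} (\<lambda>x. v x - conv h exp_kernel v x)"
proof -
  define t where "t = (b - a) / h"
  have t: "0 \<le> t" and b: "a + h * t = b"
    using assms by (auto simp: t_def)
  show ?thesis
    using resolvent_difference[OF assms(1,2) t, of a]
      conv_window[OF XB_diff[OF assms(1) conv_mem(1)[OF kernel_exp assms(1,2)]] assms(2) t, of a]
    unfolding b by (simp add: algebra_simps)
qed

text \<open>
  Continuity needs only local integrability of \<open>v\<close>; differentiability at every point needs
  continuity of \<open>v\<close> and is therefore available for iterated resolvents.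
\<close>

lemma resolvent_continuous:
  assumes "v \<in> XB" "0 < h"
  shows "isCont (conv h exp_kernel v) x"
proof -
  let ?w = "\<lambda>x. v x - conv h exp_kernel v x"
  let ?a = "x - 1" and ?b = "x + 1"
  have "?w integrable_on {?a..?b}"
    by (intro set_borel_integral_eq_integral(1) XB_set_integrable XB_diff conv_mem[OF kernel_exp] assms)
  then have "continuous_on {?a..?b} (\<lambda>y. conv h exp_kernel v ?a - (1 / h) *\<^sub>R integral {?a..y} ?w)"
    by (intro continuous_intros indefinite_integral_continuous_1)
  then have "continuous_on {?a..?b} (conv h exp_kernel v)"
    by (rule continuous_on_eq) (rule resolvent_integral[OF assms, symmetric], simp)
  then show ?thesis
    by (rule continuous_on_interior) simp
qed

lemma resolvent_derivative:
  assumes "v \<in> XB" "0 < h" "continuous_on UNIV v"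
  shows "(conv h exp_kernel v has_vector_derivative (- 1 / h) *\<^sub>R (v x - conv h exp_kernel v x)) (at x)"
proof -
  let ?w = "\<lambda>x. v x - conv h exp_kernel v x"
  let ?a = "x - 1" and ?b = "x + 1"
  have w: "continuous_on {?a..?b} ?w"
    using resolvent_continuous[OF assms(1,2)]
    by (intro continuous_intros continuous_on_subset[OF assms(3)] continuous_at_imp_continuous_on) auto
  have "((\<lambda>y. conv h exp_kernel v ?a - (1 / h) *\<^sub>R integral {?a..y} ?w)
      has_vector_derivative 0 - (1 / h) *\<^sub>R ?w x) (at x within {?a..?b})"
    by (intro has_vector_derivative_diff has_vector_derivative_const
        bounded_linear.has_vector_derivative[OF bounded_linear_scaleR_right]
        integral_has_vector_derivative[OF w]) auto
  then have "(conv h exp_kernel v has_vector_derivative 0 - (1 / h) *\<^sub>R ?w x) (at x within {?a..?b})"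
    by (rule has_vector_derivative_transform[rotated 2], simp)
       (rule resolvent_integral[OF assms(1,2)], simp)
  then show ?thesis
    by (simp add: at_within_Icc_at)
qed

end

section \<open>Derivatives of smoothed functions\<close>

lemma nth_vderiv_0: "nth_vderiv 0 f = f"
  and nth_vderiv_Suc: "nth_vderiv (Suc n) f = (\<lambda>x. vector_derivative (nth_vderiv n f) (at x))"
  by (simp_all add: nth_vderiv_def)

lemma nth_vderiv_Suc': "nth_vderiv (Suc n) f = nth_vderiv n (\<lambda>x. vector_derivative f (at x))"
  by (simp only: nth_vderiv_def funpow_Suc_right comp_def)

lemma times_differentiable_Suc:
  "times_differentiable (Suc n) f \<longleftrightarrow>
    (\<forall>x. f differentiable (at x)) \<and> times_differentiable n (\<lambda>x. vector_derivative f (at x))"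
  unfolding times_differentiable_def nth_vderiv_Suc'[symmetric]
  by (auto simp: less_Suc_eq_0_disj nth_vderiv_0)

lemma continuous_AE_eq:
  fixes F G :: "real \<Rightarrow> complex"
  assumes "continuous_on UNIV F" "continuous_on UNIV G" "AE x in lebesgue. F x = G x"
  shows "F = G"
proof -
  have "open {x. F x \<noteq> G x}"
    using assms by (intro open_Collect_neq)
  moreover have "negligible {x. F x \<noteq> G x}"
    using assms(3) by (simp add: negligible_iff_null_sets AE_iff_null_sets
        open_Collect_neq[OF assms(1,2)] borel_open)
  ultimately have "{x. F x \<noteq> G x} = {}"
    using open_not_negligible by blast
  then show ?thesis by auto
qed

lemma times_differentiable_imp_continuous:
  "times_differentiable n f \<Longrightarrow> 1 \<le> n \<Longrightarrow> continuous_on UNIV f"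
  unfolding times_differentiable_def
  by (intro continuous_at_imp_continuous_on ballI)
     (metis nth_vderiv_0 differentiable_imp_continuous_within less_le_trans zero_less_one)

text \<open>
  With at least one derivative the representative is continuous, hence unique; for \<open>n = 0\<close> every
  function in the class would qualify.
\<close>

lemma class_deriv_eq:
  assumes "differentiable_rep n f F" "1 \<le> n"
  shows "class_deriv n f = nth_vderiv n F"
proof -
  have "(SOME F. differentiable_rep n f F) = F"
  proof (rule some_equality)
    show "differentiable_rep n f F" by (rule assms(1))
  next
    fix G assume G: "differentiable_rep n f G"
    show "G = F"
    proof (rule continuous_AE_eq)
      show "continuous_on UNIV G" "continuous_on UNIV F"
        using G assms times_differentiable_imp_continuous unfolding differentiable_rep_def by blast+
      have "AE x in lebesgue. G x = f x" "AE x in lebesgue. F x = f x"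
        using G assms unfolding differentiable_rep_def by auto
      then show "AE x in lebesgue. G x = F x" by eventually_elim simp
    qed
  qed
  then show ?thesis by (simp add: class_deriv_def)
qed

context steklov_lattice
begin

lemma resolvent_power_continuous:
  assumes "y \<in> XB" "0 < h" "continuous_on UNIV y"
  shows "continuous_on UNIV ((conv h exp_kernel ^^ n) y)"
proof (cases n)
  case (Suc k)
  have "(conv h exp_kernel ^^ k) y \<in> XB"
    by (rule conv_algebra_mem[OF conv_algebra_funpow[OF conv_algebra.convolution[OF kernel_exp]] assms(2,1)])
  then show ?thesis
    using resolvent_continuous[OF _ assms(2)] Suc by (auto intro: continuous_at_imp_continuous_on)
qed (use assms in simp)

text \<open>Each factor \<open>E\<close> of \<open>E\<^sup>n\<close> absorbs one derivative, because \<open>(E y)' = - (y - E y) / h\<close>.\<close>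

lemma resolvent_power_derivative:
  assumes "y \<in> XB" "0 < h" "continuous_on UNIV y"
  defines "Q \<equiv> \<lambda>g x. complex_of_real (- 1 / h) * (g x - conv h exp_kernel g x)"
  shows "times_differentiable n ((conv h exp_kernel ^^ n) y) \<and>
    nth_vderiv n ((conv h exp_kernel ^^ n) y) = (Q ^^ n) y"
  using assms(1,3)
proof (induction n arbitrary: y)
  case 0
  then show ?case by (simp add: times_differentiable_def nth_vderiv_0)
next
  case (Suc n)
  note E = conv_algebra.convolution[OF kernel_exp, of h]
  have Q: "conv_algebra h (cmod (complex_of_real (- 1 / h)) * (1 + 16 * A * 2)) Q"
    unfolding Q_def by (intro conv_algebra.scale conv_algebra_id_minus E)
  define z where "z = (conv h exp_kernel ^^ n) y"
  have z: "z \<in> XB" "continuous_on UNIV z"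
    using conv_algebra_mem[OF conv_algebra_funpow[OF E] assms(2) Suc.prems(1)]
      resolvent_power_continuous[OF Suc.prems(1) assms(2) Suc.prems(2)] by (auto simp: z_def)
  have deriv: "(conv h exp_kernel z has_vector_derivative Q z x) (at x)" for x
    using resolvent_derivative[OF z(1) assms(2) z(2)] unfolding Q_def by (simp add: scaleR_conv_of_real)
  have Qz: "Q z = (conv h exp_kernel ^^ n) (Q y)"
    unfolding z_def by (rule conv_algebra_commute[OF Q conv_algebra_funpow[OF E] assms(2) Suc.prems(1)])
  have "continuous_on UNIV (conv h exp_kernel y)"
    using resolvent_continuous[OF Suc.prems(1) assms(2)] by (auto intro: continuous_at_imp_continuous_on)
  then have "continuous_on UNIV (Q y)"
    unfolding Q_def using Suc.prems(2) by (intro continuous_intros)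
  moreover have "Q y \<in> XB"
    by (rule conv_algebra_mem[OF Q assms(2) Suc.prems(1)])
  ultimately have IH: "times_differentiable n (Q z)" "nth_vderiv n (Q z) = (Q ^^ n) (Q y)"
    using Suc.IH[of "Q y"] by (auto simp: Qz)
  have v: "(\<lambda>x. vector_derivative (conv h exp_kernel z) (at x)) = Q z"
    using deriv by (auto intro: vector_derivative_at)
  have "(conv h exp_kernel ^^ Suc n) y = conv h exp_kernel z" by (simp add: z_def)
  moreover have "conv h exp_kernel z differentiable (at x)" for x
    using deriv by (rule differentiableI_vector)
  ultimately show ?case
    using IH by (simp add: times_differentiable_Suc nth_vderiv_Suc' v funpow_swap1)
qed

lemma scaled_funpow:
  assumes L: "conv_algebra h M L"
  shows "((\<lambda>g x. c * L g x) ^^ n) f = (\<lambda>x. c ^ n * (L ^^ n) f x)"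
  by (induction n) (auto simp: conv_algebra_scale[OF L] mult.assoc)

text \<open>
  Integration by parts of \<open>(1 - t) F (x + h t)\<close> over \<open>[0, 1]\<close>.
\<close>

lemma one_minus_box_of_derivative:
  assumes F: "F \<in> XB" and F': "F' \<in> XB" and h: "0 < h"
    and deriv: "\<And>x. (F has_vector_derivative F' x) (at x)" and cont: "continuous_on UNIV F'"
  shows "F x - conv h box_kernel F x = complex_of_real (- h) * conv h tri_kernel F' x"
proof -
  have cF: "continuous_on UNIV F"
    using deriv by (meson continuous_at_imp_continuous_on has_vector_derivative_continuous)
  have "((\<lambda>t. (1 - t) *\<^sub>R F (x + h * t)) has_vector_derivative
      (1 - t) *\<^sub>R (h *\<^sub>R F' (x + h * t)) + (- 1) *\<^sub>R F (x + h * t)) (at t within {0..1})" for t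
  proof (rule has_vector_derivative_scaleR)
    show "((-) 1 has_real_derivative - 1) (at t within {0..1})"
      by (auto intro!: derivative_eq_intros)
    have "((\<lambda>t. F (x + h * t)) has_vector_derivative h *\<^sub>R F' (x + h * t)) (at t)"
    proof -
      have "((\<lambda>t. x + h * t) has_vector_derivative h) (at t)"
        by (auto intro!: derivative_eq_intros
            simp: has_real_derivative_iff_has_vector_derivative[symmetric])
      from vector_diff_chain_at[OF this deriv] show ?thesis by (simp add: o_def)
    qed
    then show "((\<lambda>t. F (x + h * t)) has_vector_derivative h *\<^sub>R F' (x + h * t)) (at t within {0..1})"
      by (rule has_vector_derivative_at_within)
  qed
  moreover have "continuous_on {0..1} (\<lambda>t. (1 - t) *\<^sub>R (h *\<^sub>R F' (x + h * t)) + (- 1) *\<^sub>R F (x + h * t))"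
    by (intro continuous_intros continuous_on_compose2[OF cont] continuous_on_compose2[OF cF]) auto
  ultimately have "(LINT t|lborel. indicator {0..1} t *\<^sub>R
      ((1 - t) *\<^sub>R (h *\<^sub>R F' (x + h * t)) + (- 1) *\<^sub>R F (x + h * t)))
      = (1 - 1) *\<^sub>R F (x + h * 1) - (1 - 0) *\<^sub>R F (x + h * 0)"
    by (intro integral_FTC_atLeastAtMost) auto
  moreover have "indicator {0..1} t *\<^sub>R ((1 - t) *\<^sub>R (h *\<^sub>R F' (x + h * t)) + (- 1) *\<^sub>R F (x + h * t))
      = h *\<^sub>R (tri_kernel t *\<^sub>R F' (x + h * t)) - box_kernel t *\<^sub>R F (x + h * t)" for t
    by (simp add: tri_kernel_def box_kernel_def indicator_def algebra_simps)
  moreover have "(LINT t|lborel. h *\<^sub>R (tri_kernel t *\<^sub>R F' (x + h * t)) - box_kernel t *\<^sub>R F (x + h * t))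
      = h *\<^sub>R conv h tri_kernel F' x - conv h box_kernel F x"
    unfolding conv_def
    using conv_integrable[OF kernel_tri F' h] conv_integrable[OF kernel_box F h]
    by (simp del: scaleR_scaleR)
  ultimately have "h *\<^sub>R conv h tri_kernel F' x - conv h box_kernel F x = - F x"
    by (simp del: scaleR_conv_of_real)
  then show ?thesis by (simp add: scaleR_conv_of_real algebra_simps)
qed

text \<open>
  Iterating the preceding identity needs no derivative of a convolution: the forward difference is
  moved past the triangular averages by commutativity, and meets the derivative itself.
\<close>

lemma one_minus_box_power_of_smooth:
  assumes "smooth_fun F" "\<And>i. i \<le> n \<Longrightarrow> nth_vderiv i F \<in> X" "0 < h"
  shows "N (((\<lambda>g x. g x - conv h box_kernel g x) ^^ n) F) \<le> (32 * A * h) ^ n * N (nth_vderiv n F)"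
proof -
  let ?D = "\<lambda>g x. g x - conv h box_kernel g x"
  note T = conv_algebra.convolution[OF kernel_tri, of h]
  note Tn = conv_algebra_funpow[OF T]
  have D: "conv_algebra h (1 + 16 * A * 2) ?D"
    by (intro conv_algebra_id_minus conv_algebra.convolution kernel_box)
  have diff: "nth_vderiv i F differentiable (at x)" for i x
    using assms(1) unfolding smooth_fun_def times_differentiable_def by auto
  then have cont: "continuous_on UNIV (nth_vderiv i F)" for i
    by (auto intro: continuous_at_imp_continuous_on differentiable_imp_continuous_within)
  have mem: "nth_vderiv i F \<in> XB" if "i \<le> n" for i
    using assms(2)[OF that] borel_measurable_continuous_onI[OF cont] by (simp add: XB_def)
  have step: "?D (nth_vderiv i F) = (\<lambda>x. complex_of_real (- h) * conv h tri_kernel (nth_vderiv (Suc i) F) x)"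
    if "Suc i \<le> n" for i
    using that one_minus_box_of_derivative[OF mem[of i] mem[of "Suc i"] assms(3) _ cont] diff
    by (auto simp: nth_vderiv_Suc vector_derivative_works)
  have "(?D ^^ k) F = (\<lambda>x. complex_of_real (- h) ^ k * (conv h tri_kernel ^^ k) (nth_vderiv k F) x)"
    if "k \<le> n" for k
    using that
  proof (induction k)
    case (Suc k)
    then have k: "k \<le> n" by simp
    have "(?D ^^ Suc k) F
        = ?D (\<lambda>x. complex_of_real (- h) ^ k * (conv h tri_kernel ^^ k) (nth_vderiv k F) x)"
      using Suc.IH[OF k] by simp
    also have "\<dots> = (\<lambda>x. complex_of_real (- h) ^ k * ?D ((conv h tri_kernel ^^ k) (nth_vderiv k F)) x)"
      by (rule conv_algebra_scale[OF D])
    also have "?D ((conv h tri_kernel ^^ k) (nth_vderiv k F)) = (conv h tri_kernel ^^ k) (?D (nth_vderiv k F))"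
      by (rule conv_algebra_commute[OF D Tn assms(3) mem[OF k]])
    also have "?D (nth_vderiv k F) = (\<lambda>x. complex_of_real (- h) * conv h tri_kernel (nth_vderiv (Suc k) F) x)"
      by (rule step[OF Suc.prems])
    also have "(conv h tri_kernel ^^ k) \<dots>
        = (\<lambda>x. complex_of_real (- h) * (conv h tri_kernel ^^ k) (conv h tri_kernel (nth_vderiv (Suc k) F)) x)"
      by (rule conv_algebra_scale[OF Tn])
    finally show ?case
      by (simp only: funpow_Suc_right comp_def power_Suc mult_ac)
  qed (simp add: nth_vderiv_0)
  from this[of n] have eq: "(?D ^^ n) F
      = (\<lambda>x. complex_of_real (- h) ^ n * (conv h tri_kernel ^^ n) (nth_vderiv n F) x)" by simp
  have "N ((?D ^^ n) F) = h ^ n * N ((conv h tri_kernel ^^ n) (nth_vderiv n F))"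
    unfolding eq using conv_algebra_mem[OF Tn assms(3) mem[of n]] assms(3)
    by (subst norm_scale) (auto simp: XB_X norm_power)
  also have "\<dots> \<le> h ^ n * ((16 * A * 2) ^ n * N (nth_vderiv n F))"
    using assms(3) by (intro mult_left_mono conv_algebra_norm[OF Tn] mem) auto
  finally show ?thesis by (simp add: power_mult_distrib mult_ac)
qed

end

section \<open>A band-limited approximate identity\<close>

definition sinc :: "real \<Rightarrow> real" where
  "sinc x = (if x = 0 then 1 else sin x / x)"

lemma sinc_measurable[measurable]: "sinc \<in> borel_measurable borel"
  unfolding sinc_def[abs_def] by measurable

lemma abs_sinc_le_1: "\<bar>sinc x\<bar> \<le> 1"
  using abs_sin_x_le_abs_x[of x] by (auto simp: sinc_def divide_le_eq_1)

lemma integral_cis: "(LINT w|lborel. indicator {-1..1} w *\<^sub>R cis (x * w)) = 2 * complex_of_real (sinc x)"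
proof (cases "x = 0")
  case True
  then show ?thesis by (simp add: sinc_def scaleR_conv_of_real)
next
  case False
  have "(LINT w|lborel. indicator {-1..1} w *\<^sub>R cis (x * w))
     = cis (x * 1) / (\<i> * x) - cis (x * - 1) / (\<i> * x)"
  proof (rule integral_FTC_atLeastAtMost)
    show "continuous_on {-1..1} (\<lambda>w. cis (x * w))"
      by (intro continuous_intros)
    show "((\<lambda>w. cis (x * w) / (\<i> * x)) has_vector_derivative cis (x * w)) (at w within {-1..1})" for w
      unfolding has_vector_derivative_complex_iff using False
      by (auto intro!: derivative_eq_intros simp: Re_divide Im_divide field_simps power2_eq_square)
  qed simp
  also have "\<dots> = 2 * complex_of_real (sin x / x)"
    using False by (simp add: complex_eq_iff Re_divide Im_divide field_simps power2_eq_square)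
  finally show ?thesis using False by (simp add: sinc_def)
qed

lemma sinc_power_bound:
  assumes "0 < d"
  shows "sinc (d * t) ^ 4 \<le> (1 + 1 / d\<^sup>2)\<^sup>2 / (1 + t\<^sup>2)\<^sup>2"
proof -
  have "\<bar>sinc (d * t)\<bar> * \<bar>d * t\<bar> \<le> 1"
    by (auto simp: sinc_def)
  then have "(\<bar>sinc (d * t)\<bar> * \<bar>d * t\<bar>)\<^sup>2 \<le> 1\<^sup>2"
    by (intro power_mono) auto
  then have "(sinc (d * t))\<^sup>2 * t\<^sup>2 \<le> 1 / d\<^sup>2"
    using assms by (simp add: power_mult_distrib field_simps)
  moreover have "(sinc (d * t))\<^sup>2 \<le> 1"
    using abs_sinc_le_1[of "d * t"] by (simp add: abs_square_le_1)
  ultimately have "(sinc (d * t))\<^sup>2 * (1 + t\<^sup>2) \<le> 1 + 1 / d\<^sup>2"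
    by (simp add: distrib_left)
  then have "((sinc (d * t))\<^sup>2 * (1 + t\<^sup>2))\<^sup>2 \<le> (1 + 1 / d\<^sup>2)\<^sup>2"
    by (intro power_mono) auto
  then show ?thesis
    using one_plus_square_pos[of t] by (simp add: power_mult_distrib pos_le_divide_eq power_mult[symmetric])
qed

lemma quadratic_sq_imp_kernel:
  assumes "a \<in> borel_measurable borel" "0 \<le> M" "\<And>t. \<bar>a t\<bar> \<le> M / (1 + t\<^sup>2)\<^sup>2"
  shows "kernel M a"
  unfolding kernel_def
proof (intro conjI allI)
  fix t :: real
  have "(1 + t\<^sup>2) * 1 \<le> (1 + t\<^sup>2) * (1 + t\<^sup>2)"
    by (intro mult_left_mono) auto
  then have "M / (1 + t\<^sup>2)\<^sup>2 \<le> M / (1 + t\<^sup>2)"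
    using assms(2) one_plus_square_pos[of t]
    by (intro divide_left_mono) (auto simp: power2_eq_square)
  then show "\<bar>a t\<bar> \<le> M / (1 + t\<^sup>2)" using assms(3)[of t] by linarith
qed (rule assms)

lemma sinc_power_kernel:
  assumes "0 < d"
  shows "kernel ((1 + 1 / d\<^sup>2)\<^sup>2) (\<lambda>t. sinc (d * t) ^ 4)"
proof (rule quadratic_sq_imp_kernel)
  show "\<bar>sinc (d * t) ^ 4\<bar> \<le> (1 + 1 / d\<^sup>2)\<^sup>2 / (1 + t\<^sup>2)\<^sup>2" for t
    using sinc_power_bound[OF assms] by (simp add: power_even_abs)
qed auto

lemma integral_sinc_power_pos:
  assumes "0 < d"
  shows "0 < (LINT t|lborel. sinc (d * t) ^ 4)"
proof -
  have int: "integrable lborel (\<lambda>t. sinc (d * t) ^ 4)"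
    by (rule kernel_integrable[OF sinc_power_kernel[OF assms]])
  have "0 \<le> (LINT t|lborel. sinc (d * t) ^ 4)"
    by (intro integral_nonneg_AE) auto
  moreover have "(LINT t|lborel. sinc (d * t) ^ 4) \<noteq> 0"
  proof
    assume "(LINT t|lborel. sinc (d * t) ^ 4) = 0"
    then have "AE t in lborel. sinc (d * t) ^ 4 = 0"
      using integral_nonneg_eq_0_iff_AE[OF int] by auto
    moreover have "sinc (d * t) \<noteq> 0" if "0 < t" "t < 1 / d" for t
    proof -
      have "0 < d * t" "d * t < pi"
        using that assms pi_gt3 by (auto simp: field_simps)
      then show ?thesis using sin_gt_zero[of "d * t"] by (auto simp: sinc_def)
    qed
    ultimately have "AE t in lborel. t \<notin> {0<..<1 / d}"
      by (auto elim!: eventually_mono)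
    then have "emeasure lborel {0<..<1 / d} = 0"
    proof -
      have "{t \<in> space lborel. \<not> t \<notin> {0<..<1 / d}} = {0<..<1 / d}" by auto
      from AE_iff_measurable[OF _ this] show ?thesis
        using \<open>AE t in lborel. t \<notin> {0<..<1 / d}\<close> by simp
    qed
    then show False using assms by simp
  qed
  ultimately show ?thesis by (metis order_le_less)
qed

text \<open>
  The fourth power is the smallest even one whose tail integrals decay at least as fast as the
  kernels \<open>1 / (1 + t\<^sup>2)\<close>; this is what a first-order Jackson estimate uses.
\<close>

definition jackson_kernel :: "real \<Rightarrow> real \<Rightarrow> real" where
  "jackson_kernel d t = sinc (d * t) ^ 4 / (LINT t|lborel. sinc (d * t) ^ 4)"

lemma jackson_kernel_bound:
  assumes "0 < d"
  defines "M \<equiv> (1 + 1 / d\<^sup>2)\<^sup>2 / (LINT t|lborel. sinc (d * t) ^ 4)"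
  shows "\<bar>jackson_kernel d t\<bar> \<le> M / (1 + t\<^sup>2)\<^sup>2" "kernel M (jackson_kernel d)" "0 \<le> M"
proof -
  let ?Z = "LINT t|lborel. sinc (d * t) ^ 4"
  have Z: "0 < ?Z" by (rule integral_sinc_power_pos[OF assms(1)])
  show b: "\<bar>jackson_kernel d t\<bar> \<le> M / (1 + t\<^sup>2)\<^sup>2" for t
    using divide_right_mono[OF sinc_power_bound[OF assms(1), of t], of ?Z] Z
    by (simp add: jackson_kernel_def M_def power_even_abs mult.commute)
  show M: "0 \<le> M" unfolding M_def using Z by simp
  show "kernel M (jackson_kernel d)"
    by (rule quadratic_sq_imp_kernel[OF _ M b]) (simp add: jackson_kernel_def[abs_def])
qed

lemma integral_jackson_kernel: "0 < d \<Longrightarrow> (LINT t|lborel. jackson_kernel d t) = 1"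
  using integral_sinc_power_pos[of d] by (simp add: jackson_kernel_def)


section \<open>Approximation by band-limited functions\<close>

context steklov_lattice
begin

text \<open>
  Increments of \<open>E v\<close> are integrals of \<open>(v - E v) / h\<close> between the two points. The symmetric
  interval around \<open>x\<close> serves both signs of \<open>t\<close>.
\<close>

lemma resolvent_increment:
  assumes v: "v \<in> XB" and h: "0 < h"
  defines "W \<equiv> \<lambda>x. v x - conv h exp_kernel v x"
  shows "cmod (conv h exp_kernel v x - conv h exp_kernel v (x + h * t)) \<le> mass W x (h * \<bar>t\<bar>) / h"
proof -
  have W: "W \<in> XB"
    unfolding W_def by (intro XB_diff v conv_mem[OF kernel_exp v h])
  have *: "cmod (conv h exp_kernel v a - conv h exp_kernel v b) \<le> mass W x (h * \<bar>t\<bar>) / h"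
    if ab: "a \<le> b" "{a..b} \<subseteq> {x - h * \<bar>t\<bar>..x + h * \<bar>t\<bar>}" for a b
  proof -
    have "cmod (conv h exp_kernel v a - conv h exp_kernel v b) = (1 / h) * cmod (integral {a..b} W)"
      using resolvent_integral[OF v h ab(1)] h by (simp add: W_def)
    also have "cmod (integral {a..b} W) = cmod (LINT z|lborel. indicator {a..b} z *\<^sub>R W z)"
      using set_borel_integral_eq_integral(2)[OF XB_set_integrable[OF W]]
      by (simp add: set_lebesgue_integral_def)
    also have "\<dots> \<le> (LINT z|lborel. norm (indicator {a..b} z *\<^sub>R W z))"
      by (rule integral_norm_bound)
    also have "\<dots> \<le> mass W x (h * \<bar>t\<bar>)"
      unfolding mass_def set_lebesgue_integral_def
      using XB_set_integrable[OF W] XB_set_integrable_cmod[OF W] ab(2)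
      by (intro integral_mono integrable_norm) (auto simp: set_integrable_def indicator_def)
    finally show ?thesis using h by (simp add: divide_right_mono)
  qed
  show ?thesis
  proof (cases "0 \<le> t")
    case True
    have "0 \<le> h * t" using True h by simp
    then show ?thesis using *[of x "x + h * t"] True by auto
  next
    case False
    have "h * t \<le> 0" using False h by (simp add: mult_le_0_iff)
    then show ?thesis using *[of "x + h * t" x] False by (auto simp: norm_minus_commute)
  qed
qed

text \<open>
  As \<open>a\<close> has integral one, the error at \<open>x\<close> is the integral of increments of \<open>E v\<close> against \<open>a\<close>.
  Exchanging the integrals puts on \<open>\<bar>v - E v\<bar>\<close> the weight \<open>\<integral> \<bar>a t\<bar>\<close> over \<open>\<bar>t\<bar> \<ge> \<bar>u\<bar>\<close>, which the
  decay of \<open>a\<close> bounds by a multiple of \<open>1 / (1 + u\<^sup>2)\<close>.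
\<close>

lemma averaged_resolvent_error:
  assumes a: "a \<in> borel_measurable borel" "\<And>t. \<bar>a t\<bar> \<le> M / (1 + t\<^sup>2)\<^sup>2" "0 \<le> M"
    and mass1: "(LINT t|lborel. a t) = 1"
    and v: "v \<in> XB" and h: "0 < h"
  defines "I \<equiv> LINT t|lborel. 1 / (1 + t\<^sup>2 :: real)"
  shows "N (\<lambda>x. conv h exp_kernel v x - conv h a (conv h exp_kernel v) x)
      \<le> 16 * A * (M * I) * N (\<lambda>x. v x - conv h exp_kernel v x)"
proof -
  note [measurable] = a(1)
  have ka: "kernel M a" by (rule quadratic_sq_imp_kernel[OF a(1) a(3) a(2)])
  let ?E = "conv h exp_kernel v"
  define W where "W = (\<lambda>x. v x - conv h exp_kernel v x)"
  have E: "?E \<in> XB" by (rule conv_mem[OF kernel_exp v h])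
  have W: "W \<in> XB" unfolding W_def by (intro XB_diff v E)
  note [measurable] = XB_measurable[OF W] XB_measurable[OF E]
  have I: "0 \<le> I" unfolding I_def by (intro integral_nonneg_AE) auto
  have nnI: "(\<integral>\<^sup>+t. ennreal (1 / (1 + t\<^sup>2)) \<partial>lborel) = ennreal I"
    unfolding I_def by (intro nn_integral_eq_integral integrable_inverse_quadratic) auto
  have tail: "(\<integral>\<^sup>+t. ennreal \<bar>a t\<bar> * indicator {- \<bar>t\<bar>..\<bar>t\<bar>} u \<partial>lborel) \<le> ennreal (M * I) * ennreal (1 / (1 + u\<^sup>2))"
    for u :: real
  proof -
    have "(\<integral>\<^sup>+t. ennreal \<bar>a t\<bar> * indicator {- \<bar>t\<bar>..\<bar>t\<bar>} u \<partial>lborel)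
        \<le> (\<integral>\<^sup>+t. ennreal (M * (1 / (1 + u\<^sup>2))) * ennreal (1 / (1 + t\<^sup>2)) \<partial>lborel)"
    proof (intro nn_integral_mono)
      fix t :: real
      show "ennreal \<bar>a t\<bar> * indicator {- \<bar>t\<bar>..\<bar>t\<bar>} u
          \<le> ennreal (M * (1 / (1 + u\<^sup>2))) * ennreal (1 / (1 + t\<^sup>2))"
      proof (cases "u \<in> {- \<bar>t\<bar>..\<bar>t\<bar>}")
        case True
        then have "u\<^sup>2 \<le> t\<^sup>2" by (simp add: abs_le_square_iff[symmetric] abs_le_iff)
        then have "1 / (1 + t\<^sup>2) \<le> 1 / (1 + u\<^sup>2)"
          by (intro divide_left_mono) (auto simp: one_plus_square_pos)
        then have "M * (1 / (1 + t\<^sup>2)) * (1 / (1 + t\<^sup>2)) \<le> M * (1 / (1 + u\<^sup>2)) * (1 / (1 + t\<^sup>2))"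
          using a(3) by (intro mult_right_mono mult_left_mono) auto
        then have "\<bar>a t\<bar> \<le> M * (1 / (1 + u\<^sup>2)) * (1 / (1 + t\<^sup>2))"
          using a(2)[of t] by (simp add: power2_eq_square)
        then show ?thesis
          using True a(3) by (simp add: ennreal_mult[symmetric] ennreal_leI)
      qed simp
    qed
    also have "\<dots> = ennreal (M * (1 / (1 + u\<^sup>2))) * ennreal I"
      unfolding nnI[symmetric] by (rule nn_integral_cmult) measurable
    also have "\<dots> = ennreal (M * I) * ennreal (1 / (1 + u\<^sup>2))"
      using a(3) I by (simp add: ennreal_mult[symmetric] mult_ac)
    finally show ?thesis .
  qed
  have pw: "cmod (?E x - conv h a ?E x) \<le> M * I * poisson h W x" for x
  proof -
    have const: "integrable lborel (\<lambda>t. a t *\<^sub>R ?E x)"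
      by (intro integrable_scaleR_left kernel_integrable[OF ka])
    have int: "integrable lborel (\<lambda>t. a t *\<^sub>R (?E x - ?E (x + h * t)))"
      unfolding scaleR_diff_right
      by (intro Bochner_Integration.integrable_diff const conv_integrable[OF ka E h])
    have "?E x - conv h a ?E x = (LINT t|lborel. a t *\<^sub>R (?E x - ?E (x + h * t)))"
      unfolding conv_def[of h a] scaleR_diff_right
      using const conv_integrable[OF ka E h] kernel_integrable[OF ka]
      by (subst Bochner_Integration.integral_diff) (auto simp: mass1)
    then have "ennreal (cmod (?E x - conv h a ?E x))
        \<le> (\<integral>\<^sup>+t. ennreal (norm (a t *\<^sub>R (?E x - ?E (x + h * t)))) \<partial>lborel)"
      using integral_norm_bound_ennreal[OF int] by simp
    also have "\<dots> \<le> (\<integral>\<^sup>+t. ennreal \<bar>a t\<bar> *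
        (\<integral>\<^sup>+u\<in>{-\<bar>t\<bar>..\<bar>t\<bar>}. ennreal (cmod (W (x + h * u))) \<partial>lborel) \<partial>lborel)"
    proof (intro nn_integral_mono)
      fix t
      have "norm (a t *\<^sub>R (?E x - ?E (x + h * t))) \<le> \<bar>a t\<bar> * (mass W x (h * \<bar>t\<bar>) / h)"
        using mult_left_mono[OF resolvent_increment[OF v h, of x t], of "\<bar>a t\<bar>"] by (simp add: W_def)
      then show "ennreal (norm (a t *\<^sub>R (?E x - ?E (x + h * t))))
        \<le> ennreal \<bar>a t\<bar> * (\<integral>\<^sup>+u\<in>{-\<bar>t\<bar>..\<bar>t\<bar>}. ennreal (cmod (W (x + h * u))) \<partial>lborel)"
        unfolding nn_integral_window[OF W h] using h
        by (subst ennreal_mult[symmetric]) (auto simp: mass_nonneg intro: ennreal_leI)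
    qed
    also have "\<dots> = (\<integral>\<^sup>+t. (\<integral>\<^sup>+u. ennreal (cmod (W (x + h * u))) * (ennreal \<bar>a t\<bar> * indicator {- \<bar>t\<bar>..\<bar>t\<bar>} u) \<partial>lborel) \<partial>lborel)"
      by (intro nn_integral_cong, subst nn_integral_cmult[symmetric])
         (auto simp: mult_ac intro!: nn_integral_cong)
    also have "\<dots> = (\<integral>\<^sup>+u. (\<integral>\<^sup>+t. ennreal (cmod (W (x + h * u))) * (ennreal \<bar>a t\<bar> * indicator {- \<bar>t\<bar>..\<bar>t\<bar>} u) \<partial>lborel) \<partial>lborel)"
      by (rule lborel_pair.Fubini') (simp add: indicator_def, measurable)
    also have "\<dots> = (\<integral>\<^sup>+u. ennreal (cmod (W (x + h * u))) * (\<integral>\<^sup>+t. ennreal \<bar>a t\<bar> * indicator {- \<bar>t\<bar>..\<bar>t\<bar>} u \<partial>lborel) \<partial>lborel)"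
      by (intro nn_integral_cong nn_integral_cmult) (simp add: indicator_def, measurable)
    also have "\<dots> \<le> (\<integral>\<^sup>+u. ennreal (M * I) * ennreal (cmod (W (x + h * u)) / (1 + u\<^sup>2)) \<partial>lborel)"
    proof (intro nn_integral_mono)
      fix u
      have "ennreal (cmod (W (x + h * u))) * (\<integral>\<^sup>+t. ennreal \<bar>a t\<bar> * indicator {- \<bar>t\<bar>..\<bar>t\<bar>} u \<partial>lborel)
        \<le> ennreal (cmod (W (x + h * u))) * (ennreal (M * I) * ennreal (1 / (1 + u\<^sup>2)))"
        by (intro mult_left_mono tail) auto
      also have "\<dots> = ennreal (M * I) * ennreal (cmod (W (x + h * u)) / (1 + u\<^sup>2))"
        using a(3) I by (simp add: ennreal_mult[symmetric] mult_ac)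
      finally show "ennreal (cmod (W (x + h * u))) * (\<integral>\<^sup>+t. ennreal \<bar>a t\<bar> * indicator {- \<bar>t\<bar>..\<bar>t\<bar>} u \<partial>lborel)
        \<le> ennreal (M * I) * ennreal (cmod (W (x + h * u)) / (1 + u\<^sup>2))" .
    qed
    also have "\<dots> = ennreal (M * I) * (\<integral>\<^sup>+u. ennreal (cmod (W (x + h * u)) / (1 + u\<^sup>2)) \<partial>lborel)"
      by (rule nn_integral_cmult) measurable
    also have "(\<integral>\<^sup>+u. ennreal (cmod (W (x + h * u)) / (1 + u\<^sup>2)) \<partial>lborel) = ennreal (poisson h W x)"
      unfolding poisson_def by (intro nn_integral_eq_integral poisson_integrable W h) auto
    finally show ?thesis
      using a(3) I by (simp add: ennreal_mult[symmetric] poisson_nonneg)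
  qed
  let ?P = "\<lambda>x. complex_of_real (M * I) * complex_of_real (poisson h W x)"
  have P: "?P \<in> X" by (intro scale_closed XB_X poisson_mem W h)
  have "N (\<lambda>x. ?E x - conv h a ?E x) \<le> N ?P"
  proof (rule XB_ideal(2)[OF _ P])
    show "(\<lambda>x. ?E x - conv h a ?E x) \<in> borel_measurable borel"
      using XB_measurable[OF conv_mem(1)[OF ka E h]] by measurable
    show "cmod (?E x - conv h a ?E x) \<le> cmod (?P x)" for x
      using pw[of x] a(3) I by (simp add: norm_mult poisson_nonneg del: of_real_mult)
  qed
  also have "N ?P = M * I * N (\<lambda>x. complex_of_real (poisson h W x))"
    using norm_scale[OF XB_X[OF poisson_mem[OF W h]], of "complex_of_real (M * I)"] a(3) I
    by (simp del: of_real_mult)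
  also have "\<dots> \<le> M * I * (16 * A * N W)"
    using a(3) I by (intro mult_left_mono poisson_norm W h) auto
  finally show ?thesis by (simp add: W_def mult_ac)
qed

text \<open>
  Divisibility of \<open>1 - (1 - L)\<^sup>n\<close> by \<open>L\<close> in the polynomials; the norm bound of the quotient is fixed
  before \<open>h\<close> and \<open>L\<close>, which keeps later constants independent of the scale.
\<close>

lemma id_minus_power_factor:
  "\<exists>M'. \<forall>h>0. \<forall>L. conv_algebra h M L \<longrightarrow> (\<exists>U. conv_algebra h M' U \<and>
     (\<forall>f\<in>XB. (\<lambda>x. f x - ((\<lambda>g x. g x - L g x) ^^ n) f x) = L (U f)))"
proof (induction n)
  case 0
  show ?case
  proof (intro exI[of _ "1 + 1"] allI impI exI conjI ballI)
    fix h :: real and L f assume L: "conv_algebra h M L"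
    show "conv_algebra h (1 + 1) (\<lambda>f x. f x - f x)"
      by (intro conv_algebra.diff conv_algebra.ident)
    show "(\<lambda>x. f x - ((\<lambda>g x. g x - L g x) ^^ 0) f x) = L (\<lambda>x. f x - f x)"
      using conv_algebra_scale[OF L, of 0 f] by simp
  qed
next
  case (Suc n)
  then obtain M' where M': "\<And>h L. 0 < h \<Longrightarrow> conv_algebra h M L \<Longrightarrow> \<exists>U. conv_algebra h M' U \<and>
     (\<forall>f\<in>XB. (\<lambda>x. f x - ((\<lambda>g x. g x - L g x) ^^ n) f x) = L (U f))" by blast
  show ?case
  proof (intro exI[of _ "M' + cmod (- 1) * (1 + M) ^ n"] allI impI)
    fix h :: real and L assume h: "0 < h" and L: "conv_algebra h M L"
    let ?P = "(\<lambda>g x. g x - L g x) ^^ n"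
    obtain U where U: "conv_algebra h M' U" "\<And>f. f \<in> XB \<Longrightarrow> (\<lambda>x. f x - ?P f x) = L (U f)"
      using M'[OF h L] by blast
    have P: "conv_algebra h ((1 + M) ^ n) ?P"
      by (intro conv_algebra_funpow conv_algebra_id_minus L)
    let ?U = "\<lambda>f x. U f x - (- 1) * ?P f x"
    have "conv_algebra h (M' + cmod (- 1) * (1 + M) ^ n) ?U"
      by (intro conv_algebra.diff conv_algebra.scale U P)
    moreover have "(\<lambda>x. f x - ((\<lambda>g x. g x - L g x) ^^ Suc n) f x) = L (?U f)" if f: "f \<in> XB" for f
    proof -
      have "L (?U f) = (\<lambda>x. L (U f) x - L (\<lambda>x. (- 1) * ?P f x) x)"
        by (intro conv_algebra_diff[OF L h] conv_algebra_mem[OF U(1) h f] XB_scale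
            conv_algebra_mem[OF P h f])
      also have "\<dots> = (\<lambda>x. L (U f) x - (- 1) * L (?P f) x)"
        by (simp only: conv_algebra_scale[OF L])
      also have "\<dots> = (\<lambda>x. f x - ((\<lambda>g x. g x - L g x) ^^ Suc n) f x)"
        unfolding U(2)[OF f, symmetric] by (auto simp: fun_eq_iff)
      finally show ?thesis ..
    qed
    ultimately show "\<exists>U. conv_algebra h (M' + cmod (- 1) * (1 + M) ^ n) U \<and>
       (\<forall>f\<in>XB. (\<lambda>x. f x - ((\<lambda>g x. g x - L g x) ^^ Suc n) f x) = L (U f))" by blast
  qed
qed

text \<open>
  Let \<open>B = J E\<^sup>s\<^sup>+\<^sup>1\<close> with \<open>J\<close> the convolution with the Jackson kernel, and \<open>g = f - (1 - B)\<^sup>s f\<close>.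
  The error is \<open>(1 - B)\<^sup>s f\<close>, where \<open>1 - B = (1 - E\<^sup>s\<^sup>+\<^sup>1) + E\<^sup>s\<^sup>+\<^sup>1 - J E\<^sup>s\<^sup>+\<^sup>1\<close> is dominated by \<open>1 - E\<close>. On
  the other hand \<open>g = B (U f) = E\<^sup>s (E J U f)\<close>, whose derivative of order \<open>s\<close> is, up to sign,
  \<open>h\<^sup>-\<^sup>s E J U (1 - E)\<^sup>s f\<close>. The additional factor \<open>E\<close> provides the continuity that the
  derivatives of \<open>E\<^sup>s\<close> require.
\<close>

lemma bandlimited_approximation:
  assumes d: "0 < d"
  obtains C where "0 \<le> C"
    "\<And>h f. 0 < h \<Longrightarrow> f \<in> XB \<Longrightarrow> \<exists>y\<in>XB.
       times_differentiable s (conv h (jackson_kernel d) y) \<and>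
       nth_vderiv s (conv h (jackson_kernel d) y) \<in> XB \<and>
       N (\<lambda>x. f x - conv h (jackson_kernel d) y x) \<le> C * N (((\<lambda>g x. g x - conv h box_kernel g x) ^^ s) f) \<and>
       h ^ s * N (nth_vderiv s (conv h (jackson_kernel d) y))
         \<le> C * N (((\<lambda>g x. g x - conv h box_kernel g x) ^^ s) f)"
proof -
  let ?J = "jackson_kernel d"
  let ?b = "\<lambda>h g x. g x - conv h box_kernel g x"
  let ?e = "\<lambda>h g x. g x - conv h exp_kernel g x"
  define M where "M = (1 + 1 / d\<^sup>2)\<^sup>2 / (LINT t|lborel. sinc (d * t) ^ 4)"
  note J = jackson_kernel_bound[OF d, folded M_def]
  have Jmeas: "?J \<in> borel_measurable borel" using J(2) by (rule kernel_measurable)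
  define MJ where "MJ = 16 * A * M"
  define ME where "ME = 16 * A * 2"
  define c1 where "c1 = 16 * A * (M * (LINT t|lborel. 1 / (1 + t\<^sup>2 :: real)))"
  obtain c0 where c0: "0 \<le> c0" "\<And>h f. 0 < h \<Longrightarrow> f \<in> XB \<Longrightarrow> N (?e h f) \<le> c0 * N (?b h f)"
    using resolvent_dominated_by_box by blast
  obtain MU where MU: "\<And>h L. 0 < h \<Longrightarrow> conv_algebra h (MJ * ME ^ Suc s) L \<Longrightarrow>
      \<exists>U. conv_algebra h MU U \<and> (\<forall>f\<in>XB. (\<lambda>x. f x - ((\<lambda>g x. g x - L g x) ^^ s) f x) = L (U f))"
    using id_minus_power_factor[of "MJ * ME ^ Suc s" s] by blast
  define c2 where "c2 = (\<Sum>i<Suc s. ME ^ i) + c1 * ME ^ s"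
  define C where "C = max ((c2 * c0) ^ s) (ME * (MJ * (\<bar>MU\<bar> * c0 ^ s)))"
  have pos: "0 \<le> MJ" "0 \<le> ME" "0 \<le> c1"
    unfolding MJ_def ME_def c1_def using J(3) A_nonneg by (auto intro!: mult_nonneg_nonneg integral_nonneg_AE)
  have c2: "0 \<le> c2" unfolding c2_def using pos by (auto intro!: add_nonneg_nonneg sum_nonneg)
  show thesis
  proof (rule that[of C])
    show "0 \<le> C" unfolding C_def using c2 c0(1) by (auto simp: le_max_iff_disj)
    fix h :: real and f assume h: "0 < h" and f: "f \<in> XB"
    let ?E = "conv h exp_kernel" and ?K = "conv h ?J"
    have E: "conv_algebra h ME ?E" unfolding ME_def by (rule conv_algebra.convolution[OF kernel_exp])
    have K: "conv_algebra h MJ ?K" unfolding MJ_def by (rule conv_algebra.convolution[OF J(2)])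
    have De: "conv_algebra h (1 + ME) (?e h)" by (rule conv_algebra_id_minus[OF E])
    have Db: "conv_algebra h (1 + 16 * A * 2) (?b h)"
      by (rule conv_algebra_id_minus[OF conv_algebra.convolution[OF kernel_box]])
    note En = conv_algebra_funpow[OF E] and Den = conv_algebra_funpow[OF De]
    define B where "B = (\<lambda>f. ?K ((?E ^^ Suc s) f))"
    have B: "conv_algebra h (MJ * ME ^ Suc s) B"
      unfolding B_def by (rule conv_algebra.compose[OF K En])
    have B1: "N (\<lambda>x. v x - B v x) \<le> c2 * c0 * N (?b h v)" if v: "v \<in> XB" for v
    proof -
      have mem: "(?E ^^ s) v \<in> XB" "(?E ^^ Suc s) v \<in> XB" "B v \<in> XB"
        by (rule conv_algebra_mem[OF En h v] conv_algebra_mem[OF B h v])+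
      have "N (\<lambda>x. v x - B v x) \<le> N (\<lambda>x. v x - (?E ^^ Suc s) v x) + N (\<lambda>x. (?E ^^ Suc s) v x - B v x)"
        by (intro norm_diff_le_via XB_X v mem)
      also have "N (\<lambda>x. v x - (?E ^^ Suc s) v x) \<le> (\<Sum>i<Suc s. ME ^ i) * N (?e h v)"
        by (rule id_minus_funpow_norm[OF E h v])
      also have "N (\<lambda>x. (?E ^^ Suc s) v x - B v x) \<le> c1 * N (?e h ((?E ^^ s) v))"
        using averaged_resolvent_error[OF Jmeas J(1) J(3) integral_jackson_kernel[OF d] mem(1) h]
        unfolding B_def c1_def by simp
      also have "?e h ((?E ^^ s) v) = (?E ^^ s) (?e h v)"
        by (rule conv_algebra_commute[OF De En h v])
      also have "N ((?E ^^ s) (?e h v)) \<le> ME ^ s * N (?e h v)"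
        by (intro conv_algebra_norm[OF En h] conv_algebra_mem[OF De h v])
      finally have "N (\<lambda>x. v x - B v x) \<le> c2 * N (?e h v)"
        using pos(3) by (simp add: c2_def distrib_right mult_left_mono mult.assoc)
      also have "\<dots> \<le> c2 * (c0 * N (?b h v))"
        by (intro mult_left_mono c0 c2 h v)
      finally show ?thesis by (simp add: mult.assoc)
    qed
    obtain U where U: "conv_algebra h MU U"
      "\<And>f. f \<in> XB \<Longrightarrow> (\<lambda>x. f x - ((\<lambda>g x. g x - B g x) ^^ s) f x) = B (U f)"
      using MU[OF h B] by blast
    have Uf: "U f \<in> XB" by (rule conv_algebra_mem[OF U(1) h f])
    define y where "y = (?E ^^ Suc s) (U f)"
    have y: "y \<in> XB" unfolding y_def by (rule conv_algebra_mem[OF En h Uf])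
    have Ky: "?K y = B (U f)" by (simp add: y_def B_def)
    define z where "z = ?E (?K (U f))"
    have KU: "?K (U f) \<in> XB" by (rule conv_algebra_mem[OF K h Uf])
    have z: "z \<in> XB" unfolding z_def by (rule conv_algebra_mem[OF E h KU])
    have zc: "continuous_on UNIV z"
      unfolding z_def using resolvent_continuous[OF KU h] by (auto intro: continuous_at_imp_continuous_on)
    have Kz: "?K y = (?E ^^ s) z"
      unfolding y_def z_def
      using conv_algebra_commute[OF K En h Uf, of "Suc s"] by (simp only: funpow_Suc_right comp_def)
    let ?Q = "\<lambda>g x. complex_of_real (- 1 / h) * ?e h g x"
    have td: "times_differentiable s (?K y)" "nth_vderiv s (?K y) = (?Q ^^ s) z"
      unfolding Kz using resolvent_power_derivative[OF z h zc, of s] by auto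
    have nv: "nth_vderiv s (?K y) = (\<lambda>x. complex_of_real (- 1 / h) ^ s * (?e h ^^ s) z x)"
      unfolding td(2) by (rule scaled_funpow[OF De])
    have Dz: "(?e h ^^ s) z \<in> XB" by (rule conv_algebra_mem[OF Den h z])
    have Df: "(?e h ^^ s) f \<in> XB" by (rule conv_algebra_mem[OF Den h f])
    have "h ^ s * N (nth_vderiv s (?K y)) = N ((?e h ^^ s) z)"
      unfolding nv using h by (subst norm_scale[OF XB_X[OF Dz]]) (simp add: norm_power norm_divide power_divide)
    also have "(?e h ^^ s) z = ?E (?K (U ((?e h ^^ s) f)))"
      unfolding z_def conv_algebra_commute[OF Den E h KU] conv_algebra_commute[OF Den K h Uf]
        conv_algebra_commute[OF Den U(1) h f] ..
    also have "N \<dots> \<le> ME * (MJ * (MU * N ((?e h ^^ s) f)))"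
    proof -
      have u: "U ((?e h ^^ s) f) \<in> XB" by (rule conv_algebra_mem[OF U(1) h Df])
      have "N (?E (?K (U ((?e h ^^ s) f)))) \<le> ME * N (?K (U ((?e h ^^ s) f)))"
        by (rule conv_algebra_norm[OF E h conv_algebra_mem[OF K h u]])
      also have "\<dots> \<le> ME * (MJ * N (U ((?e h ^^ s) f)))"
        by (intro mult_left_mono conv_algebra_norm[OF K h u] pos)
      also have "\<dots> \<le> ME * (MJ * (MU * N ((?e h ^^ s) f)))"
        by (intro mult_left_mono conv_algebra_norm[OF U(1) h Df] pos)
      finally show ?thesis .
    qed
    also have "\<dots> \<le> ME * (MJ * (\<bar>MU\<bar> * (c0 ^ s * N ((?b h ^^ s) f))))"
      by (intro mult_left_mono mult_mono pos funpow_dominated[OF De Db h c0(2)[OF h] c0(1) f] norm_nonneg XB_X Df) auto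
    also have "\<dots> \<le> C * N ((?b h ^^ s) f)"
      unfolding C_def
      using mult_right_mono[OF max.cobounded2, of "N ((?b h ^^ s) f)" "ME * (MJ * (\<bar>MU\<bar> * c0 ^ s))"]
        norm_nonneg[OF XB_X[OF conv_algebra_mem[OF conv_algebra_funpow[OF Db] h f]]]
      by (simp add: mult.assoc)
    finally have 1: "h ^ s * N (nth_vderiv s (?K y)) \<le> C * N ((?b h ^^ s) f)" .
    have "(\<lambda>x. f x - ?K y x) = ((\<lambda>g x. g x - B g x) ^^ s) f"
      unfolding Ky U(2)[OF f, symmetric] by simp
    then have "N (\<lambda>x. f x - ?K y x) \<le> (c2 * c0) ^ s * N ((?b h ^^ s) f)"
      using funpow_dominated[OF conv_algebra_id_minus[OF B] Db h B1 _ f, of s] c2 c0(1) by simp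
    also have "\<dots> \<le> C * N ((?b h ^^ s) f)"
      unfolding C_def
      by (intro mult_right_mono max.cobounded1 norm_nonneg XB_X
          conv_algebra_mem[OF conv_algebra_funpow[OF Db] h f])
    finally have 2: "N (\<lambda>x. f x - ?K y x) \<le> C * N ((?b h ^^ s) f)" .
    have 3: "nth_vderiv s (?K y) \<in> XB" unfolding nv by (rule XB_scale[OF Dz])
    show "\<exists>y\<in>XB. times_differentiable s (?K y) \<and> nth_vderiv s (?K y) \<in> XB \<and>
       N (\<lambda>x. f x - ?K y x) \<le> C * N ((?b h ^^ s) f) \<and>
       h ^ s * N (nth_vderiv s (?K y)) \<le> C * N ((?b h ^^ s) f)"
      using y td(1) 1 2 3 by blast
  qed
qed

end

section \<open>Band-limitedness\<close>

lemma vanishing_integrable: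
  fixes f :: "real \<Rightarrow> complex"
  assumes "continuous_on UNIV f" "\<And>x. R < \<bar>x\<bar> \<Longrightarrow> f x = 0"
  shows "integrable lborel f"
proof -
  have "integrable lborel (\<lambda>x. indicator {-R..R} x *\<^sub>R f x)"
    using borel_integrable_atLeastAtMost'[OF continuous_on_subset[OF assms(1), of "{-R..R}"]]
    by (simp add: set_integrable_def)
  also have "(\<lambda>x. indicator {-R..R} x *\<^sub>R f x) = f"
    using assms(2) by (auto simp: fun_eq_iff indicator_def abs_if)
  finally show ?thesis .
qed

lemma vanishing_derivative:
  fixes f :: "real \<Rightarrow> complex"
  assumes "\<And>x. R < \<bar>x\<bar> \<Longrightarrow> f x = 0" "(f has_vector_derivative f') (at x)" "R < \<bar>x\<bar>"
  shows "f' = 0"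
proof -
  have "open {x. R < \<bar>x\<bar>}" by (intro open_Collect_less continuous_intros)
  then have "((\<lambda>_. 0) has_vector_derivative f') (at x)"
    using assms by (intro has_vector_derivative_transform_within_open[OF assms(2), of "{x. R < \<bar>x\<bar>}"]) auto
  then show ?thesis
    using has_vector_derivative_const vector_derivative_unique_at by blast
qed

lemma fourier_lborel:
  assumes "f \<in> borel_measurable borel"
  shows "fourier f \<xi> = (LINT x|lborel. f x * cis (- (\<xi> * x)))"
proof -
  note [measurable] = assms
  have [measurable]: "cis \<in> borel_measurable borel"
    by (intro borel_measurable_continuous_onI continuous_intros)
  show ?thesis unfolding fourier_def by (rule integral_completion) measurable
qed

lemma fourier_bound:
  assumes "continuous_on UNIV f"
  shows "cmod (fourier f \<xi>) \<le> (LINT x|lborel. cmod (f x))"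
  unfolding fourier_lborel[OF borel_measurable_continuous_onI[OF assms]]
  using integral_norm_bound[of lborel "\<lambda>x. f x * cis (- (\<xi> * x))"] by (simp add: norm_mult)

lemma fourier_derivative:
  assumes deriv: "\<And>x. (f has_vector_derivative f' x) (at x)" and cont: "continuous_on UNIV f'"
    and van: "\<And>x. R < \<bar>x\<bar> \<Longrightarrow> f x = 0"
  shows "fourier f' \<xi> = \<i> * \<xi> * fourier f \<xi>"
proof -
  have cf: "continuous_on UNIV f"
    using deriv by (meson continuous_at_imp_continuous_on has_vector_derivative_continuous)
  have van': "R < \<bar>x\<bar> \<Longrightarrow> f' x = 0" for x
    by (rule vanishing_derivative[OF van deriv])
  let ?c = "\<lambda>x. cis (- (\<xi> * x))"
  let ?S = "\<bar>R\<bar> + 1"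
  have int: "integrable lborel (\<lambda>x. f x * ?c x)" "integrable lborel (\<lambda>x. f' x * ?c x)"
    by (rule vanishing_integrable[where R = R];
        use cf cont van van' in \<open>auto intro!: continuous_intros\<close>)+
  have c: "(?c has_vector_derivative (- \<i> * \<xi>) * ?c x) (at x within T)" for x T
    unfolding has_vector_derivative_complex_iff
    by (auto intro!: derivative_eq_intros)
  have "((\<lambda>x. f x * ?c x) has_vector_derivative f x * ((- \<i> * \<xi>) * ?c x) + f' x * ?c x)
      (at x within {-?S..?S})" for x
    by (intro has_vector_derivative_mult c has_vector_derivative_at_within[OF deriv])
  moreover have "continuous_on {-?S..?S} (\<lambda>x. f x * ((- \<i> * \<xi>) * ?c x) + f' x * ?c x)"
    by (intro continuous_intros continuous_on_subset[OF cf] continuous_on_subset[OF cont]) auto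
  ultimately have "(LINT x|lborel. indicator {-?S..?S} x *\<^sub>R (f x * ((- \<i> * \<xi>) * ?c x) + f' x * ?c x))
      = f ?S * ?c ?S - f (- ?S) * ?c (- ?S)"
    by (intro integral_FTC_atLeastAtMost) auto
  also have "\<dots> = 0" using van[of ?S] van[of "- ?S"] by simp
  finally have zero: "(LINT x|lborel. indicator {-?S..?S} x *\<^sub>R (f x * ((- \<i> * \<xi>) * ?c x) + f' x * ?c x)) = 0" .
  have "indicator {-?S..?S} x *\<^sub>R (f x * ((- \<i> * \<xi>) * ?c x) + f' x * ?c x)
      = (- \<i> * \<xi>) * (f x * ?c x) + f' x * ?c x" for x
    using van[of x] van'[of x] by (auto simp: indicator_def)
  then have "0 = (LINT x|lborel. (- \<i> * \<xi>) * (f x * ?c x) + f' x * ?c x)"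
    using zero by simp
  also have "\<dots> = (- \<i> * \<xi>) * (LINT x|lborel. f x * ?c x) + (LINT x|lborel. f' x * ?c x)"
    using int by (subst Bochner_Integration.integral_add) auto
  finally have "(LINT x|lborel. f' x * ?c x) = \<i> * \<xi> * (LINT x|lborel. f x * ?c x)"
    by (simp add: add_eq_0_iff2)
  then show ?thesis
    unfolding fourier_lborel[OF borel_measurable_continuous_onI[OF cf]]
      fourier_lborel[OF borel_measurable_continuous_onI[OF cont]] .
qed

lemma smooth_fun_derivative:
  assumes "smooth_fun f"
  shows "(nth_vderiv n f has_vector_derivative nth_vderiv (Suc n) f x) (at x)"
    "continuous_on UNIV (nth_vderiv n f)"
proof -
  have diff: "nth_vderiv n f differentiable (at x)" for x
    using assms unfolding smooth_fun_def times_differentiable_def by auto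
  then show "(nth_vderiv n f has_vector_derivative nth_vderiv (Suc n) f x) (at x)"
    by (simp add: nth_vderiv_Suc vector_derivative_works)
  show "continuous_on UNIV (nth_vderiv n f)"
    using diff by (auto intro: continuous_at_imp_continuous_on differentiable_imp_continuous_within)
qed

lemma test_fun_vanishes:
  assumes "\<theta> \<in> test_fun"
  obtains R where "\<And>x. R < \<bar>x\<bar> \<Longrightarrow> \<theta> x = 0"
proof -
  have "bounded (closure {x. \<theta> x \<noteq> 0})"
    using assms by (auto simp: test_fun_def compact_imp_bounded)
  then obtain R where R: "\<And>x. x \<in> closure {x. \<theta> x \<noteq> 0} \<Longrightarrow> \<bar>x\<bar> \<le> R"
    by (auto simp: bounded_iff)
  show thesis
  proof (rule that[of R])
    fix x assume "R < \<bar>x\<bar>"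
    then have "x \<notin> closure {x. \<theta> x \<noteq> 0}" using R[of x] by linarith
    then show "\<theta> x = 0" using closure_subset[of "{x. \<theta> x \<noteq> 0}"] by auto
  qed
qed

lemma fourier_decay:
  assumes "\<theta> \<in> test_fun"
  obtains C where "0 \<le> C" "\<And>\<xi>. cmod (fourier \<theta> \<xi>) \<le> C / (1 + \<xi>\<^sup>2)"
proof -
  have sm: "smooth_fun \<theta>" using assms by (simp add: test_fun_def)
  obtain R where van: "\<And>x. R < \<bar>x\<bar> \<Longrightarrow> \<theta> x = 0"
    using test_fun_vanishes[OF assms] by blast
  note d0 = smooth_fun_derivative(1)[OF sm, of 0, unfolded nth_vderiv_0]
  have c0: "continuous_on UNIV \<theta>"
    using smooth_fun_derivative(2)[OF sm, of 0] by (simp add: nth_vderiv_0)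
  note c = smooth_fun_derivative(2)[OF sm] and d = smooth_fun_derivative(1)[OF sm]
  have van1: "\<And>x. R < \<bar>x\<bar> \<Longrightarrow> nth_vderiv (Suc 0) \<theta> x = 0"
    by (rule vanishing_derivative[OF van d0])
  define C where "C = (LINT x|lborel. cmod (\<theta> x)) + (LINT x|lborel. cmod (nth_vderiv (Suc (Suc 0)) \<theta> x))"
  have "0 \<le> C" unfolding C_def by (intro add_nonneg_nonneg integral_nonneg_AE) auto
  moreover have "cmod (fourier \<theta> \<xi>) \<le> C / (1 + \<xi>\<^sup>2)" for \<xi>
  proof -
    have "fourier (nth_vderiv (Suc (Suc 0)) \<theta>) \<xi> = \<i> * \<xi> * (\<i> * \<xi> * fourier \<theta> \<xi>)"
      using fourier_derivative[OF d[of "Suc 0"] c van1] fourier_derivative[OF d0 c van] by simp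
    then have "\<xi>\<^sup>2 * cmod (fourier \<theta> \<xi>) = cmod (fourier (nth_vderiv (Suc (Suc 0)) \<theta>) \<xi>)"
      by (simp add: norm_mult power2_eq_square)
    also have "\<dots> \<le> (LINT x|lborel. cmod (nth_vderiv (Suc (Suc 0)) \<theta> x))"
      by (rule fourier_bound[OF c])
    finally have "(1 + \<xi>\<^sup>2) * cmod (fourier \<theta> \<xi>) \<le> C"
      using fourier_bound[OF c0, of \<xi>] by (simp add: C_def distrib_right)
    then show ?thesis
      using one_plus_square_pos[of \<xi>] by (simp add: pos_le_divide_eq mult.commute)
  qed
  ultimately show thesis by (rule that)
qed

lemma fourier_measurable:
  assumes "continuous_on UNIV f"
  shows "fourier f \<in> borel_measurable borel"
proof -
  have [measurable]: "f \<in> borel_measurable borel" "cis \<in> borel_measurable borel"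
    by (intro borel_measurable_continuous_onI assms continuous_intros)+
  have "fourier f = (\<lambda>\<xi>. LINT x|lborel. f x * cis (- (\<xi> * x)))"
    by (intro ext fourier_lborel) measurable
  then show ?thesis by simp
qed

lemma fourier_integrable:
  assumes "\<theta> \<in> test_fun"
  shows "integrable lborel (fourier \<theta>)"
proof -
  obtain C where C: "0 \<le> C" "\<And>\<xi>. cmod (fourier \<theta> \<xi>) \<le> C / (1 + \<xi>\<^sup>2)"
    using fourier_decay[OF assms] by blast
  have c: "continuous_on UNIV \<theta>"
    using smooth_fun_derivative(2)[of \<theta> 0] assms by (simp add: test_fun_def nth_vderiv_0)
  show ?thesis
  proof (rule Bochner_Integration.integrable_bound)
    show "integrable lborel (\<lambda>\<xi>. C * (1 / (1 + \<xi>\<^sup>2)))"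
      by (intro integrable_mult_right integrable_inverse_quadratic)
    show "AE \<xi> in lborel. norm (fourier \<theta> \<xi>) \<le> norm (C * (1 / (1 + \<xi>\<^sup>2)))"
      using C by (intro AE_I2) (auto simp: abs_mult)
  qed (simp add: fourier_measurable[OF c])
qed

text \<open>
  Fourier inversion at a point outside the support: \<open>\<theta>\<close> is \<open>(\<xi> - a) \<zeta>\<close> with \<open>\<zeta>\<close> continuously
  differentiable, so the integral of the transform over \<open>[-T, T]\<close> consists of boundary terms,
  namely values of the transform of \<open>\<zeta>\<close> at \<open>T\<close> and \<open>-T\<close>.
\<close>

lemma fourier_inversion_off_support:
  assumes \<theta>: "\<theta> \<in> test_fun" and a: "a \<notin> closure {x. \<theta> x \<noteq> 0}"
  shows "(LINT x|lborel. cis (a * x) * fourier \<theta> x) = 0"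
proof -
  have sm: "smooth_fun \<theta>" using \<theta> by (simp add: test_fun_def)
  obtain R where van: "\<And>x. R < \<bar>x\<bar> \<Longrightarrow> \<theta> x = 0"
    using test_fun_vanishes[OF \<theta>] by blast
  define \<theta>' where "\<theta>' = nth_vderiv (Suc 0) \<theta>"
  have d: "(\<theta> has_vector_derivative \<theta>' x) (at x)" for x
    using smooth_fun_derivative(1)[OF sm, of 0] by (simp add: nth_vderiv_0 \<theta>'_def)
  have c: "continuous_on UNIV \<theta>" and c': "continuous_on UNIV \<theta>'"
    using smooth_fun_derivative(2)[OF sm, of 0] smooth_fun_derivative(2)[OF sm, of 1]
    by (simp_all add: nth_vderiv_0 \<theta>'_def)
  define V where "V = - closure {x. \<theta> x \<noteq> 0}"
  have V: "open V" "a \<in> V" unfolding V_def using a by auto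
  have zero: "\<theta> x = 0" if "x \<in> V" for x
    using that closure_subset[of "{x. \<theta> x \<noteq> 0}"] by (auto simp: V_def)
  have zero': "\<theta>' x = 0" if "x \<in> V" for x
  proof -
    have "((\<lambda>_. 0) has_vector_derivative \<theta>' x) (at x)"
      using has_vector_derivative_transform_within_open[OF d V(1) that] zero by auto
    then show ?thesis using has_vector_derivative_const vector_derivative_unique_at by blast
  qed
  \<comment> \<open>At \<open>a\<close> itself both quotients take the value \<open>0\<close>, which is the right one.\<close>
  define \<zeta> where "\<zeta> x = \<theta> x / complex_of_real (x - a)" for x
  define \<zeta>' where "\<zeta>' x = \<theta>' x / complex_of_real (x - a) - \<theta> x / (complex_of_real (x - a))\<^sup>2" for x
  have \<zeta>: "(\<zeta> has_vector_derivative \<zeta>' x) (at x)" for x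
  proof (cases "x = a")
    case True
    have "((\<lambda>_. 0) has_vector_derivative \<zeta>' x) (at x)"
      using zero zero' V True by (simp add: \<zeta>'_def)
    then show ?thesis
      using V zero True by (elim has_vector_derivative_transform_within_open[where S = V]) (auto simp: \<zeta>_def)
  next
    case False
    have "((\<lambda>x. inverse (complex_of_real (x - a))) has_vector_derivative
        - (inverse (complex_of_real (x - a)) * 1 * inverse (complex_of_real (x - a)))) (at x)"
    proof -
      have "((\<lambda>x. complex_of_real (x - a)) has_vector_derivative 1) (at x)"
        unfolding has_vector_derivative_complex_iff by (auto intro!: derivative_eq_intros)
      then have "((\<lambda>x. complex_of_real (x - a)) has_derivative (\<lambda>t. t *\<^sub>R 1)) (at x)"
        by (simp add: has_vector_derivative_def)
      from Deriv.has_derivative_inverse[OF _ this] False show ?thesis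
        by (simp add: has_vector_derivative_def scaleR_conv_of_real mult_ac)
    qed
    from has_vector_derivative_mult[OF d this] show ?thesis
      unfolding \<zeta>_def[abs_def] \<zeta>'_def by (simp add: divide_inverse power2_eq_square mult_ac)
  qed
  have "isCont \<zeta>' x" for x
  proof (cases "x = a")
    case True
    have "continuous_on V (\<lambda>_. 0 :: complex)" by simp
    then have "continuous_on V \<zeta>'"
      by (rule continuous_on_eq) (simp add: \<zeta>'_def zero zero')
    then show ?thesis using V True by (simp add: continuous_on_eq_continuous_at)
  next
    case False
    have "isCont \<theta> x" "isCont \<theta>' x"
      using c c' by (simp_all add: continuous_on_eq_continuous_at)
    then show ?thesis
      unfolding \<zeta>'_def using False by (intro continuous_intros) auto
  qed
  then have c\<zeta>': "continuous_on UNIV \<zeta>'" by (simp add: continuous_at_imp_continuous_on)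
  have c\<zeta>: "continuous_on UNIV \<zeta>"
    using \<zeta> by (meson continuous_at_imp_continuous_on has_vector_derivative_continuous)
  have van\<zeta>: "R < \<bar>x\<bar> \<Longrightarrow> \<zeta> x = 0" for x by (simp add: \<zeta>_def van)
  define L where "L = (LINT x|lborel. cmod (\<zeta>' x))"
  have F\<zeta>: "\<bar>T\<bar> * cmod (fourier \<zeta> T) \<le> L" for T
  proof -
    have "fourier \<zeta>' T = \<i> * T * fourier \<zeta> T"
      by (rule fourier_derivative[OF \<zeta> c\<zeta>']) (rule van\<zeta>)
    then show ?thesis
      using fourier_bound[OF c\<zeta>', of T] by (simp add: norm_mult L_def)
  qed
  let ?g = "\<lambda>x. cis (a * x) * fourier \<theta> x"
  note [measurable] = fourier_measurable[OF c] borel_measurable_continuous_onI[OF c]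
    borel_measurable_continuous_onI[OF c\<zeta>]
  have [measurable]: "cis \<in> borel_measurable borel"
    by (intro borel_measurable_continuous_onI continuous_intros)
  have int: "integrable lborel ?g"
  proof (rule Bochner_Integration.integrable_bound[OF fourier_integrable[OF \<theta>]])
    show "AE x in lborel. norm (?g x) \<le> norm (fourier \<theta> x)" by (simp add: norm_mult)
  qed measurable
  have trunc: "cmod (LINT x|lborel. indicator {-T..T} x *\<^sub>R ?g x) \<le> 2 * L / T" if T: "0 < T" for T
  proof -
    let ?G = "\<lambda>(x, \<xi>). indicator {-T..T} x *\<^sub>R (\<theta> \<xi> * cis ((a - \<xi>) * x))"
    have int2: "integrable (lborel \<Otimes>\<^sub>M lborel) ?G"
    proof (rule lborel_pair.Fubini_integrable)
      have "(\<lambda>x. LINT \<xi>|lborel. norm (?G (x, \<xi>)))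
          = (\<lambda>x. indicator {-T..T} x *\<^sub>R (LINT \<xi>|lborel. cmod (\<theta> \<xi>)))"
        by (auto simp: norm_mult fun_eq_iff indicator_def)
      then show "integrable lborel (\<lambda>x. LINT \<xi>|lborel. norm (?G (x, \<xi>)))"
        by (auto intro!: integrable_scaleR_left integrable_real_indicator simp: emeasure_lborel_Icc_eq)
      show "AE x in lborel. integrable lborel (\<lambda>\<xi>. ?G (x, \<xi>))"
      proof (rule AE_I2, unfold prod.case, rule integrable_scaleR_right)
        show "integrable lborel (\<lambda>\<xi>. \<theta> \<xi> * cis ((a - \<xi>) * x))" for x
          by (rule vanishing_integrable[where R = R])
             (use van in \<open>auto intro!: continuous_intros continuous_on_subset[OF c]\<close>)
      qed
    qed measurable
    have "(LINT x|lborel. indicator {-T..T} x *\<^sub>R ?g x) = (LINT x|lborel. LINT \<xi>|lborel. ?G (x, \<xi>))"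
    proof (intro Bochner_Integration.integral_cong refl)
      fix x
      have "?g x = (LINT \<xi>|lborel. cis (a * x) * (\<theta> \<xi> * cis (- (x * \<xi>))))"
        by (subst fourier_lborel) auto
      also have "\<dots> = (LINT \<xi>|lborel. \<theta> \<xi> * cis ((a - \<xi>) * x))"
      proof (intro Bochner_Integration.integral_cong refl)
        fix \<xi>
        have "(a - \<xi>) * x = a * x + - (x * \<xi>)" by (simp add: algebra_simps)
        then have "cis ((a - \<xi>) * x) = cis (a * x) * cis (- (x * \<xi>))" by (simp only: cis_mult)
        then show "cis (a * x) * (\<theta> \<xi> * cis (- (x * \<xi>))) = \<theta> \<xi> * cis ((a - \<xi>) * x)"
          by (simp only: mult.left_commute)
      qed
      finally show "indicator {-T..T} x *\<^sub>R ?g x = (LINT \<xi>|lborel. ?G (x, \<xi>))" by simp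
    qed
    also have "\<dots> = (LINT \<xi>|lborel. LINT x|lborel. ?G (x, \<xi>))"
      using lborel_pair.Fubini_integral[of "\<lambda>x \<xi>. ?G (x, \<xi>)"] int2 by simp
    also have "\<dots> = (LINT \<xi>|lborel. (\<zeta> \<xi> * cis (- (- T * \<xi>)) * cis (- (a * T)) - \<zeta> \<xi> * cis (- (T * \<xi>)) * cis (a * T)) / \<i>)"
    proof (intro Bochner_Integration.integral_cong refl)
      fix \<xi>
      have "(LINT x|lborel. ?G (x, \<xi>)) = (LINT x|lborel. \<theta> \<xi> * (indicator {-T..T} x *\<^sub>R cis ((a - \<xi>) * x)))"
        by (intro Bochner_Integration.integral_cong refl) (simp only: prod.case mult_scaleR_right)
      also have "\<dots> = \<theta> \<xi> * (LINT x|lborel. indicator {-T..T} x *\<^sub>R cis ((a - \<xi>) * x))"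
        by (rule integral_mult_right_zero)
      also have "(LINT x|lborel. indicator {-T..T} x *\<^sub>R cis ((a - \<xi>) * x))
          = T *\<^sub>R (LINT w|lborel. indicator {-T..T} (T * w) *\<^sub>R cis ((a - \<xi>) * (T * w)))"
        using T by (subst lborel_integral_real_affine[where c = T and t = 0]) auto
      also have "(LINT w|lborel. indicator {-T..T} (T * w) *\<^sub>R cis ((a - \<xi>) * (T * w)))
          = (LINT w|lborel. indicator {-1..1} w *\<^sub>R cis (((a - \<xi>) * T) * w))"
      proof (intro Bochner_Integration.integral_cong refl)
        fix w
        have "- T \<le> T * w \<longleftrightarrow> - 1 \<le> w" "T * w \<le> T \<longleftrightarrow> w \<le> 1"
          using mult_le_cancel_left_pos[OF T, of "- 1" w] mult_le_cancel_left_pos[OF T, of w 1] by simp_all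
        then show "indicator {-T..T} (T * w) *\<^sub>R cis ((a - \<xi>) * (T * w)) = indicator {-1..1} w *\<^sub>R cis (((a - \<xi>) * T) * w)"
          by (simp add: indicator_def mult.assoc)
      qed
      also have "\<theta> \<xi> * (T *\<^sub>R (LINT w|lborel. indicator {-1..1} w *\<^sub>R cis (((a - \<xi>) * T) * w)))
          = \<zeta> \<xi> * (2 * complex_of_real (sin ((\<xi> - a) * T)))"
      proof (cases "\<xi> = a")
        case True
        then show ?thesis using zero[OF V(2)] by (simp add: \<zeta>_def)
      next
        case False
        have "(a - \<xi>) * T = - ((\<xi> - a) * T)" by (simp add: algebra_simps)
        then have "T * sinc ((a - \<xi>) * T) = sin ((\<xi> - a) * T) / (\<xi> - a)"
          unfolding sinc_def using False T by simp
        then have "complex_of_real T * complex_of_real (sinc ((a - \<xi>) * T))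
            = complex_of_real (sin ((\<xi> - a) * T)) / complex_of_real (\<xi> - a)"
          by (metis of_real_mult of_real_divide)
        moreover have "\<theta> \<xi> * (T *\<^sub>R (2 * S)) = 2 * \<theta> \<xi> * (complex_of_real T * S)" for S
          by (simp add: scaleR_conv_of_real mult_ac)
        ultimately show ?thesis
          unfolding integral_cis \<zeta>_def by simp
      qed
      also have "2 * complex_of_real (sin ((\<xi> - a) * T))
          = (cis (- (- T * \<xi>)) * cis (- (a * T)) - cis (- (T * \<xi>)) * cis (a * T)) / \<i>"
        by (simp add: cis_mult complex_eq_iff Re_divide Im_divide algebra_simps)
           (simp add: cos_diff sin_diff sin_add cos_add)
      finally show "(LINT x|lborel. ?G (x, \<xi>))
          = (\<zeta> \<xi> * cis (- (- T * \<xi>)) * cis (- (a * T)) - \<zeta> \<xi> * cis (- (T * \<xi>)) * cis (a * T)) / \<i>"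
        by (simp add: algebra_simps)
    qed
    also have "\<dots> = (fourier \<zeta> (- T) * cis (- (a * T)) - fourier \<zeta> T * cis (a * T)) / \<i>"
    proof -
      have "integrable lborel (\<lambda>\<xi>. \<zeta> \<xi> * cis (- (S * \<xi>)) * z)" for S z
        by (rule vanishing_integrable[where R = R])
           (use van\<zeta> in \<open>auto intro!: continuous_intros continuous_on_subset[OF c\<zeta>]\<close>)
      from this[of "- T"] this[of T] show ?thesis
        by (simp add: fourier_lborel)
    qed
    finally have "cmod (LINT x|lborel. indicator {-T..T} x *\<^sub>R ?g x) \<le> cmod (fourier \<zeta> (- T)) + cmod (fourier \<zeta> T)"
      using norm_triangle_ineq4[of "fourier \<zeta> (- T) * cis (- (a * T))" "fourier \<zeta> T * cis (a * T)"]
      by (simp add: norm_divide norm_mult)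
    also have "\<dots> \<le> L / T + L / T"
      using F\<zeta>[of T] F\<zeta>[of "- T"] T by (intro add_mono) (simp_all add: pos_le_divide_eq mult.commute)
    finally show ?thesis by simp
  qed
  have "(\<lambda>n. LINT x|lborel. indicator {- real n..real n} x *\<^sub>R ?g x) \<longlonglongrightarrow> (LINT x|lborel. ?g x)"
  proof (rule integral_dominated_convergence[where w = "\<lambda>x. cmod (?g x)"])
    show "AE x in lborel. (\<lambda>n. indicator {- real n..real n} x *\<^sub>R ?g x) \<longlonglongrightarrow> ?g x"
    proof (rule AE_I2)
      fix x :: real
      obtain n0 :: nat where n0: "\<bar>x\<bar> \<le> n0" using real_arch_simple by blast
      have "eventually (\<lambda>n. indicator {- real n..real n} x *\<^sub>R ?g x = ?g x) sequentially"
        using eventually_ge_at_top[of n0] by eventually_elim (use n0 in \<open>auto simp: indicator_def\<close>)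
      then show "(\<lambda>n. indicator {- real n..real n} x *\<^sub>R ?g x) \<longlonglongrightarrow> ?g x"
        by (rule tendsto_eventually)
    qed
  qed (use int fourier_integrable[OF \<theta>] in \<open>auto simp: indicator_def norm_mult\<close>)
  moreover have "(\<lambda>n. LINT x|lborel. indicator {- real n..real n} x *\<^sub>R ?g x) \<longlonglongrightarrow> 0"
  proof (rule Lim_null_comparison)
    show "eventually (\<lambda>n. cmod (LINT x|lborel. indicator {- real n..real n} x *\<^sub>R ?g x) \<le> 2 * L / real n) sequentially"
      using eventually_gt_at_top[of 0] by eventually_elim (rule trunc, simp)
    show "(\<lambda>n. 2 * L / real n) \<longlonglongrightarrow> 0"
      by (rule lim_const_over_n)
  qed
  ultimately show ?thesis by (rule LIMSEQ_unique)
qed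

text \<open>
  Each factor \<open>sinc (d t)\<close> is the mean of the exponentials with frequencies in \<open>[-d, d]\<close>. Replacing
  the factors one after the other reduces the claim to pure exponentials whose frequency, rescaled
  by \<open>h\<close>, stays in the interval on which \<open>\<theta>\<close> vanishes.
\<close>

lemma sinc_power_orthogonal:
  assumes \<theta>: "\<theta> \<in> test_fun" and supp: "closure {x. \<theta> x \<noteq> 0} \<inter> {-\<sigma>..\<sigma>} = {}"
    and h: "0 < h" and d: "0 < d" and b: "\<bar>b\<bar> + real k * d \<le> h * \<sigma>"
  shows "(LINT t|lborel. sinc (d * t) ^ k *\<^sub>R (cis (b * t) * fourier \<theta> (z - h * t))) = 0"
  using b
proof (induction k arbitrary: b)
  case 0
  have "- (b / h) \<in> {-\<sigma>..\<sigma>}"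
    using 0 h by (auto simp: abs_le_iff field_simps)
  then have "(LINT x|lborel. cis (- (b / h) * x) * fourier \<theta> x) = 0"
    using supp by (intro fourier_inversion_off_support[OF \<theta>]) auto
  also have "(LINT x|lborel. cis (- (b / h) * x) * fourier \<theta> x)
      = h *\<^sub>R (LINT t|lborel. cis (- (b / h) * (z - h * t)) * fourier \<theta> (z - h * t))"
    using h by (subst lborel_integral_real_affine[where c = "- h" and t = z]) auto
  also have "(LINT t|lborel. cis (- (b / h) * (z - h * t)) * fourier \<theta> (z - h * t))
      = (LINT t|lborel. cis (- (b / h) * z) * (cis (b * t) * fourier \<theta> (z - h * t)))"
  proof (intro Bochner_Integration.integral_cong refl)
    fix t
    have "- (b / h) * (z - h * t) = - (b / h) * z + b * t"
      using h by (simp add: right_diff_distrib)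
    then have "cis (- (b / h) * (z - h * t)) = cis (- (b / h) * z) * cis (b * t)" by (simp only: cis_mult)
    then show "cis (- (b / h) * (z - h * t)) * fourier \<theta> (z - h * t)
        = cis (- (b / h) * z) * (cis (b * t) * fourier \<theta> (z - h * t))"
      by (simp only: mult.assoc)
  qed
  finally have "h *\<^sub>R (cis (- (b / h) * z) * (LINT t|lborel. cis (b * t) * fourier \<theta> (z - h * t))) = 0"
    by (simp only: integral_mult_right_zero)
  then show ?case using h by simp
next
  case (Suc k)
  have c: "continuous_on UNIV \<theta>"
    using smooth_fun_derivative(2)[of \<theta> 0] \<theta> by (simp add: test_fun_def nth_vderiv_0)
  note [measurable] = fourier_measurable[OF c]
  have [measurable]: "cis \<in> borel_measurable borel"
    by (intro borel_measurable_continuous_onI continuous_intros)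
  let ?F = "\<lambda>t. fourier \<theta> (z - h * t)"
  let ?G = "\<lambda>(w, t). indicator {-1..1} w *\<^sub>R (sinc (d * t) ^ k *\<^sub>R (cis ((b + d * w) * t) * ?F t))"
  have F: "integrable lborel ?F"
    using lborel_integrable_real_affine[OF fourier_integrable[OF \<theta>], of "- h" z] h by simp
  have s1: "\<bar>sinc (d * t)\<bar> ^ k \<le> 1" for t
    using abs_sinc_le_1 by (simp add: power_le_one)
  have int: "integrable (lborel \<Otimes>\<^sub>M lborel) ?G"
  proof (rule lborel_pair.Fubini_integrable)
    have "(\<lambda>w. LINT t|lborel. norm (?G (w, t)))
        = (\<lambda>w. indicator {-1..1} w *\<^sub>R (LINT t|lborel. \<bar>sinc (d * t)\<bar> ^ k * cmod (?F t)))"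
      by (auto simp: norm_mult power_abs fun_eq_iff indicator_def)
    then show "integrable lborel (\<lambda>w. LINT t|lborel. norm (?G (w, t)))"
      by (auto intro!: integrable_scaleR_left integrable_real_indicator)
    show "AE w in lborel. integrable lborel (\<lambda>t. ?G (w, t))"
    proof (rule AE_I2, unfold prod.case, rule integrable_scaleR_right,
        rule Bochner_Integration.integrable_bound[OF F])
      show "AE t in lborel. norm (sinc (d * t) ^ k *\<^sub>R (cis ((b + d * w) * t) * ?F t)) \<le> norm (?F t)" for w
        using s1 by (intro AE_I2) (simp add: norm_mult power_abs mult_left_le_one_le)
    qed measurable
  qed measurable
  have "2 * (LINT t|lborel. sinc (d * t) ^ Suc k *\<^sub>R (cis (b * t) * ?F t))
      = (LINT t|lborel. 2 * (sinc (d * t) ^ Suc k *\<^sub>R (cis (b * t) * ?F t)))"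
    by (rule integral_mult_right_zero[symmetric])
  also have "\<dots> = (LINT t|lborel. LINT w|lborel. ?G (w, t))"
  proof (intro Bochner_Integration.integral_cong refl)
    fix t
    have "2 * (sinc (d * t) ^ Suc k *\<^sub>R (cis (b * t) * ?F t))
        = (2 * complex_of_real (sinc (d * t))) * (sinc (d * t) ^ k *\<^sub>R (cis (b * t) * ?F t))"
      by (simp add: scaleR_conv_of_real mult_ac)
    also have "\<dots> = (LINT w|lborel. (indicator {-1..1} w *\<^sub>R cis ((d * t) * w)) *
        (sinc (d * t) ^ k *\<^sub>R (cis (b * t) * ?F t)))"
      unfolding integral_cis[symmetric] by (rule integral_mult_left_zero[symmetric])
    also have "\<dots> = (LINT w|lborel. ?G (w, t))"
    proof (intro Bochner_Integration.integral_cong refl)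
      fix w
      have "cis ((b + d * w) * t) = cis ((d * t) * w) * cis (b * t)"
        by (simp add: cis_mult algebra_simps)
      then show "(indicator {-1..1} w *\<^sub>R cis ((d * t) * w)) * (sinc (d * t) ^ k *\<^sub>R (cis (b * t) * ?F t)) = ?G (w, t)"
        by (simp add: scaleR_conv_of_real mult_ac)
    qed
    finally show "2 * (sinc (d * t) ^ Suc k *\<^sub>R (cis (b * t) * ?F t)) = (LINT w|lborel. ?G (w, t))" .
  qed
  also have "\<dots> = (LINT w|lborel. LINT t|lborel. ?G (w, t))"
    using lborel_pair.Fubini_integral[of "\<lambda>w t. ?G (w, t)"] int by simp
  also have "\<dots> = (LINT w|(lborel :: real measure). 0)"
  proof (intro Bochner_Integration.integral_cong refl)
    fix w :: real
    show "(LINT t|lborel. ?G (w, t)) = 0"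
    proof (cases "w \<in> {-1..1}")
      case True
      then have "\<bar>d * w\<bar> \<le> d"
        using d by (auto simp: abs_mult abs_le_iff mult_left_le)
      then have "\<bar>b + d * w\<bar> + real k * d \<le> h * \<sigma>"
        using Suc.prems abs_triangle_ineq[of b "d * w"] by (simp add: distrib_right)
      then show ?thesis using Suc.IH[of "b + d * w"] True by simp
    qed simp
  qed
  finally show ?case by simp
qed

lemma schwartz_decay:
  assumes "\<psi> \<in> schwartz"
  shows "cmod (\<psi> x) \<le> (\<Sum>m\<le>2. \<Sum>n\<le>2. schwartz_seminorm m n \<psi>) / (1 + x\<^sup>2)"
    "\<psi> \<in> borel_measurable borel"
proof -
  have sm: "smooth_fun \<psi>" using assms by (simp add: schwartz_def)
  show "\<psi> \<in> borel_measurable borel"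
    using borel_measurable_continuous_onI[OF smooth_fun_derivative(2)[OF sm, of 0]] by (simp add: nth_vderiv_0)
  have le: "cmod (of_real (y ^ m) * nth_vderiv n \<psi> y) \<le> schwartz_seminorm m n \<psi>" for m n y
  proof -
    have "bounded (range (\<lambda>x. of_real (x ^ m) * nth_vderiv n \<psi> x))"
      using assms by (simp add: schwartz_def)
    then obtain B where "\<And>x. cmod (of_real (x ^ m) * nth_vderiv n \<psi> x) \<le> B"
      by (auto simp: bounded_iff)
    then have "bdd_above (range (\<lambda>x. cmod (of_real (x ^ m) * nth_vderiv n \<psi> x)))"
      by (intro bdd_aboveI2[where M = B])
    then show ?thesis unfolding schwartz_seminorm_def by (rule cSUP_upper[OF UNIV_I])
  qed
  have nonneg: "0 \<le> schwartz_seminorm m n \<psi>" for m n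
    using le[of 0 m n] norm_ge_zero order_trans by blast
  have "(1 + x\<^sup>2) * cmod (\<psi> x) \<le> schwartz_seminorm 0 0 \<psi> + schwartz_seminorm 2 0 \<psi>"
    using le[of x 0 0] le[of x 2 0] by (simp add: nth_vderiv_0 norm_mult norm_power distrib_right)
  also have "\<dots> \<le> (\<Sum>m\<le>2. \<Sum>n\<le>2. schwartz_seminorm m n \<psi>)"
    using nonneg by (simp add: numeral_2_eq_2 add_nonneg_nonneg)
  finally show "cmod (\<psi> x) \<le> (\<Sum>m\<le>2. \<Sum>n\<le>2. schwartz_seminorm m n \<psi>) / (1 + x\<^sup>2)"
    using one_plus_square_pos[of x] by (simp add: pos_le_divide_eq mult.commute)
qed

context steklov_lattice
begin

text \<open>
  Since \<open>g / (1 + x\<^sup>2)\<close> is integrable, the distribution is given on all Schwartz functions by the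
  integral itself.
\<close>

lemma XB_tempered:
  assumes g: "g \<in> XB"
  shows "induces_tempered g (\<lambda>\<psi>. LINT x|lebesgue. g x * \<psi> x)"
proof -
  note [measurable] = XB_measurable[OF g]
  have lb: "(LINT x|lebesgue. g x * \<psi> x) = (LINT x|lborel. g x * \<psi> x)" if "\<psi> \<in> schwartz" for \<psi>
  proof -
    note [measurable] = schwartz_decay(2)[OF that]
    show ?thesis by (rule integral_completion) measurable
  qed
  have P: "integrable lborel (\<lambda>x. cmod (g x) / (1 + x\<^sup>2))"
    using poisson_integrable[OF g, of 1 0] by simp
  have bd: "cmod (g x * \<psi> x) \<le> (\<Sum>m\<le>2. \<Sum>n\<le>2. schwartz_seminorm m n \<psi>) * (cmod (g x) / (1 + x\<^sup>2))"
    if "\<psi> \<in> schwartz" for \<psi> x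
    using mult_left_mono[OF schwartz_decay(1)[OF that, of x], of "cmod (g x)"] by (simp add: norm_mult mult_ac)
  have int: "integrable lborel (\<lambda>x. g x * \<psi> x)" if "\<psi> \<in> schwartz" for \<psi>
  proof -
    note [measurable] = schwartz_decay(2)[OF that]
    show ?thesis
      by (rule Bochner_Integration.integrable_bound[OF integrable_mult_right[OF P]])
         (use order_trans[OF bd[OF that] abs_ge_self] in auto)
  qed
  have "tempered (\<lambda>\<psi>. LINT x|lebesgue. g x * \<psi> x)"
    unfolding tempered_def
  proof (intro conjI ballI allI exI)
    fix \<psi> \<theta> assume *: "\<psi> \<in> schwartz" "\<theta> \<in> schwartz"
    note [measurable] = schwartz_decay(2)[OF *(1)] schwartz_decay(2)[OF *(2)]
    have "(LINT x|lebesgue. g x * (\<psi> x + \<theta> x)) = (LINT x|lborel. g x * (\<psi> x + \<theta> x))"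
      by (rule integral_completion) measurable
    then show "(LINT x|lebesgue. g x * (\<psi> x + \<theta> x)) = (LINT x|lebesgue. g x * \<psi> x) + (LINT x|lebesgue. g x * \<theta> x)"
      using int * by (simp add: lb distrib_left)
  next
    fix c \<psi>
    show "(LINT x|lebesgue. g x * (c * \<psi> x)) = c * (LINT x|lebesgue. g x * \<psi> x)"
      by (subst integral_mult_right_zero[symmetric]) (simp add: mult_ac)
  next
    fix \<psi> assume *: "\<psi> \<in> schwartz"
    have "cmod (LINT x|lebesgue. g x * \<psi> x) \<le> (LINT x|lborel. cmod (g x * \<psi> x))"
      unfolding lb[OF *] by (rule integral_norm_bound)
    also have "\<dots> \<le> (LINT x|lborel. (\<Sum>m\<le>2. \<Sum>n\<le>2. schwartz_seminorm m n \<psi>) * (cmod (g x) / (1 + x\<^sup>2)))"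
      by (intro integral_mono integrable_norm int * integrable_mult_right P bd)
    also have "\<dots> = (\<Sum>m\<le>2. \<Sum>n\<le>2. schwartz_seminorm m n \<psi>) * (LINT x|lborel. cmod (g x) / (1 + x\<^sup>2))"
      by (rule integral_mult_right_zero)
    finally show "cmod (LINT x|lebesgue. g x * \<psi> x)
        \<le> (LINT x|lborel. cmod (g x) / (1 + x\<^sup>2)) * (\<Sum>m\<le>2. \<Sum>n\<le>2. schwartz_seminorm m n \<psi>)"
      by (simp only: mult.commute)
  qed
  then show ?thesis by (simp add: induces_tempered_def)
qed

text \<open>
  The rescaled transform of a test function is itself a kernel, and pairing with it is the value
  at \<open>0\<close> of a convolution. Commuting it with the Jackson convolution leaves the convolution of the
  two kernels, which vanishes by orthogonality.
\<close>

lemma jackson_bandlimited: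
  assumes y: "y \<in> XB" and h: "0 < h" and d: "0 < d" and \<sigma>: "4 * d \<le> h * \<sigma>"
  shows "conv h (jackson_kernel d) y \<in> bandlimited X \<sigma>"
proof -
  let ?J = "jackson_kernel d"
  define g where "g = conv h ?J y"
  obtain M where J: "kernel M ?J" using jackson_kernel_bound(2)[OF d] by blast
  have g: "g \<in> XB" unfolding g_def by (rule conv_mem[OF J y h])
  let ?T = "\<lambda>\<psi>. LINT x|lebesgue. g x * \<psi> x"
  have ann: "fourier_dist ?T \<theta> = 0"
    if \<theta>: "\<theta> \<in> test_fun" and supp: "closure {x. \<theta> x \<noteq> 0} \<subseteq> - {-\<sigma>..\<sigma>}" for \<theta>
  proof -
    have c: "continuous_on UNIV \<theta>"
      using smooth_fun_derivative(2)[of \<theta> 0] \<theta> by (simp add: test_fun_def nth_vderiv_0)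
    note [measurable] = fourier_measurable[OF c] XB_measurable[OF g]
    obtain C where C: "0 \<le> C" "\<And>\<xi>. cmod (fourier \<theta> \<xi>) \<le> C / (1 + \<xi>\<^sup>2)"
      using fourier_decay[OF \<theta>] by blast
    have Cb: "cmod (fourier \<theta> (h * u)) * (1 + u\<^sup>2) \<le> C * (1 + 1 / h\<^sup>2)" for u
    proof -
      have "0 \<le> h\<^sup>2 * u\<^sup>2 + 1 / h\<^sup>2" by simp
      then have "1 + u\<^sup>2 \<le> (1 + (h * u)\<^sup>2) * (1 + 1 / h\<^sup>2)"
        using h by (simp add: power_mult_distrib distrib_left distrib_right add_divide_distrib)
      then have "cmod (fourier \<theta> (h * u)) * (1 + u\<^sup>2) \<le> cmod (fourier \<theta> (h * u)) * ((1 + (h * u)\<^sup>2) * (1 + 1 / h\<^sup>2))"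
        by (intro mult_left_mono) auto
      also have "\<dots> \<le> C * (1 + 1 / h\<^sup>2)"
        using C(2)[of "h * u"] one_plus_square_pos[of "h * u"]
        by (subst mult.assoc[symmetric], intro mult_right_mono) (auto simp: pos_le_divide_eq)
      finally show ?thesis .
    qed
    have orth: "(LINT t|lborel. ?J t *\<^sub>R fourier \<theta> (z - h * t)) = 0" for z
    proof -
      have "(LINT t|lborel. sinc (d * t) ^ 4 *\<^sub>R (cis (0 * t) * fourier \<theta> (z - h * t))) = 0"
        by (rule sinc_power_orthogonal[OF \<theta> _ h d]) (use supp \<sigma> in auto)
      then have "(LINT t|lborel. (1 / (LINT t|lborel. sinc (d * t) ^ 4)) *\<^sub>R
          (sinc (d * t) ^ 4 *\<^sub>R fourier \<theta> (z - h * t))) = 0"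
        by (subst integral_scaleR_right) simp
      then show ?thesis by (simp add: jackson_kernel_def)
    qed
    have Jint: "integrable lborel (\<lambda>t. ?J t *\<^sub>R fourier \<theta> (z - h * t))" for z
    proof (rule Bochner_Integration.integrable_bound)
      show "integrable lborel (\<lambda>t. C * ?J t)"
        by (intro integrable_mult_right kernel_integrable[OF J])
      show "AE t in lborel. norm (?J t *\<^sub>R fourier \<theta> (z - h * t)) \<le> norm (C * ?J t)"
      proof (rule AE_I2)
        fix t
        have "C / (1 + (z - h * t)\<^sup>2) \<le> C / 1"
          using C(1) by (intro divide_left_mono) (auto simp: one_plus_square_pos)
        then have "cmod (fourier \<theta> (z - h * t)) \<le> C"
          using C(2)[of "z - h * t"] by linarith
        then have "\<bar>?J t\<bar> * cmod (fourier \<theta> (z - h * t)) \<le> \<bar>?J t\<bar> * C"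
          by (rule mult_left_mono) simp
        then show "norm (?J t *\<^sub>R fourier \<theta> (z - h * t)) \<le> norm (C * ?J t)"
          using C(1) by (simp add: abs_mult mult.commute)
      qed
    qed (use kernel_measurable[OF J] in measurable)
    \<comment> \<open>Kernels are real, hence the separation into real and imaginary part.\<close>
    have part: "conv h (\<lambda>u. P (fourier \<theta> (h * u))) g 0 = 0 \<and>
        integrable lborel (\<lambda>u. P (fourier \<theta> (h * u)) *\<^sub>R g (0 + h * u))"
      if P: "bounded_linear P" "\<And>w. \<bar>P w\<bar> \<le> cmod w" for P :: "complex \<Rightarrow> real"
    proof -
      have [measurable]: "P \<in> borel_measurable borel"
        using P(1) by (intro borel_measurable_continuous_onI linear_continuous_on)
      have k: "kernel (C * (1 + 1 / h\<^sup>2)) (\<lambda>u. P (fourier \<theta> (h * u)))"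
      proof (rule kernelI)
        show "\<bar>P (fourier \<theta> (h * u))\<bar> * (1 + u\<^sup>2) \<le> C * (1 + 1 / h\<^sup>2)" for u
          using mult_right_mono[OF P(2)[of "fourier \<theta> (h * u)"], of "1 + u\<^sup>2"] Cb[of u] by simp
      qed measurable
      have "(LINT t|lborel. ?J t * P (fourier \<theta> (h * (s - t)))) = 0" for s
      proof -
        have "(LINT t|lborel. ?J t * P (fourier \<theta> (h * (s - t))))
            = (LINT t|lborel. P (?J t *\<^sub>R fourier \<theta> (h * s - h * t)))"
          using bounded_linear.linear[OF P(1)] by (simp add: linear_scale right_diff_distrib)
        also have "\<dots> = P (LINT t|lborel. ?J t *\<^sub>R fourier \<theta> (h * s - h * t))"
          by (rule integral_bounded_linear[OF P(1) Jint])
        also have "\<dots> = 0"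
          unfolding orth using bounded_linear.linear[OF P(1)] by (rule linear_0)
        finally show ?thesis .
      qed
      then have "conv h ?J (conv h (\<lambda>u. P (fourier \<theta> (h * u))) y) 0 = 0"
        unfolding conv_conv[OF J k y h] by (simp add: conv_def)
      then show ?thesis
        using conv_commute[OF J k y h] conv_integrable[OF k g h, of 0] by (simp add: g_def)
    qed
    have "?T (fourier \<theta>) = (LINT x|lborel. g x * fourier \<theta> x)"
      by (rule integral_completion) measurable
    also have "\<dots> = h *\<^sub>R (LINT u|lborel. g (0 + h * u) * fourier \<theta> (h * u))"
      using h by (subst lborel_integral_real_affine[where c = h and t = 0]) auto
    also have "(LINT u|lborel. g (0 + h * u) * fourier \<theta> (h * u))
        = (LINT u|lborel. Re (fourier \<theta> (h * u)) *\<^sub>R g (0 + h * u)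
            + \<i> * (Im (fourier \<theta> (h * u)) *\<^sub>R g (0 + h * u)))"
      by (intro Bochner_Integration.integral_cong refl) (simp add: complex_eq_iff)
    also have "\<dots> = conv h (\<lambda>u. Re (fourier \<theta> (h * u))) g 0 + \<i> * conv h (\<lambda>u. Im (fourier \<theta> (h * u))) g 0"
      unfolding conv_def
      using part[OF bounded_linear_Re abs_Re_le_cmod] part[OF bounded_linear_Im abs_Im_le_cmod]
      by (simp only: Bochner_Integration.integral_add integrable_mult_right integral_mult_right_zero)
    also have "\<dots> = 0"
      using part[OF bounded_linear_Re abs_Re_le_cmod] part[OF bounded_linear_Im abs_Im_le_cmod] by simp
    finally show ?thesis by (simp add: fourier_dist_def)
  qed
  have "dist_support (fourier_dist ?T) \<subseteq> {-\<sigma>..\<sigma>}"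
  proof -
    have "open (- {-\<sigma>..\<sigma>})" by (intro open_Compl closed_atLeastAtMost)
    then show ?thesis unfolding dist_support_def using ann by blast
  qed
  then show ?thesis
    unfolding bandlimited_def using XB_tempered[OF g] XB_X[OF g] by (auto simp: g_def)
qed

end

section \<open>Kantorovich operators\<close>

lemma steklov_scale: "steklov h (\<lambda>x. c * f x) = (\<lambda>x. c * steklov h f x)"
  by (simp add: steklov_def fun_eq_iff)

lemma ex_steklov_lattice:
  assumes "banach_lattice X N" "steklov_bounded X N"
  obtains A where "steklov_lattice X N A"
proof -
  interpret banach_lattice X N by (rule assms)
  obtain C where mem: "\<And>f h. f \<in> X \<Longrightarrow> 0 < h \<Longrightarrow> steklov h f \<in> X"
    and C: "\<And>f h. 0 < h \<Longrightarrow> f \<in> X \<Longrightarrow> N f \<le> 1 \<Longrightarrow> N (steklov h f) \<le> C"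
    using assms(2) unfolding steklov_bounded_def by blast
  have le: "N (steklov h f) \<le> \<bar>C\<bar> * N f" if f: "f \<in> X" and h: "0 < h" for f h
  proof (rule field_le_epsilon)
    fix e :: real assume e: "0 < e"
    \<comment> \<open>The detour through \<open>t > N f\<close> covers functions of norm zero, which cannot be normalized.\<close>
    define t where "t = N f + e / (\<bar>C\<bar> + 1)"
    have t: "0 < t" "N f \<le> t"
      using norm_nonneg[OF f] e by (auto simp: t_def add_nonneg_pos)
    have "N (\<lambda>x. complex_of_real (1 / t) * f x) \<le> 1"
      using t norm_scale[OF f, of "complex_of_real (1 / t)"] by (simp add: norm_divide)
    then have "N (steklov h (\<lambda>x. complex_of_real (1 / t) * f x)) \<le> C"
      by (intro C h scale_closed f)
    then have "N (steklov h f) / t \<le> C"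
      unfolding steklov_scale using norm_scale[OF mem[OF f h], of "complex_of_real (1 / t)"] t
      by (simp add: norm_divide)
    then have "N (steklov h f) \<le> \<bar>C\<bar> * t"
      using t by (simp add: pos_divide_le_eq order_trans[OF _ mult_right_mono[OF abs_ge_self]])
    also have "\<dots> \<le> \<bar>C\<bar> * N f + e"
      using e by (simp add: t_def distrib_left pos_divide_le_eq mult.commute distrib_right)
    finally show "N (steklov h f) \<le> \<bar>C\<bar> * N f + e" .
  qed
  have "steklov_lattice X N \<bar>C\<bar>"
    by unfold_locales (use mem le in auto)
  then show thesis by (rule that)
qed

lemma linear_subspace_sum:
  assumes "linear_subspace_of V X" "finite S" "\<And>k. k \<in> S \<Longrightarrow> u k \<in> V"
  shows "(\<lambda>x. \<Sum>k\<in>S. c k * u k x) \<in> V"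
  using assms(2,3)
proof (induction S rule: finite_induct)
  case empty
  then show ?case using assms(1) by (simp add: linear_subspace_of_def)
next
  case (insert k S)
  have add: "(\<lambda>x. f x + g x) \<in> V" if "f \<in> V" "g \<in> V" for f g
    using assms(1) that by (simp add: linear_subspace_of_def)
  have "(\<lambda>x. c k * u k x) \<in> V" "(\<lambda>x. \<Sum>k\<in>S. c k * u k x) \<in> V"
    using assms(1) insert by (simp_all add: linear_subspace_of_def)
  from add[OF this] show ?case using insert by simp
qed

context banach_lattice
begin

lemma steklov_diff_arg:
  assumes "f \<in> X" "g \<in> X"
  shows "steklov h (\<lambda>x. f x - g x) = (\<lambda>x. steklov h f x - steklov h g x)"
  using set_integrable_interval[OF assms(1)] set_integrable_interval[OF assms(2)]
  by (simp add: steklov_def fun_eq_iff diff_divide_distrib)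

lemma steklov_AE_cong:
  assumes "f \<in> X" "g \<in> X" "AE x in lebesgue. f x = g x"
  shows "steklov h f = steklov h g"
proof -
  note [measurable] = measurable[OF assms(1)] measurable[OF assms(2)]
  have "(LINT t:S|lebesgue. f t) = (LINT t:S|lebesgue. g t)" if "S \<in> sets lebesgue" for S
    unfolding set_lebesgue_integral_def using assms(3) that
    by (intro integral_cong_AE) auto
  then show ?thesis by (simp add: steklov_def fun_eq_iff)
qed

text \<open>
  At single points the operators see only \<open>A\<^sub>h f\<close>, which is the same function for all representatives
  of \<open>f\<close>, since the combination has no term of order zero.
\<close>

lemma steklov_comb_AE_cong:
  assumes "f \<in> X" "g \<in> X" "AE x in lebesgue. f x = g x"
  shows "steklov_comb h r f = steklov_comb h r g"
proof -
  have "(steklov h ^^ k) f = (steklov h ^^ k) g" if "k \<in> {1..r}" for k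
  proof -
    obtain j where "k = Suc j" using \<open>k \<in> {1..r}\<close> by (cases k) auto
    then show ?thesis
      by (simp only: funpow_Suc_right comp_def steklov_AE_cong[OF assms])
  qed
  then show ?thesis unfolding steklov_comb_def by (intro ext sum.cong) auto
qed

lemma series_sum_unique:
  assumes "has_series_sum X N u f" "has_series_sum X N u g"
    and part: "\<And>n :: nat. (\<lambda>x. \<Sum>k\<in>{- int n..int n}. u k x) \<in> X"
  shows "N (\<lambda>x. f x - g x) = 0"
proof -
  let ?P = "\<lambda>n x. \<Sum>k\<in>{- int n..int n}. u k x"
  have f: "f \<in> X" "(\<lambda>n. N (\<lambda>x. ?P n x - f x)) \<longlonglongrightarrow> 0"
    and g: "g \<in> X" "(\<lambda>n. N (\<lambda>x. ?P n x - g x)) \<longlonglongrightarrow> 0"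
    using assms(1,2) by (auto simp: has_series_sum_def)
  have "N (\<lambda>x. f x - g x) \<le> N (\<lambda>x. ?P n x - f x) + N (\<lambda>x. ?P n x - g x)" for n
    using norm_diff_le_via[OF f(1) part[of n] g(1)] norm_swap[OF f(1) part[of n]] by simp
  moreover have "(\<lambda>n. N (\<lambda>x. ?P n x - f x) + N (\<lambda>x. ?P n x - g x)) \<longlonglongrightarrow> 0 + 0"
    by (intro tendsto_add f g)
  ultimately have "N (\<lambda>x. f x - g x) \<le> 0"
    by (intro LIMSEQ_le_const[of _ "0 :: real"]) auto
  then show ?thesis using norm_nonneg[OF diff_closed[OF f(1) g(1)]] by simp
qed

text \<open>
  The representatives for different orders of differentiation are continuous from order one on,
  so they coincide and form one smooth function.
\<close>

lemma smooth_representative: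
  assumes rep: "\<And>k. \<exists>F. differentiable_rep k \<psi> F" and "\<psi> \<in> X"
    and mem: "\<And>k. class_deriv k \<psi> \<in> X"
  obtains F where "smooth_fun F" "AE x in lebesgue. F x = \<psi> x" "\<And>k. nth_vderiv k F \<in> X"
    "\<And>k. 1 \<le> k \<Longrightarrow> class_deriv k \<psi> = nth_vderiv k F"
proof -
  obtain F where F: "differentiable_rep 1 \<psi> F" using rep by blast
  have "times_differentiable k F" for k
  proof (cases "k = 0")
    case False
    obtain G where G: "differentiable_rep k \<psi> G" using rep by blast
    have "G = F"
    proof (rule continuous_AE_eq)
      show "continuous_on UNIV G" "continuous_on UNIV F"
        using G F False times_differentiable_imp_continuous[of k G] times_differentiable_imp_continuous[of 1 F]
        unfolding differentiable_rep_def by auto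
      have "AE x in lebesgue. G x = \<psi> x" "AE x in lebesgue. F x = \<psi> x"
        using F G unfolding differentiable_rep_def by auto
      then show "AE x in lebesgue. G x = F x" by eventually_elim simp
    qed
    then show ?thesis using G by (simp add: differentiable_rep_def)
  qed (simp add: times_differentiable_def)
  then have sm: "smooth_fun F" by (simp add: smooth_fun_def)
  have AE: "AE x in lebesgue. F x = \<psi> x" using F by (simp add: differentiable_rep_def)
  have cd: "class_deriv k \<psi> = nth_vderiv k F" if "1 \<le> k" for k
    using sm AE that by (intro class_deriv_eq) (auto simp: differentiable_rep_def smooth_fun_def)
  have "nth_vderiv k F \<in> X" for k
  proof (cases "k = 0")
    case True
    have "F \<in> borel_measurable lebesgue"
      using smooth_fun_derivative(2)[OF sm, of 0]
      by (intro borel_imp_lebesgue borel_measurable_continuous_onI) (simp add: nth_vderiv_0)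
    moreover have "AE x in lebesgue. \<psi> x = F x" using AE by eventually_elim simp
    ultimately show ?thesis
      using AE_eq_mem(1)[OF assms(2)] True by (simp add: nth_vderiv_0)
  next
    case False
    then show ?thesis using cd[of k] mem[of k] by simp
  qed
  then show thesis using that[OF sm AE _ cd] by blast
qed

end

context steklov_lattice
begin

lemma steklov_fwd_eq_conv:
  assumes "f \<in> XB" "0 < h"
  shows "steklov_fwd h f = conv h box_kernel f"
proof
  fix x
  note [measurable] = XB_measurable[OF assms(1)]
  have "(LINT t:{x..x + h}|lebesgue. f t) = (LINT t|lborel. indicator {x..x + h} t *\<^sub>R f t)"
    unfolding set_lebesgue_integral_def by (rule integral_completion) measurable
  also have "\<dots> = h *\<^sub>R (LINT t|lborel. indicator {x..x + h} (x + h * t) *\<^sub>R f (x + h * t))"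
    using assms(2) by (subst lborel_integral_real_affine[where c = h and t = x]) auto
  also have "(LINT t|lborel. indicator {x..x + h} (x + h * t) *\<^sub>R f (x + h * t)) = conv h box_kernel f x"
    unfolding conv_def box_kernel_def using assms(2)
    by (intro Bochner_Integration.integral_cong) (auto simp: indicator_def zero_le_mult_iff)
  finally show "steklov_fwd h f x = conv h box_kernel f x"
    using assms(2) by (simp add: steklov_fwd_def steklov_def scaleR_conv_of_real add.commute)
qed

lemma steklov_diff_eq:
  assumes "f \<in> XB" "0 < h"
  shows "steklov_diff h n f = ((\<lambda>g x. g x - conv h box_kernel g x) ^^ n) f"
  using assms(1)
proof (induction n arbitrary: f)
  case (Suc n)
  have "(\<lambda>x. f x - conv h box_kernel f x) \<in> XB"
    by (intro XB_diff Suc.prems conv_mem[OF kernel_box Suc.prems assms(2)])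
  from Suc.IH[OF this] show ?case
    by (simp only: steklov_diff_def funpow_Suc_right comp_def steklov_fwd_eq_conv[OF Suc.prems assms(2)])
qed (simp add: steklov_diff_def)

lemma steklov_diff_AE_cong:
  assumes "f \<in> X" "g \<in> XB" "AE x in lebesgue. f x = g x" "0 < h"
  shows "steklov_diff h n f \<in> X" "N (steklov_diff h n f) = N (steklov_diff h n g)"
proof -
  have "steklov_diff h n f \<in> X \<and> N (steklov_diff h n f) = N (steklov_diff h n g)"
    using assms(1-3)
  proof (induction n arbitrary: f g)
    case 0
    then show ?case using norm_AE_cong[OF 0(1) XB_X[OF 0(2)] 0(3)] by (simp add: steklov_diff_def)
  next
    case (Suc n)
    note g = Suc.prems(2)
    have eq: "steklov_fwd h f = steklov_fwd h g"
      using steklov_AE_cong[OF Suc.prems(1) XB_X[OF g] Suc.prems(3)] by (simp add: steklov_fwd_def fun_eq_iff)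
    have mem: "steklov_fwd h g \<in> XB"
      unfolding steklov_fwd_eq_conv[OF g assms(4)] by (rule conv_mem[OF kernel_box g assms(4)])
    have "steklov_diff h n (\<lambda>x. f x - steklov_fwd h f x) \<in> X \<and>
        N (steklov_diff h n (\<lambda>x. f x - steklov_fwd h f x)) = N (steklov_diff h n (\<lambda>x. g x - steklov_fwd h g x))"
    proof (rule Suc.IH)
      show "(\<lambda>x. f x - steklov_fwd h f x) \<in> X"
        unfolding eq by (intro diff_closed Suc.prems XB_X mem)
      show "(\<lambda>x. g x - steklov_fwd h g x) \<in> XB" by (intro XB_diff g mem)
      show "AE x in lebesgue. f x - steklov_fwd h f x = g x - steklov_fwd h g x"
        using Suc.prems(3) unfolding eq by eventually_elim simp
    qed
    then show ?case by (simp only: steklov_diff_def funpow_Suc_right comp_def)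
  qed
  then show "steklov_diff h n f \<in> X" "N (steklov_diff h n f) = N (steklov_diff h n g)" by auto
qed

lemma steklov_diff_stable:
  assumes f: "f \<in> X" and g: "g \<in> X" and h: "0 < h"
  shows "N (steklov_diff h n f) \<le> (1 + 32 * A) ^ n * N (\<lambda>x. f x - g x) + N (steklov_diff h n g)"
proof -
  obtain f0 where f0: "f0 \<in> XB" "AE x in lebesgue. f x = f0 x"
    using ex_borel_representative[OF f] by blast
  obtain g0 where g0: "g0 \<in> XB" "AE x in lebesgue. g x = g0 x"
    using ex_borel_representative[OF g] by blast
  let ?D = "\<lambda>g x. g x - conv h box_kernel g x"
  have D: "conv_algebra h ((1 + 16 * A * 2) ^ n) (?D ^^ n)"
    by (intro conv_algebra_funpow conv_algebra_id_minus conv_algebra.convolution kernel_box)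
  have d0: "(\<lambda>x. f0 x - g0 x) \<in> XB" by (intro XB_diff f0 g0)
  have "N ((?D ^^ n) f0) \<le> N (\<lambda>x. (?D ^^ n) f0 x - (?D ^^ n) g0 x) + N ((?D ^^ n) g0)"
    by (intro norm_le_diff_add XB_X conv_algebra_mem[OF D h] f0 g0)
  also have "(\<lambda>x. (?D ^^ n) f0 x - (?D ^^ n) g0 x) = (?D ^^ n) (\<lambda>x. f0 x - g0 x)"
    by (rule conv_algebra_diff[OF D h f0(1) g0(1), symmetric])
  also have "N ((?D ^^ n) (\<lambda>x. f0 x - g0 x)) \<le> (1 + 16 * A * 2) ^ n * N (\<lambda>x. f0 x - g0 x)"
    by (rule conv_algebra_norm[OF D h d0])
  also have "N (\<lambda>x. f0 x - g0 x) = N (\<lambda>x. f x - g x)"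
    by (rule norm_AE_cong[OF diff_closed[OF f g] XB_X[OF d0]])
       (use f0(2) g0(2) in \<open>eventually_elim, simp\<close>)
  finally show ?thesis
    using steklov_diff_AE_cong(2)[OF f f0 h] steklov_diff_AE_cong(2)[OF g g0 h]
      steklov_diff_eq[OF f0(1) h] steklov_diff_eq[OF g0(1) h] by simp
qed

text \<open>
  The sum of the series lies in the closure of \<open>V\<close>, not necessarily in \<open>V\<close>; the partial sums provide
  the approximants from \<open>V\<close>.
\<close>

lemma kantorovich_properties:
  assumes V: "linear_subspace_of V X" and \<phi>: "\<And>k. \<phi> k \<in> V" and h: "0 < h"
    and ex: "\<And>f. f \<in> X \<Longrightarrow> \<exists>g. has_series_sum X N (kantorovich_term h r p \<phi> f) g"
    and bound: "\<And>f. f \<in> X \<Longrightarrow> N (kantorovich X N h r p \<phi> f) \<le> C1 * N f"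
  shows kantorovich_mem: "\<And>f. f \<in> X \<Longrightarrow> kantorovich X N h r p \<phi> f \<in> X"
    and kantorovich_partial_sums: "\<And>f. f \<in> X \<Longrightarrow> \<exists>\<psi> :: nat \<Rightarrow> real \<Rightarrow> complex. (\<forall>n. \<psi> n \<in> V) \<and>
      (\<lambda>n. N (\<lambda>x. \<psi> n x - kantorovich X N h r p \<phi> f x)) \<longlonglongrightarrow> 0"
    and kantorovich_lipschitz: "\<And>f g. f \<in> X \<Longrightarrow> g \<in> X \<Longrightarrow>
      N (\<lambda>x. kantorovich X N h r p \<phi> f x - kantorovich X N h r p \<phi> g x) \<le> C1 * N (\<lambda>x. f x - g x)"
proof -
  let ?K = "kantorovich X N h r p \<phi>" and ?t = "kantorovich_term h r p \<phi>"
  let ?P = "\<lambda>f n x. \<Sum>k\<in>{- int n..int n}. ?t f k x"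
  have sum: "has_series_sum X N (?t f) (?K f)" if "f \<in> X" for f
    unfolding kantorovich_def series_sum_def using ex[OF that] by (rule someI_ex)
  then show mem: "?K f \<in> X" if "f \<in> X" for f
    using that by (auto simp: has_series_sum_def)
  have PV: "?P f n \<in> V" for f n
    unfolding kantorovich_term_def by (intro linear_subspace_sum[OF V] \<phi>) auto
  have PX: "?P f n \<in> X" for f n
    using PV V unfolding linear_subspace_of_def by blast
  show "\<exists>\<psi> :: nat \<Rightarrow> real \<Rightarrow> complex. (\<forall>n. \<psi> n \<in> V) \<and> (\<lambda>n. N (\<lambda>x. \<psi> n x - ?K f x)) \<longlonglongrightarrow> 0"
    if "f \<in> X" for f
    using sum[OF that] PV by (intro exI[of _ "?P f"]) (auto simp: has_series_sum_def)
  have comb: "steklov_comb h r (\<lambda>x. f x - g x) z = steklov_comb h r f z - steklov_comb h r g z"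
    if f: "f \<in> X" and g: "g \<in> X" for f g z
  proof -
    have "(steklov h ^^ k) (\<lambda>x. f x - g x) = (\<lambda>x. (steklov h ^^ k) f x - (steklov h ^^ k) g x) \<and>
        (steklov h ^^ k) f \<in> X \<and> (steklov h ^^ k) g \<in> X" for k
      by (induction k) (use f g in \<open>auto simp: steklov_diff_arg steklov_mem h\<close>)
    then show ?thesis
      by (simp add: steklov_comb_def right_diff_distrib sum_subtractf sum_negf)
  qed
  show "N (\<lambda>x. ?K f x - ?K g x) \<le> C1 * N (\<lambda>x. f x - g x)" if f: "f \<in> X" and g: "g \<in> X" for f g
  proof -
    let ?d = "\<lambda>x. f x - g x"
    have d: "?d \<in> X" by (intro diff_closed f g)
    have KK: "(\<lambda>x. ?K f x - ?K g x) \<in> X" by (intro diff_closed mem f g)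
    have "has_series_sum X N (?t ?d) (\<lambda>x. ?K f x - ?K g x)"
      unfolding has_series_sum_def
    proof (intro conjI KK)
      have le: "N (\<lambda>x. ?P ?d n x - (?K f x - ?K g x)) \<le> N (\<lambda>x. ?P f n x - ?K f x) + N (\<lambda>x. ?P g n x - ?K g x)" for n
      proof -
        have "(\<lambda>x. ?P ?d n x - (?K f x - ?K g x)) = (\<lambda>x. (?P f n x - ?K f x) - (?P g n x - ?K g x))"
          by (simp add: kantorovich_term_def comb[OF f g] left_diff_distrib sum_subtractf fun_eq_iff)
        then show ?thesis
          using norm_diff_triangle[OF diff_closed[OF PX[of f n] mem[OF f]] diff_closed[OF PX[of g n] mem[OF g]]]
          by simp
      qed
      have "(\<lambda>n. N (\<lambda>x. ?P f n x - ?K f x) + N (\<lambda>x. ?P g n x - ?K g x)) \<longlonglongrightarrow> 0 + 0"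
        using sum[OF f] sum[OF g] unfolding has_series_sum_def by (intro tendsto_add) auto
      then have lim: "(\<lambda>n. N (\<lambda>x. ?P f n x - ?K f x) + N (\<lambda>x. ?P g n x - ?K g x)) \<longlonglongrightarrow> 0" by simp
      have nn: "0 \<le> N (\<lambda>x. ?P ?d n x - (?K f x - ?K g x))" for n
        by (intro norm_nonneg diff_closed[OF PX KK])
      show "(\<lambda>n. N (\<lambda>x. ?P ?d n x - (?K f x - ?K g x))) \<longlonglongrightarrow> 0"
        by (rule tendsto_sandwich[OF _ _ tendsto_const lim]) (use le nn in auto)
    qed
    then have "N (\<lambda>x. (?K f x - ?K g x) - ?K ?d x) = 0"
      by (rule series_sum_unique[OF _ sum[OF d] PX])
    then show ?thesis
      using norm_le_diff_add[OF KK mem[OF d]] bound[OF d] by simp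
  qed
qed

end

section \<open>The two-sided estimate\<close>

theorem theorem4p3:
  fixes X :: "(real \<Rightarrow> complex) set"
    and N :: "(real \<Rightarrow> complex) \<Rightarrow> real"
    and \<Phi> :: "real \<Rightarrow> (real \<Rightarrow> complex) set"
    and \<phi> :: "real \<Rightarrow> int \<Rightarrow> real \<Rightarrow> complex"
    and p :: "real \<Rightarrow> int \<Rightarrow> real"
    and K :: "real \<Rightarrow> (real \<Rightarrow> complex) \<Rightarrow> real \<Rightarrow> complex"
    and \<gamma> \<gamma>' C1 C2 C3 :: real
    and r s :: nat
  assumes "K = (\<lambda>\<sigma>. kantorovich X N (\<gamma> / \<sigma>) r (p \<sigma>) (\<phi> \<sigma>))"
    and "banach_lattice X N"
    and "steklov_bounded X N"
    and "1 \<le> r" and "1 \<le> s" and "s \<le> 2 * r"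
    and "bernstein_family X N \<Phi>"
    and "\<And>\<sigma> k. \<sigma> \<ge> 1 \<Longrightarrow> \<phi> \<sigma> k \<in> \<Phi> \<sigma>"
    and "\<gamma> > 0" and "\<gamma>' > 0"
    and "\<And>\<sigma>. \<sigma> \<ge> 1 \<Longrightarrow> inj (p \<sigma>)"
    and "\<And>\<sigma> k. \<sigma> \<ge> 1 \<Longrightarrow> \<gamma> / \<sigma> \<le> p \<sigma> (k + 1) - p \<sigma> k"
    and "\<And>\<sigma> k. \<sigma> \<ge> 1 \<Longrightarrow> p \<sigma> (k + 1) - p \<sigma> k \<le> \<gamma>' / \<sigma>"
    and "\<And>\<sigma> f. \<sigma> \<ge> 1 \<Longrightarrow> f \<in> X \<Longrightarrow>
           \<exists>g. has_series_sum X N (kantorovich_term (\<gamma> / \<sigma>) r (p \<sigma>) (\<phi> \<sigma>) f) g"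
    and "\<not> (\<forall>\<sigma>\<ge>1. \<forall>k. compactly_supported_ae (\<phi> \<sigma> k)) \<Longrightarrow>
           order_continuous_norm X N \<and> dense_in N schwartz X"
    and "C1 > 0" and "C2 > 0" and "C3 > 0"
    and "\<And>\<sigma> f. \<sigma> \<ge> 1 \<Longrightarrow> f \<in> X \<Longrightarrow> N (K \<sigma> f) \<le> C1 * N f"
    and "\<And>\<sigma> g. \<sigma> \<ge> 1 \<Longrightarrow> g \<in> bandlimited X \<sigma> \<Longrightarrow>
           N (\<lambda>x. g x - K \<sigma> g x) \<le> C2 / \<sigma> ^ s * N (class_deriv s g)"
    and "\<And>\<sigma> \<psi>. \<sigma> \<ge> 1 \<Longrightarrow> \<psi> \<in> \<Phi> \<sigma> \<Longrightarrow>
           C3 / \<sigma> ^ s * N (class_deriv s \<psi>) \<le> N (\<lambda>x. \<psi> x - K \<sigma> \<psi> x)"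
  shows "\<exists>c>0. \<exists>C>0. \<forall>f\<in>X. \<forall>\<sigma>\<ge>1.
           c * N (steklov_diff (\<gamma> / \<sigma>) s f) \<le> N (\<lambda>x. f x - K \<sigma> f x) \<and>
           N (\<lambda>x. f x - K \<sigma> f x) \<le> C * N (steklov_diff (\<gamma> / \<sigma>) s f)"
proof -
  note K_def = assms(1) and \<Phi> = assms(7) and \<gamma> = assms(9) and s1 = assms(5)
  obtain A where "steklov_lattice X N A"
    using ex_steklov_lattice[OF assms(2,3)] by blast
  then interpret steklov_lattice X N A .
  have h: "0 < \<gamma> / \<sigma>" if "\<sigma> \<ge> 1" for \<sigma> using \<gamma> that by simp
  have V: "linear_subspace_of (\<Phi> \<sigma>) X" if "\<sigma> \<ge> 1" for \<sigma>
    using \<Phi> that unfolding bernstein_family_def by auto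
  have K_mem: "K \<sigma> f \<in> X" if "\<sigma> \<ge> 1" "f \<in> X" for \<sigma> f
    unfolding K_def
    by (rule kantorovich_mem[OF V[OF that(1)] assms(8)[OF that(1)] h[OF that(1)] assms(14)[OF that(1)] _ that(2)])
       (use assms(19)[OF that(1)] in \<open>auto simp: K_def\<close>)
  have K_lip: "N (\<lambda>x. K \<sigma> f x - K \<sigma> g x) \<le> C1 * N (\<lambda>x. f x - g x)" if "\<sigma> \<ge> 1" "f \<in> X" "g \<in> X" for \<sigma> f g
    unfolding K_def
    by (rule kantorovich_lipschitz[OF V[OF that(1)] assms(8)[OF that(1)] h[OF that(1)] assms(14)[OF that(1)] _ that(2,3)])
       (use assms(19)[OF that(1)] in \<open>auto simp: K_def\<close>)
  have K_part: "\<exists>\<psi> :: nat \<Rightarrow> real \<Rightarrow> complex. (\<forall>n. \<psi> n \<in> \<Phi> \<sigma>) \<and> (\<lambda>n. N (\<lambda>x. \<psi> n x - K \<sigma> f x)) \<longlonglongrightarrow> 0"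
    if "\<sigma> \<ge> 1" "f \<in> X" for \<sigma> f
    unfolding K_def
    by (rule kantorovich_partial_sums[OF V[OF that(1)] assms(8)[OF that(1)] h[OF that(1)] assms(14)[OF that(1)] _ that(2)])
       (use assms(19)[OF that(1)] in \<open>auto simp: K_def\<close>)
  define cD where "cD = (1 + 32 * A) ^ s"
  define cB where "cB = (32 * A * \<gamma>) ^ s / C3"
  have cD: "1 \<le> cD" unfolding cD_def using A_nonneg by (intro one_le_power) auto
  have cB: "0 \<le> cB" unfolding cB_def using A_nonneg \<gamma> assms(18) by (intro divide_nonneg_pos zero_le_power) auto
  have lower: "N (steklov_diff (\<gamma> / \<sigma>) s f) \<le> (cD + cB * C1) * N (\<lambda>x. f x - K \<sigma> f x)"
    if \<sigma>: "\<sigma> \<ge> 1" and f: "f \<in> X" for \<sigma> f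
  proof -
    \<comment> \<open>The estimate passes through the partial sums \<open>\<psi> n\<close> of \<open>K \<sigma> f\<close>, with errors \<open>?e n\<close> tending to \<open>0\<close>.\<close>
    let ?h = "\<gamma> / \<sigma>" and ?Kf = "K \<sigma> f"
    note Kf = K_mem[OF \<sigma> f]
    obtain \<psi> :: "nat \<Rightarrow> real \<Rightarrow> complex" where \<psi>: "\<And>n. \<psi> n \<in> \<Phi> \<sigma>"
      and lim: "(\<lambda>n. N (\<lambda>x. \<psi> n x - ?Kf x)) \<longlonglongrightarrow> 0"
      using K_part[OF \<sigma> f] by blast
    let ?e = "\<lambda>n. N (\<lambda>x. \<psi> n x - ?Kf x)" and ?d = "N (\<lambda>x. f x - ?Kf x)"
    have \<psi>X: "\<psi> n \<in> X" for n using \<psi> V[OF \<sigma>] unfolding linear_subspace_of_def by blast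
    have smooth: "N (steklov_diff ?h s (\<psi> n)) \<le> cB * N (\<lambda>x. \<psi> n x - K \<sigma> (\<psi> n) x)" for n
    proof -
      have rep: "\<exists>F. differentiable_rep k (\<psi> n) F" "class_deriv k (\<psi> n) \<in> X" for k
        using \<Phi> \<psi>[of n] \<sigma> unfolding bernstein_family_def by (metis order_trans zero_le_one)+
      obtain F where F: "smooth_fun F" "AE x in lebesgue. F x = \<psi> n x" "\<And>k. nth_vderiv k F \<in> X"
        "\<And>k. 1 \<le> k \<Longrightarrow> class_deriv k (\<psi> n) = nth_vderiv k F"
        using smooth_representative[OF rep(1) \<psi>X rep(2)] by blast
      have FB: "F \<in> XB"
        using F(3)[of 0] borel_measurable_continuous_onI[OF smooth_fun_derivative(2)[OF F(1), of 0]]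
        by (simp add: XB_def nth_vderiv_0)
      have "AE x in lebesgue. \<psi> n x = F x" using F(2) by eventually_elim simp
      then have "N (steklov_diff ?h s (\<psi> n)) = N (steklov_diff ?h s F)"
        by (rule steklov_diff_AE_cong(2)[OF \<psi>X FB _ h[OF \<sigma>]])
      also have "\<dots> \<le> (32 * A * ?h) ^ s * N (nth_vderiv s F)"
        unfolding steklov_diff_eq[OF FB h[OF \<sigma>]]
        by (rule one_minus_box_power_of_smooth[OF F(1) F(3) h[OF \<sigma>]])
      also have "\<dots> = cB * (C3 / \<sigma> ^ s * N (class_deriv s (\<psi> n)))"
        using F(4)[OF s1] assms(18) by (simp add: cB_def power_divide)
      also have "\<dots> \<le> cB * N (\<lambda>x. \<psi> n x - K \<sigma> (\<psi> n) x)"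
        by (intro mult_left_mono assms(21) \<sigma> \<psi> cB)
      finally show ?thesis .
    qed
    have "N (steklov_diff ?h s f) \<le> cD * (?d + ?e n) + cB * ((?e n + C1 * ?d) + C1 * ?e n)" for n
    proof -
      have 1: "N (\<lambda>x. f x - \<psi> n x) \<le> ?d + ?e n"
        using norm_diff_le_via[OF f Kf \<psi>X[of n]] norm_swap[OF Kf \<psi>X[of n]] by simp
      have 2: "N (\<lambda>x. \<psi> n x - K \<sigma> (\<psi> n) x) \<le> (?e n + C1 * ?d) + C1 * ?e n"
      proof -
        have "N (\<lambda>x. \<psi> n x - K \<sigma> ?Kf x) \<le> ?e n + N (\<lambda>x. ?Kf x - K \<sigma> ?Kf x)"
          by (intro norm_diff_le_via \<psi>X Kf K_mem \<sigma>)
        moreover have "N (\<lambda>x. ?Kf x - K \<sigma> ?Kf x) \<le> C1 * ?d"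
          by (rule K_lip[OF \<sigma> f Kf])
        moreover have "N (\<lambda>x. K \<sigma> ?Kf x - K \<sigma> (\<psi> n) x) \<le> C1 * ?e n"
          using K_lip[OF \<sigma> Kf \<psi>X[of n]] norm_swap[OF Kf \<psi>X[of n]] by simp
        moreover have "N (\<lambda>x. \<psi> n x - K \<sigma> (\<psi> n) x)
            \<le> N (\<lambda>x. \<psi> n x - K \<sigma> ?Kf x) + N (\<lambda>x. K \<sigma> ?Kf x - K \<sigma> (\<psi> n) x)"
          by (intro norm_diff_le_via \<psi>X Kf K_mem \<sigma>)
        ultimately show ?thesis by linarith
      qed
      have "N (steklov_diff ?h s f) \<le> cD * N (\<lambda>x. f x - \<psi> n x) + N (steklov_diff ?h s (\<psi> n))"
        unfolding cD_def by (rule steklov_diff_stable[OF f \<psi>X h[OF \<sigma>]])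
      also have "\<dots> \<le> cD * (?d + ?e n) + cB * ((?e n + C1 * ?d) + C1 * ?e n)"
        using cD cB order_trans[OF smooth[of n] mult_left_mono[OF 2 cB]]
        by (intro add_mono mult_left_mono 1) auto
      finally show ?thesis .
    qed
    moreover have "(\<lambda>n. cD * (?d + ?e n) + cB * ((?e n + C1 * ?d) + C1 * ?e n))
        \<longlonglongrightarrow> cD * (?d + 0) + cB * ((0 + C1 * ?d) + C1 * 0)"
      by (intro tendsto_intros lim)
    ultimately have "N (steklov_diff ?h s f) \<le> cD * (?d + 0) + cB * ((0 + C1 * ?d) + C1 * 0)"
      by (intro LIMSEQ_le_const) auto
    then show ?thesis by (simp add: algebra_simps)
  qed
  \<comment> \<open>Band width \<open>4 d / h = \<sigma>\<close> for the fourth power of the cardinal sine.\<close>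
  define d where "d = \<gamma> / 4"
  have d: "0 < d" using \<gamma> by (simp add: d_def)
  obtain C where C: "0 \<le> C" "\<And>h f. 0 < h \<Longrightarrow> f \<in> XB \<Longrightarrow> \<exists>y\<in>XB.
       times_differentiable s (conv h (jackson_kernel d) y) \<and>
       nth_vderiv s (conv h (jackson_kernel d) y) \<in> XB \<and>
       N (\<lambda>x. f x - conv h (jackson_kernel d) y x) \<le> C * N (((\<lambda>g x. g x - conv h box_kernel g x) ^^ s) f) \<and>
       h ^ s * N (nth_vderiv s (conv h (jackson_kernel d) y))
         \<le> C * N (((\<lambda>g x. g x - conv h box_kernel g x) ^^ s) f)"
    using bandlimited_approximation[OF d, of s] by blast
  define cU where "cU = (1 + C1) * C + C2 / \<gamma> ^ s * C"
  have cU: "0 \<le> cU" unfolding cU_def using C(1) assms(16,17) \<gamma> by simp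
  have upper: "N (\<lambda>x. f x - K \<sigma> f x) \<le> cU * N (steklov_diff (\<gamma> / \<sigma>) s f)"
    if \<sigma>: "\<sigma> \<ge> 1" and f: "f \<in> X" for \<sigma> f
  proof -
    let ?h = "\<gamma> / \<sigma>"
    obtain f0 where f0: "f0 \<in> XB" "AE x in lebesgue. f x = f0 x"
      using ex_borel_representative[OF f] by blast
    note f0X = XB_X[OF f0(1)]
    have "kantorovich_term ?h r (p \<sigma>) (\<phi> \<sigma>) f = kantorovich_term ?h r (p \<sigma>) (\<phi> \<sigma>) f0"
      using steklov_comb_AE_cong[OF f f0X f0(2)] by (simp add: kantorovich_term_def fun_eq_iff)
    then have K0: "K \<sigma> f = K \<sigma> f0" by (simp add: K_def kantorovich_def)
    let ?D = "N (steklov_diff ?h s f)"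
    have D: "?D = N (((\<lambda>g x. g x - conv ?h box_kernel g x) ^^ s) f0)"
      using steklov_diff_AE_cong(2)[OF f f0 h[OF \<sigma>]] steklov_diff_eq[OF f0(1) h[OF \<sigma>]] by simp
    obtain y where y: "y \<in> XB" and app:
       "times_differentiable s (conv ?h (jackson_kernel d) y)"
       "N (\<lambda>x. f0 x - conv ?h (jackson_kernel d) y x) \<le> C * ?D"
       "?h ^ s * N (nth_vderiv s (conv ?h (jackson_kernel d) y)) \<le> C * ?D"
      using C(2)[OF h[OF \<sigma>] f0(1)] unfolding D by blast
    define g where "g = conv ?h (jackson_kernel d) y"
    have gB: "g \<in> bandlimited X \<sigma>"
      unfolding g_def using \<sigma> by (intro jackson_bandlimited[OF y h[OF \<sigma>] d]) (simp add: d_def)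
    then have gX: "g \<in> X" by (simp add: bandlimited_def)
    have cd: "class_deriv s g = nth_vderiv s g"
      using app(1) s1 by (intro class_deriv_eq) (auto simp: differentiable_rep_def g_def)
    have "N (\<lambda>x. f x - K \<sigma> f x) = N (\<lambda>x. f0 x - K \<sigma> f0 x)"
      unfolding K0
      by (rule norm_AE_cong[OF diff_closed[OF f0X K_mem[OF \<sigma> f0X]] diff_closed[OF f K_mem[OF \<sigma> f0X]]])
         (use f0(2) in \<open>eventually_elim, simp\<close>)
    also have "\<dots> \<le> N (\<lambda>x. f0 x - g x) + N (\<lambda>x. g x - K \<sigma> f0 x)"
      by (intro norm_diff_le_via f0X gX K_mem \<sigma>)
    also have "N (\<lambda>x. g x - K \<sigma> f0 x) \<le> N (\<lambda>x. g x - K \<sigma> g x) + N (\<lambda>x. K \<sigma> g x - K \<sigma> f0 x)"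
      by (intro norm_diff_le_via f0X gX K_mem \<sigma>)
    also have "N (\<lambda>x. K \<sigma> g x - K \<sigma> f0 x) \<le> C1 * N (\<lambda>x. f0 x - g x)"
      using K_lip[OF \<sigma> gX f0X] norm_swap[OF gX f0X] by simp
    also have "N (\<lambda>x. g x - K \<sigma> g x) \<le> C2 / \<gamma> ^ s * (C * ?D)"
    proof -
      have "N (\<lambda>x. g x - K \<sigma> g x) \<le> C2 / \<sigma> ^ s * N (class_deriv s g)"
        by (rule assms(20)[OF \<sigma> gB])
      also have "\<dots> = C2 / \<gamma> ^ s * (?h ^ s * N (nth_vderiv s g))"
        using \<gamma> by (simp add: cd power_divide)
      also have "\<dots> \<le> C2 / \<gamma> ^ s * (C * ?D)"
        using app(3) assms(17) \<gamma> by (intro mult_left_mono) (auto simp: g_def)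
      finally show ?thesis .
    qed
    finally have "N (\<lambda>x. f x - K \<sigma> f x) \<le> (1 + C1) * N (\<lambda>x. f0 x - g x) + C2 / \<gamma> ^ s * (C * ?D)"
      by (simp add: distrib_right)
    also have "\<dots> \<le> (1 + C1) * (C * ?D) + C2 / \<gamma> ^ s * (C * ?D)"
      using app(2) assms(16) by (intro add_right_mono mult_left_mono) (auto simp: g_def)
    finally show ?thesis by (simp add: cU_def distrib_right mult.assoc)
  qed
  have nn: "0 \<le> N (steklov_diff (\<gamma> / \<sigma>) s f)" if "\<sigma> \<ge> 1" "f \<in> X" for \<sigma> f
    using ex_borel_representative[OF that(2)] steklov_diff_AE_cong(1)[OF that(2) _ _ h[OF that(1)]]
    by (metis norm_nonneg)
  have cL: "0 < cD + cB * C1" using cD cB assms(16) by (simp add: add_pos_nonneg)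
  show ?thesis
  proof (intro exI conjI ballI allI impI)
    show "0 < 1 / (cD + cB * C1)" using cL by simp
    show "0 < cU + 1" using cU by simp
    fix f \<sigma> assume f: "f \<in> X" and \<sigma>: "(1::real) \<le> \<sigma>"
    show "1 / (cD + cB * C1) * N (steklov_diff (\<gamma> / \<sigma>) s f) \<le> N (\<lambda>x. f x - K \<sigma> f x)"
      using lower[OF \<sigma> f] cL by (simp add: pos_divide_le_eq mult.commute)
    show "N (\<lambda>x. f x - K \<sigma> f x) \<le> (cU + 1) * N (steklov_diff (\<gamma> / \<sigma>) s f)"
      using upper[OF \<sigma> f] nn[OF \<sigma> f] by (simp add: distrib_right)
  qed
qed

end
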